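(* Let $X=\{x_j\}_1^\infty$ be a sequence of pairwise distinct points of $\mathbb{R}^3$ and let $\varphi_j(x)=\dfrac{e^{-|x-x_j|}}{|x-x_j|}$, $x\in\mathbb{R}^3$, $j\in\mathbb{N}$. The sequence $E=\{\varphi_j\}_1^\infty$ forms a Riesz basis of the Hilbert space $\mathfrak{N}_{-1}$ if and only if $d_*(X)>0$.
   Context: $d_*(X):=\inf_{k\neq j}|x_k-x_j|$. $-\Delta$ is the self-adjoint Laplacian on $L^2(\mathbb{R}^3)$ with domain $W^{2,2}(\mathbb{R}^3)$, and $H$ is its restriction to $\operatorname{dom}H=\{f\in W^{2,2}(\mathbb{R}^3): f(x_j)=0\text{ for all }j\in\mathbb{N}\}$. $\mathfrak{N}_{-1}$ is the defect subspace of $H$ at $-1$, i.e. the orthogonal complement of $\operatorname{ran}(H+I)$ in $L^2(\mathbb{R}^3)$ (equal to $\ker(H^*+I)$ when $H$ is densely defined). A sequence $\{f_k\}$ in a Hilbert space $\mathcal{H}$ is a Riesz basis of $\mathcal{H}$ if its linear span is dense in $\mathcal{H}$ and there are constants $c,C>0$ such that $c\sum_{k=1}^m|\xi_k|^2\le\|\sum_{k=1}^m\xi_kf_k\|^2\le C\sum_{k=1}^m|\xi_k|^2$ for all $m\in\mathbb{N}$ and $\xi_1,\dots,\xi_m\in\mathbb{C}$. *)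

theory Defs
  imports "HOL-Analysis.Analysis"
begin

section \<open>The Hilbert space of square-integrable functions on three-space\<close>

text \<open>
  Elements of \<open>L\<^sup>2(\<real>\<^sup>3)\<close> are represented by square-integrable Borel functions rather than by
  classes modulo equality almost everywhere. Accordingly \<open>L2_norm\<close> is only a seminorm on
  functions, and the domain, range and defect subspace below are sets of functions closed under
  almost everywhere equality (within Borel functions), i.e. preimages of the corresponding sets of
  classes.
  The one place where pointwise values matter, evaluation at a point, goes through the continuous
  representative, see \<open>dom_H\<close>.
\<close>

definition L2 :: "(real^3 \<Rightarrow> complex) set" where
  "L2 = {f. f \<in> borel_measurable lborel \<and> integrable lborel (\<lambda>x. (cmod (f x))\<^sup>2)}"

definition L2_inner :: "(real^3 \<Rightarrow> complex) \<Rightarrow> (real^3 \<Rightarrow> complex) \<Rightarrow> complex" where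
  "L2_inner f g = (LINT x|lborel. f x * cnj (g x))"

definition L2_norm :: "(real^3 \<Rightarrow> complex) \<Rightarrow> real" where
  "L2_norm f = sqrt (LINT x|lborel. (cmod (f x))\<^sup>2)"

definition L2_orthogonal_complement :: "(real^3 \<Rightarrow> complex) set \<Rightarrow> (real^3 \<Rightarrow> complex) set" where
  "L2_orthogonal_complement S = {g \<in> L2. \<forall>h\<in>S. L2_inner g h = 0}"


section \<open>Weak derivatives and the Sobolev space of order two\<close>

definition partial_deriv :: "3 \<Rightarrow> (real^3 \<Rightarrow> complex) \<Rightarrow> real^3 \<Rightarrow> complex" where
  "partial_deriv i f x = vector_derivative (\<lambda>t. f (x + t *\<^sub>R axis i 1)) (at 0)"

text \<open>
  Multi-indices are given as lists of coordinate directions. On smooth functions the order of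
  the list is immaterial.
\<close>

definition partial_derivs :: "3 list \<Rightarrow> (real^3 \<Rightarrow> complex) \<Rightarrow> real^3 \<Rightarrow> complex" where
  "partial_derivs is f = foldr partial_deriv is f"

definition smooth :: "(real^3 \<Rightarrow> complex) \<Rightarrow> bool" where
  "smooth f \<longleftrightarrow> (\<forall>is. continuous_on UNIV (partial_derivs is f) \<and>
     (\<forall>i x. (\<lambda>t. partial_derivs is f (x + t *\<^sub>R axis i 1)) differentiable (at (0::real))))"

definition test_functions :: "(real^3 \<Rightarrow> complex) set" where
  "test_functions = {\<phi>. smooth \<phi> \<and> compact (closure {x. \<phi> x \<noteq> 0})}"

definition has_weak_deriv :: "(real^3 \<Rightarrow> complex) \<Rightarrow> 3 list \<Rightarrow> (real^3 \<Rightarrow> complex) \<Rightarrow> bool" where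
  "has_weak_deriv f is g \<longleftrightarrow> (\<forall>\<phi>\<in>test_functions.
     (LINT x|lborel. f x * partial_derivs is \<phi> x) = (-1) ^ length is * (LINT x|lborel. g x * \<phi> x))"

definition W22 :: "(real^3 \<Rightarrow> complex) set" where
  "W22 = {f \<in> L2. \<forall>is. length is \<le> 2 \<longrightarrow> (\<exists>g\<in>L2. has_weak_deriv f is g)}"

text \<open>
  The choice below selects a representative; for \<open>f\<close> in \<open>W22\<close> and \<open>length is \<le> 2\<close> it exists and
  is unique almost everywhere.
\<close>

definition weak_deriv :: "3 list \<Rightarrow> (real^3 \<Rightarrow> complex) \<Rightarrow> real^3 \<Rightarrow> complex" where
  "weak_deriv is f = (SOME g. g \<in> L2 \<and> has_weak_deriv f is g)"


section \<open>The restricted Laplacian and its defect subspace\<close>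

definition neg_laplacian :: "(real^3 \<Rightarrow> complex) \<Rightarrow> real^3 \<Rightarrow> complex" where
  "neg_laplacian f x = - (\<Sum>i\<in>UNIV. weak_deriv [i, i] f x)"

text \<open>
  Functions in \<open>W\<^sup>2\<^sup>,\<^sup>2(\<real>\<^sup>3)\<close> have a unique continuous representative (Sobolev embedding), and
  the values \<open>f(x\<^sub>j)\<close> are those of this representative.
\<close>

definition dom_H :: "(nat \<Rightarrow> real^3) \<Rightarrow> (real^3 \<Rightarrow> complex) set" where
  "dom_H X = {f \<in> W22. \<exists>g. continuous_on UNIV g \<and> (AE x in lborel. f x = g x) \<and> (\<forall>j. g (X j) = 0)}"

definition ran_H_plus_I :: "(nat \<Rightarrow> real^3) \<Rightarrow> (real^3 \<Rightarrow> complex) set" where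
  "ran_H_plus_I X = (\<lambda>f x. neg_laplacian f x + f x) ` dom_H X"

definition defect_subspace :: "(nat \<Rightarrow> real^3) \<Rightarrow> (real^3 \<Rightarrow> complex) set" where
  "defect_subspace X = L2_orthogonal_complement (ran_H_plus_I X)"


section \<open>Riesz bases\<close>

definition linear_span :: "(nat \<Rightarrow> real^3 \<Rightarrow> complex) \<Rightarrow> (real^3 \<Rightarrow> complex) set" where
  "linear_span F = {\<lambda>x. \<Sum>k<m. \<xi> k * F k x | m \<xi>. True}"

definition riesz_basis :: "(nat \<Rightarrow> real^3 \<Rightarrow> complex) \<Rightarrow> (real^3 \<Rightarrow> complex) set \<Rightarrow> bool" where
  "riesz_basis F N \<longleftrightarrow>
     (\<forall>k. F k \<in> N) \<and>
     (\<forall>g\<in>N. \<forall>\<epsilon>>0. \<exists>h\<in>linear_span F. L2_norm (\<lambda>x. g x - h x) < \<epsilon>) \<and>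
     (\<exists>c>0. \<exists>C>0. \<forall>m (\<xi> :: nat \<Rightarrow> complex).
        c * (\<Sum>k<m. (cmod (\<xi> k))\<^sup>2) \<le> (L2_norm (\<lambda>x. \<Sum>k<m. \<xi> k * F k x))\<^sup>2 \<and>
        (L2_norm (\<lambda>x. \<Sum>k<m. \<xi> k * F k x))\<^sup>2 \<le> C * (\<Sum>k<m. (cmod (\<xi> k))\<^sup>2))"


section \<open>The point configuration\<close>

definition d_star :: "(nat \<Rightarrow> real^3) \<Rightarrow> real" where
  "d_star X = Inf {norm (X k - X j) | k j. k \<noteq> j}"

text \<open>At \<open>x = X j\<close> the quotient is \<open>0\<close> by the convention \<open>a / 0 = 0\<close>; this is a null set.\<close>

definition phi :: "(nat \<Rightarrow> real^3) \<Rightarrow> nat \<Rightarrow> real^3 \<Rightarrow> complex" where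
  "phi X j x = complex_of_real (exp (- norm (x - X j)) / norm (x - X j))"

end

(*
  Since exp (- r) / r is a multiple of the Green function of 1 - Delta, pairing phi X j with
  (1 - Delta) f evaluates f at X j up to a positive constant.  Hence phi X j lies in the defect
  subspace.  When the points are separated by d > 0, take disjointly supported bumps rho_j of
  radius d / 2 with rho_j (X k) = 1 if j = k and 0 otherwise.  Pairing sum_k xi_k phi_k with
  (1 - Delta) (sum_j cnj xi_j rho_j) gives the lower Riesz bound; the upper bound is a pointwise
  Cauchy-Schwarz estimate.  If g is in the defect subspace and a_j is its pairing with
  (1 - Delta) rho_j, then (a_j) is square summable, and g and the sum of the a_j phi_j / (4 pi) have the
  same pairings with (1 - Delta) f for all test functions f.  An L2 function orthogonal to all
  (1 - Delta) f vanishes, so the two agree.  This gives completeness of the system without solving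
  (1 - Delta) f = u in the Sobolev space.  Conversely, norm (phi_k - phi_j) tends to 0
  with the distance of X k and X j, which contradicts the lower Riesz bound.
*)

theory Submission
  imports Defs
begin

section \<open>Integrability of radial majorants\<close>

text \<open>Elements of \<open>dom_H\<close> are differentiated only through pairings with test
  functions, whereas exp(-r)/r is neither smooth nor compactly supported. The kernel is therefore
  modified twice: exp(-q)/q with q = sqrt(\<epsilon>^2 + r^2) removes the singularity, and a smooth
  radial cutoff removes the tail. The cutoff is released before \<epsilon>, each time by dominated
  convergence; the exponential tail supplies the majorants. Radial functions are written in the
  variable s = r^2, a polynomial in the coordinates, where 1 - Delta sends P to P - 6 P' - 4 s P''.
  The resulting mollified identity is used twice: against a continuous f it evaluates f at a point,
  and with source 0, averaged over boxes, it gives the uniqueness behind completeness. Separation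
  enters through two facts: the balls of radius d / 2 about the points are disjoint, and the sums of
  exp(-|x - X k|) over k are bounded uniformly in x, by comparison of volumes.\<close>

lemma emeasure_cball_r3:
  assumes "r \<ge> 0"
  shows "emeasure lborel (cball (c::real^3) r) = ennreal (unit_ball_vol 3 * r ^ 3)"
  using emeasure_cball[of r c] assms by simp

lemma dyadic_scale:
  fixes r :: real
  assumes "r \<ge> 1"
  obtains k :: nat where "2 ^ k \<le> r" "r < 2 ^ Suc k"
proof -
  have "\<exists>k. r < 2 ^ Suc k"
    using real_arch_pow[of 2 r] by (metis less_le_not_le lessI less_trans one_less_numeral_iff power_strict_increasing semiring_norm(76))
  define k where "k = (LEAST k. r < 2 ^ Suc k)"
  have "r < 2 ^ Suc k"
    unfolding k_def by (rule LeastI_ex) fact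
  moreover have "2 ^ k \<le> r"
  proof (cases k)
    case (Suc l)
    then have "\<not> r < 2 ^ Suc l"
      using not_less_Least[of l "\<lambda>k. r < 2 ^ Suc k"] k_def by auto
    then show ?thesis using Suc by simp
  qed (use assms in simp)
  ultimately show ?thesis by (rule that[rotated])
qed

text \<open>Comparison function of order r^-2 at the origin and r^-4 at infinity, both integrable in
  dimension three. The majorants exp(-c r)/r^2, exp(-r) and \<open>1 / bracket x ^ m\<close> with m
  at least 4 are bounded by multiples of it.\<close>

definition decay :: "real^3 \<Rightarrow> real" where
  "decay x = 1 / ((norm x)\<^sup>2 * (1 + (norm x)\<^sup>2))"

lemma decay_nonneg: "decay x \<ge> 0"
  by (simp add: decay_def)

lemma decay_measurable [measurable]: "decay \<in> borel_measurable borel"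
  unfolding decay_def by measurable

text \<open>Each point is charged to one dyadic scale. If r < 1 and r is about 2^-k, then
  \<open>decay\<close> is at most r^-2, hence at most 4^(k+1); if r \<ge> 1 and r is about 2^k, it
  is at most r^-4, hence at most 16^-k. Balls instead of shells suffice, so only volumes of balls
  have to be known.\<close>

lemma decay_le_dyadic:
  "\<exists>k::nat. decay x \<le> 4 ^ Suc k * indicator (cball 0 (1 / 2 ^ k)) x
     + 1 / 16 ^ k * indicator (cball 0 (2 ^ Suc k)) x"
proof (cases "x = 0")
  case True
  \<comment> \<open>Division by zero gives \<open>decay 0\<close> the value 0.\<close>
  then show ?thesis by (auto simp: decay_def)
next
  case False
  then have r: "norm x > 0" by simp
  show ?thesis
  proof (cases "norm x \<ge> 1")
    case True
    then obtain k where k: "2 ^ k \<le> norm x" "norm x < 2 ^ Suc k"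
      by (rule dyadic_scale)
    have "(2 ^ k) ^ 4 \<le> (norm x) ^ 4"
      using k by (intro power_mono) auto
    also have "\<dots> \<le> (norm x)\<^sup>2 * (1 + (norm x)\<^sup>2)"
      by (simp add: algebra_simps power2_eq_square power4_eq_xxxx)
    finally have "16 ^ k \<le> (norm x)\<^sup>2 * (1 + (norm x)\<^sup>2)"
      by (simp add: power_mult[symmetric] mult.commute[of k] power_mult)
    then have "decay x \<le> 1 / 16 ^ k"
      unfolding decay_def by (intro divide_left_mono mult_pos_pos) (use r in \<open>auto simp: add_pos_nonneg\<close>)
    then show ?thesis
      using k by (intro exI[of _ k]) (auto simp: indicator_def intro: order_trans)
  next
    case False
    then have "1 / norm x \<ge> 1" using r by simp
    then obtain k where k: "2 ^ k \<le> 1 / norm x" "1 / norm x < 2 ^ Suc k"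
      by (rule dyadic_scale)
    have "(1 / norm x)\<^sup>2 \<le> (2 ^ Suc k)\<^sup>2"
      using k r by (intro power_mono) auto
    then have 1: "1 / (norm x)\<^sup>2 \<le> 4 ^ Suc k"
      by (simp add: power_divide power_mult[symmetric] mult.commute[of _ 2] power_mult)
    have "decay x \<le> 1 / (norm x)\<^sup>2"
      unfolding decay_def by (intro divide_left_mono mult_pos_pos) (use r in \<open>auto simp: add_pos_nonneg algebra_simps\<close>)
    then have "decay x \<le> 4 ^ Suc k" using 1 by linarith
    moreover have "norm x \<le> 1 / 2 ^ k"
      using k r by (simp add: field_simps)
    ultimately show ?thesis
      by (intro exI[of _ k]) (auto simp: indicator_def intro: add_increasing2)
  qed
qed

text \<open>Volumes scale with the cube of the radius, so the two summands of the k-th term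
  contribute 4^(k+1) 8^-k = 4 / 2^k and 16^-k 8^(k+1) = 8 / 2^k unit ball volumes; this is the
  factor 12 of a geometric series.\<close>

lemma decay_integrable: "integrable lborel decay"
proof (rule integrableI_nonneg)
  define a :: "nat \<Rightarrow> real^3 \<Rightarrow> real" where
    "a k x = 4 ^ Suc k * indicator (cball 0 (1 / 2 ^ k)) x
     + 1 / 16 ^ k * indicator (cball 0 (2 ^ Suc k)) x" for k x
  have [measurable]: "a k \<in> borel_measurable borel" for k
    unfolding a_def
    by (intro borel_measurable_add borel_measurable_times borel_measurable_const
        borel_measurable_indicator) auto
  have "(\<integral>\<^sup>+x. ennreal (a k x) \<partial>lborel) = ennreal (12 * unit_ball_vol 3 * (1/2) ^ k)" for k
  proof -
    have "(\<integral>\<^sup>+x. ennreal (a k x) \<partial>lborel) =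
        (\<integral>\<^sup>+(x::real^3). ennreal (4 ^ Suc k) * indicator (cball 0 (1 / 2 ^ k)) x
          + ennreal (1 / 16 ^ k) * indicator (cball 0 (2 ^ Suc k)) x \<partial>lborel)"
      by (intro nn_integral_cong) (auto simp: a_def indicator_def ennreal_plus)
    also have "\<dots> = ennreal (4 ^ Suc k) * ennreal (unit_ball_vol 3 * (1 / 2 ^ k) ^ 3)
        + ennreal (1 / 16 ^ k) * ennreal (unit_ball_vol 3 * (2 ^ Suc k) ^ 3)"
      by (subst nn_integral_add)
        (auto simp: nn_integral_cmult_indicator emeasure_cball_r3
          intro!: borel_measurable_times_ennreal borel_measurable_const borel_measurable_indicator
          simp del: power_Suc)
    also have "\<dots> = ennreal (4 ^ Suc k * (unit_ball_vol 3 * (1 / 2 ^ k) ^ 3)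
        + 1 / 16 ^ k * (unit_ball_vol 3 * (2 ^ Suc k) ^ 3))"
      by (simp add: ennreal_mult[symmetric] ennreal_plus[symmetric] del: ennreal_plus)
    also have "4 ^ Suc k * (unit_ball_vol 3 * (1 / 2 ^ k) ^ 3)
        + 1 / 16 ^ k * (unit_ball_vol 3 * (2 ^ Suc k) ^ 3) = 12 * unit_ball_vol 3 * (1/2::real) ^ k"
    proof -
      have "(4::real) ^ k = (2 ^ k) ^ 2" "(16::real) ^ k = (2 ^ k) ^ 4"
        by (simp_all add: power_mult[symmetric] mult.commute[of k] power_mult)
      then show ?thesis
        by (simp add: field_simps power_numeral_reduce)
    qed
    finally show ?thesis .
  qed
  then have "(\<integral>\<^sup>+x. (\<Sum>k. ennreal (a k x)) \<partial>lborel) = (\<Sum>k. ennreal (12 * unit_ball_vol 3 * (1/2) ^ k))"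
    by (subst nn_integral_suminf) auto
  also have "\<dots> < \<infinity>"
    by (subst suminf_ennreal2) (auto intro!: summable_mult)
  finally have "(\<integral>\<^sup>+x. (\<Sum>k. ennreal (a k x)) \<partial>lborel) < \<infinity>" .
  moreover have "ennreal (decay x) \<le> (\<Sum>k. ennreal (a k x))" for x
  proof -
    obtain k where "decay x \<le> a k x"
      using decay_le_dyadic[of x] unfolding a_def by auto
    then have "ennreal (decay x) \<le> ennreal (a k x)" by (rule ennreal_leI)
    also have "\<dots> = (\<Sum>k\<in>{k}. ennreal (a k x))" by simp
    also have "\<dots> \<le> (\<Sum>k. ennreal (a k x))"
      by (rule sum_le_suminf) (auto intro: summableI)
    finally show ?thesis .
  qed
  ultimately show "(\<integral>\<^sup>+x. ennreal (decay x) \<partial>lborel) < \<infinity>"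
    by (meson le_less_trans nn_integral_mono)
qed (auto simp: decay_nonneg)

text \<open>The origin is left out because \<open>decay\<close> takes its default value 0 there; it
  is a null set.\<close>

lemma integrable_if_le_decay:
  fixes f :: "real^3 \<Rightarrow> 'a::{banach,second_countable_topology}"
  assumes [measurable]: "f \<in> borel_measurable borel"
    and le: "\<And>x. x \<noteq> 0 \<Longrightarrow> norm (f x) \<le> C * decay x"
  shows "integrable lborel f"
proof (rule Bochner_Integration.integrable_bound)
  show "integrable lborel (\<lambda>x. C * decay x)"
    using decay_integrable by simp
  show "AE x in lborel. norm (f x) \<le> norm (C * decay x)"
    using AE_lborel_singleton[of 0] by eventually_elim (use le in force)
qed simp

lemma exp_lower_quadratic: "(t::real) \<ge> 0 \<Longrightarrow> 1 + t + t\<^sup>2 / 2 \<le> exp t"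
  using exp_lower_Taylor_quadratic by blast

text \<open>The square of the quadratic bound at t / 2. The coefficients 1/8 and 1/64 come from
  squaring, and the latter is the source of the constant 64 in the majorants below.\<close>

lemma exp_lower_quartic:
  assumes "(t::real) \<ge> 0"
  shows "1 + t + t\<^sup>2 / 2 + t ^ 3 / 8 + t ^ 4 / 64 \<le> exp t"
proof -
  have "(1 + t / 2 + (t / 2)\<^sup>2 / 2)\<^sup>2 \<le> (exp (t / 2))\<^sup>2"
    using exp_lower_quadratic[of "t / 2"] assms by (intro power_mono) auto
  also have "\<dots> = exp t"
    by (simp add: exp_double[symmetric])
  finally show ?thesis
    by (simp add: power2_eq_square power3_eq_cube power4_eq_xxxx algebra_simps)
qed

text \<open>With c = 2 this makes the square of exp(-r)/r integrable, with c = 1 the function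
  \<open>weight\<close>.\<close>

lemma exp_div_square_integrable:
  assumes "c > 0"
  shows "integrable lborel (\<lambda>x::real^3. exp (- c * norm x) / (norm x)\<^sup>2)"
proof (rule integrable_if_le_decay[where C = "1 + 2 / c\<^sup>2"])
  fix x :: "real^3" assume "x \<noteq> 0"
  define r where "r = norm x"
  have r: "r > 0" using \<open>x \<noteq> 0\<close> r_def by simp
  have "1 + c * r + (c * r)\<^sup>2 / 2 \<le> exp (c * r)"
    using exp_lower_quadratic[of "c * r"] assms r by simp
  then have e: "1 + (c * r)\<^sup>2 / 2 \<le> exp (c * r)"
    using assms r mult_pos_pos[of c r] by linarith
  have "1 + r\<^sup>2 \<le> (1 + 2 / c\<^sup>2) * (1 + (c * r)\<^sup>2 / 2)"
    using assms by (simp add: field_simps)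
  also have "\<dots> \<le> (1 + 2 / c\<^sup>2) * exp (c * r)"
    by (intro mult_left_mono e) auto
  finally have 1: "1 + r\<^sup>2 \<le> (1 + 2 / c\<^sup>2) * exp (c * r)" .
  have "exp (- c * r) / r\<^sup>2 * (1 + r\<^sup>2) \<le> exp (- c * r) / r\<^sup>2 * ((1 + 2 / c\<^sup>2) * exp (c * r))"
    by (rule mult_left_mono[OF 1]) auto
  also have "\<dots> = (1 + 2 / c\<^sup>2) / r\<^sup>2"
    by (simp add: exp_minus)
  finally have "exp (- c * r) / r\<^sup>2 \<le> (1 + 2 / c\<^sup>2) / r\<^sup>2 / (1 + r\<^sup>2)"
    by (subst pos_le_divide_eq) (auto simp: add_pos_nonneg)
  then show "norm (exp (- c * norm x) / (norm x)\<^sup>2) \<le> (1 + 2 / c\<^sup>2) * decay x"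
    by (simp add: decay_def r_def)
qed measurable

lemma exp_minus_norm_integrable: "integrable lborel (\<lambda>x::real^3. exp (- norm x))"
proof (rule integrable_if_le_decay[where C = 64])
  fix x :: "real^3" assume "x \<noteq> 0"
  define r where "r = norm x"
  have r: "r > 0" using \<open>x \<noteq> 0\<close> r_def by simp
  have e: "1 + r + r\<^sup>2/2 + r^3/8 + r^4/64 \<le> exp r"
    using exp_lower_quartic r by simp
  have "0 \<le> r^3" "0 \<le> r^2" using r by auto
  then have "r\<^sup>2 + r ^ 4 \<le> 64 * exp r"
    using r e by linarith
  then have "exp (- r) * (r\<^sup>2 * (1 + r\<^sup>2)) \<le> exp (- r) * (64 * exp r)"
    by (intro mult_left_mono) (auto simp: algebra_simps power2_eq_square power4_eq_xxxx)
  also have "\<dots> = 64"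
    by (simp add: exp_minus)
  finally have "exp (- r) * (r\<^sup>2 * (1 + r\<^sup>2)) \<le> 64" .
  then have "exp (- r) \<le> 64 / (r\<^sup>2 * (1 + r\<^sup>2))"
    using r by (subst pos_le_divide_eq) (auto intro!: mult_pos_pos add_pos_nonneg)
  then show "norm (exp (- norm x)) \<le> 64 * decay x"
    by (simp add: decay_def r_def)
qed measurable

text \<open>The Japanese bracket. It appears because sqrt(\<epsilon>^2 + |\<epsilon> z|^2) equals
  \<epsilon> times the bracket of z.\<close>

definition bracket :: "real^3 \<Rightarrow> real" where
  "bracket x = sqrt (1 + (norm x)\<^sup>2)"

lemma bracket_ge_1: "bracket x \<ge> 1"
  by (simp add: bracket_def)

lemma bracket_measurable [measurable]: "bracket \<in> borel_measurable borel"
  unfolding bracket_def by measurable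

lemma inverse_bracket_power_integrable:
  assumes "m \<ge> 4"
  shows "integrable lborel (\<lambda>x. 1 / bracket x ^ m)"
proof (rule integrable_if_le_decay[where C = 1])
  fix x :: "real^3" assume x: "x \<noteq> 0"
  have "bracket x ^ 4 \<le> bracket x ^ m"
    using assms bracket_ge_1 by (intro power_increasing) auto
  moreover have "bracket x ^ 4 = (1 + (norm x)\<^sup>2)\<^sup>2"
    by (simp add: bracket_def power2_eq_square power4_eq_xxxx)
  moreover have "(norm x)\<^sup>2 * (1 + (norm x)\<^sup>2) \<le> (1 + (norm x)\<^sup>2)\<^sup>2"
    by (simp add: power2_eq_square algebra_simps)
  ultimately have "(norm x)\<^sup>2 * (1 + (norm x)\<^sup>2) \<le> bracket x ^ m" by linarith
  then have "1 / bracket x ^ m \<le> 1 / ((norm x)\<^sup>2 * (1 + (norm x)\<^sup>2))"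
    using x bracket_ge_1[of x] by (intro divide_left_mono mult_pos_pos) (auto simp: add_pos_nonneg)
  then show "norm (1 / bracket x ^ m) \<le> 1 * decay x"
    using bracket_ge_1[of x] by (simp add: decay_def)
qed measurable

section \<open>Smooth functions and test functions\<close>

text \<open>Relational companion of \<open>partial_deriv\<close>. The latter is a total function
  with an arbitrary value where no derivative exists; the relation asserts existence and therefore
  composes under sums and products.\<close>

definition line_deriv :: "3 \<Rightarrow> (real^3 \<Rightarrow> complex) \<Rightarrow> real^3 \<Rightarrow> complex \<Rightarrow> bool" where
  "line_deriv i f x D \<longleftrightarrow> ((\<lambda>t. f (x + t *\<^sub>R axis i 1)) has_vector_derivative D) (at 0)"

lemma line_deriv_partial_deriv: "line_deriv i f x D \<Longrightarrow> partial_deriv i f x = D"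
  unfolding line_deriv_def partial_deriv_def by (rule vector_derivative_at)

lemma partial_deriv_works:
  "(\<lambda>t. f (x + t *\<^sub>R axis i 1)) differentiable (at (0::real)) \<Longrightarrow> line_deriv i f x (partial_deriv i f x)"
  unfolding line_deriv_def partial_deriv_def by (simp add: vector_derivative_works)

lemma line_deriv_differentiable:
  "line_deriv i f x D \<Longrightarrow> (\<lambda>t. f (x + t *\<^sub>R axis i 1)) differentiable (at (0::real))"
  unfolding line_deriv_def by (auto simp: differentiable_def has_vector_derivative_def)

lemma line_deriv_add:
  "line_deriv i f x D \<Longrightarrow> line_deriv i g x E \<Longrightarrow> line_deriv i (\<lambda>x. f x + g x) x (D + E)"
  unfolding line_deriv_def by (rule has_vector_derivative_add)

lemma line_deriv_mult:
  "line_deriv i f x D \<Longrightarrow> line_deriv i g x E \<Longrightarrow> line_deriv i (\<lambda>x. f x * g x) x (f x * E + D * g x)"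
  unfolding line_deriv_def by (drule (1) has_vector_derivative_mult) simp

lemma line_deriv_const: "line_deriv i (\<lambda>x. c) x 0"
  unfolding line_deriv_def by simp

lemma line_deriv_coordinate:
  "line_deriv i (\<lambda>x. complex_of_real (x $ j - y $ j)) x (if i = j then 1 else 0)"
proof -
  have "((\<lambda>t. (x + t *\<^sub>R axis i 1) $ j - y $ j) has_real_derivative (if i = j then 1 else 0)) (at 0)"
    by (auto intro!: derivative_eq_intros simp: axis_def)
  from has_vector_derivative_of_real[OF this]
  show ?thesis
    unfolding line_deriv_def by (auto split: if_splits)
qed

text \<open>On a coordinate line |x - y|^2 is a quadratic polynomial in t with linear coefficient 2
  (x_i - y_i). Using the squared distance avoids differentiating a square root at the
  centre.\<close>

lemma line_deriv_radial:
  assumes "(P has_real_derivative P1) (at ((norm (x - y))\<^sup>2))"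
  shows "line_deriv i (\<lambda>x. complex_of_real (P ((norm (x - y))\<^sup>2))) x
    (complex_of_real (2 * P1) * complex_of_real (x $ i - y $ i))"
proof -
  have eq: "(norm (x + t *\<^sub>R axis i 1 - y))\<^sup>2 = (norm (x - y))\<^sup>2 + 2 * t * (x $ i - y $ i) + t\<^sup>2" for t
  proof -
    have "(norm (x + t *\<^sub>R axis i 1 - y))\<^sup>2 = (norm ((x - y) + t *\<^sub>R axis i 1))\<^sup>2"
      by (simp add: algebra_simps)
    also have "\<dots> = (norm (x - y))\<^sup>2 + 2 * ((x - y) \<bullet> (t *\<^sub>R axis i 1)) + (norm (t *\<^sub>R (axis i 1 :: real^3)))\<^sup>2"
      by (simp only: power2_norm_eq_inner inner_add inner_commute)
    also have "\<dots> = (norm (x - y))\<^sup>2 + 2 * t * (x $ i - y $ i) + t\<^sup>2"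
      by (simp add: inner_axis norm_axis_1)
    finally show ?thesis .
  qed
  have "((\<lambda>t. (norm (x + t *\<^sub>R axis i 1 - y))\<^sup>2) has_real_derivative 2 * (x $ i - y $ i)) (at 0)"
    unfolding eq by (auto intro!: derivative_eq_intros)
  moreover have "(P has_real_derivative P1) (at ((norm (x + 0 *\<^sub>R axis i 1 - y))\<^sup>2))"
    using assms by simp
  ultimately have "((\<lambda>t. P ((norm (x + t *\<^sub>R axis i 1 - y))\<^sup>2)) has_real_derivative P1 * (2 * (x $ i - y $ i))) (at 0)"
    by (rule DERIV_chain2[rotated])
  from has_vector_derivative_of_real[OF this]
  show ?thesis
    unfolding line_deriv_def by (simp add: mult.assoc mult.left_commute)
qed

text \<open>Smoothness graded by order. \<open>smooth\<close> quantifies over all derivative lists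
  at once, while closure under products and compositions calls for an induction that strips one
  derivative of f at a time.\<close>

fun Ck :: "nat \<Rightarrow> (real^3 \<Rightarrow> complex) \<Rightarrow> bool" where
  "Ck 0 f \<longleftrightarrow> continuous_on UNIV f"
| "Ck (Suc k) f \<longleftrightarrow> continuous_on UNIV f \<and> (\<forall>i x. line_deriv i f x (partial_deriv i f x))
     \<and> (\<forall>i. Ck k (partial_deriv i f))"

lemma Ck_SucI:
  assumes "continuous_on UNIV f" "\<And>i x. line_deriv i f x (D i x)" "\<And>i. Ck k (D i)"
  shows "Ck (Suc k) f"
proof -
  have "partial_deriv i f = D i" for i
    using line_deriv_partial_deriv[OF assms(2)] by blast
  then show ?thesis using assms by simp
qed

lemma Ck_continuous: "Ck k f \<Longrightarrow> continuous_on UNIV f"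
  by (cases k) auto

lemma Ck_Suc_imp: "Ck (Suc k) f \<Longrightarrow> Ck k f"
proof (induction k arbitrary: f)
  case (Suc k)
  then have "Ck k (partial_deriv i f)" for i
    by (metis Ck.simps(2))
  then show ?case using Suc.prems by simp
qed simp

lemma Ck_add: "Ck k f \<Longrightarrow> Ck k g \<Longrightarrow> Ck k (\<lambda>x. f x + g x)"
proof (induction k arbitrary: f g)
  case (Suc k)
  show ?case
    by (rule Ck_SucI[where D = "\<lambda>i x. partial_deriv i f x + partial_deriv i g x"])
      (use Suc in \<open>auto intro!: line_deriv_add continuous_on_add\<close>)
qed (auto intro!: continuous_on_add)

lemma Ck_mult: "Ck k f \<Longrightarrow> Ck k g \<Longrightarrow> Ck k (\<lambda>x. f x * g x)"
proof (induction k arbitrary: f g)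
  case (Suc k)
  have *: "Ck k f" "Ck k g" using Suc.prems Ck_Suc_imp by auto
  show ?case
    by (rule Ck_SucI[where D = "\<lambda>i x. f x * partial_deriv i g x + partial_deriv i f x * g x"])
      (use Suc * in \<open>auto intro!: line_deriv_mult continuous_on_mult Ck_add\<close>)
qed (auto intro!: continuous_on_mult)

lemma Ck_const: "Ck k (\<lambda>x. c)"
proof (induction k arbitrary: c)
  case (Suc k)
  show ?case
    by (rule Ck_SucI[where D = "\<lambda>i x. 0"]) (use Suc in \<open>auto intro: line_deriv_const\<close>)
qed simp

lemma Ck_coordinate: "Ck k (\<lambda>x. complex_of_real (x $ j - y $ j))"
proof (cases k)
  case (Suc l)
  show ?thesis unfolding Suc
  proof (rule Ck_SucI)
    show "line_deriv i (\<lambda>x. complex_of_real (x $ j - y $ j)) x (if i = j then 1 else 0)" for i x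
      by (rule line_deriv_coordinate)
  qed (auto intro!: Ck_const continuous_intros)
qed (auto intro!: continuous_intros)

text \<open>Both directions strengthen the claim to all \<open>partial_derivs is f\<close>.
  Induction on the list spends one order of \<open>Ck\<close> per entry; induction on k extends the
  list at its head.\<close>

lemma smooth_iff_Ck: "smooth f \<longleftrightarrow> (\<forall>k. Ck k f)"
proof
  assume s: "\<forall>k. Ck k f"
  have 1: "\<forall>k. Ck k (partial_derivs is f)" for "is"
  proof (induction "is")
    case Nil
    then show ?case using s by (simp add: partial_derivs_def)
  next
    case (Cons i "is")
    then have "Ck (Suc k) (partial_derivs is f)" for k by blast
    then show ?case by (simp add: partial_derivs_def)
  qed
  show "smooth f"
    unfolding smooth_def
  proof (intro allI conjI)
    fix "is" i x
    show "continuous_on UNIV (partial_derivs is f)"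
      using 1 Ck_continuous by blast
    have "Ck (Suc 0) (partial_derivs is f)" using 1 by blast
    then show "(\<lambda>t. partial_derivs is f (x + t *\<^sub>R axis i 1)) differentiable at (0::real)"
      unfolding Ck.simps using line_deriv_differentiable[of i "partial_derivs is f" x] by blast
  qed
next
  assume s: "smooth f"
  have "\<forall>is. Ck k (partial_derivs is f)" for k
  proof (induction k)
    case 0
    then show ?case using s by (simp add: smooth_def)
  next
    case (Suc k)
    show ?case
    proof
      fix "is"
      have "Ck k (partial_deriv i (partial_derivs is f))" for i
        using Suc[rule_format, of "i # is"] by (simp add: partial_derivs_def)
      then show "Ck (Suc k) (partial_derivs is f)"
        using s by (auto simp: smooth_def intro: partial_deriv_works)
    qed
  qed
  from this[rule_format, of _ "[]"] show "\<forall>k. Ck k f"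
    by (simp add: partial_derivs_def)
qed

lemma smooth_continuous: "smooth f \<Longrightarrow> continuous_on UNIV f"
  using smooth_iff_Ck Ck_continuous by blast

lemma smooth_line_deriv: "smooth f \<Longrightarrow> line_deriv i f x (partial_deriv i f x)"
  using smooth_iff_Ck[of f] Ck.simps(2)[of 0 f] by blast

lemma smooth_partial_deriv: "smooth f \<Longrightarrow> smooth (partial_deriv i f)"
  using smooth_iff_Ck Ck.simps(2) by blast

lemma smooth_add: "smooth f \<Longrightarrow> smooth g \<Longrightarrow> smooth (\<lambda>x. f x + g x)"
  by (simp add: smooth_iff_Ck Ck_add)

lemma smooth_mult: "smooth f \<Longrightarrow> smooth g \<Longrightarrow> smooth (\<lambda>x. f x * g x)"
  by (simp add: smooth_iff_Ck Ck_mult)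

lemma smooth_const: "smooth (\<lambda>x. c)"
  by (simp add: smooth_iff_Ck Ck_const)

text \<open>Differentiating a member of the family gives the next two members times a linear
  function, so the induction closes once m is general. Both \<open>flat\<close> and
  \<open>pole\<close> satisfy such a recurrence, and the affine argument b + a s covers 1 - a r^2 as
  well as \<epsilon>^2 + r^2. The set U is where the recurrence is valid.\<close>

lemma Ck_radial_family:
  fixes G :: "nat \<Rightarrow> real \<Rightarrow> real"
  assumes G: "\<And>m s. s \<in> U \<Longrightarrow>
      (G m has_real_derivative \<alpha> m * G (m + 1) s + \<beta> m * G (m + 2) s) (at s)"
    and U: "\<And>s. s \<ge> 0 \<Longrightarrow> b + a * s \<in> U"
  shows "Ck k (\<lambda>x. complex_of_real (G m (b + a * (norm (x - y))\<^sup>2)))"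
proof (induction k arbitrary: m)
  case 0
  have "continuous_on U (G m)" for m
    using G by (meson DERIV_isCont continuous_at_imp_continuous_on)
  then have "continuous_on UNIV (\<lambda>x. G m (b + a * (norm (x - y))\<^sup>2))"
    by (rule continuous_on_compose2) (use U in \<open>auto intro!: continuous_intros\<close>)
  then show ?case by (auto intro!: continuous_intros)
next
  case (Suc k)
  let ?q = "\<lambda>x. b + a * (norm (x - y))\<^sup>2"
  let ?D = "\<lambda>i x. (complex_of_real (2 * a * \<alpha> m) * complex_of_real (G (m + 1) (?q x))
     + complex_of_real (2 * a * \<beta> m) * complex_of_real (G (m + 2) (?q x)))
     * complex_of_real (x $ i - y $ i)"
  show ?case
  proof (rule Ck_SucI[where D = ?D])
    show "continuous_on UNIV (\<lambda>x. complex_of_real (G m (?q x)))"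
      using Suc Ck_continuous by blast
    show "Ck k (?D i)" for i
      by (intro Ck_mult Ck_add Ck_const Suc Ck_coordinate)
    fix i x
    have "((\<lambda>s. G m (b + a * s)) has_real_derivative
        (\<alpha> m * G (m + 1) (?q x) + \<beta> m * G (m + 2) (?q x)) * a) (at ((norm (x - y))\<^sup>2))"
      by (rule DERIV_chain2[OF G]) (use U in \<open>auto intro!: derivative_eq_intros\<close>)
    from line_deriv_radial[OF this, of i]
    show "line_deriv i (\<lambda>x. complex_of_real (G m (?q x))) x (?D i x)"
      by (simp add: algebra_simps)
  qed
qed

section \<open>Test functions and their stability under algebra and differentiation\<close>

lemma compact_support_iff:
  "compact (closure {x. f x \<noteq> 0}) \<longleftrightarrow> (\<exists>B. \<forall>x::real^3. norm x \<ge> B \<longrightarrow> f x = (0::complex))"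
proof
  assume "compact (closure {x. f x \<noteq> 0})"
  then have "bounded {x. f x \<noteq> 0}"
    using compact_closure by blast
  then obtain B where "\<And>x. f x \<noteq> 0 \<Longrightarrow> norm x \<le> B"
    unfolding bounded_iff by auto
  then have "\<forall>x. norm x \<ge> B + 1 \<longrightarrow> f x = 0" by force
  then show "\<exists>B. \<forall>x. norm x \<ge> B \<longrightarrow> f x = 0" ..
next
  assume "\<exists>B. \<forall>x. norm x \<ge> B \<longrightarrow> f x = 0"
  then obtain B where "\<forall>x. norm x \<ge> B \<longrightarrow> f x = 0" ..
  then have "bounded {x. f x \<noteq> 0}"
    unfolding bounded_iff by (intro exI[of _ B]) force
  then show "compact (closure {x. f x \<noteq> 0})"
    using compact_closure by blast
qed

lemma test_functions_iff:
  "f \<in> test_functions \<longleftrightarrow> smooth f \<and> (\<exists>B. \<forall>x. norm x \<ge> B \<longrightarrow> f x = 0)"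
  unfolding test_functions_def mem_Collect_eq compact_support_iff ..

lemma test_functionE:
  assumes "f \<in> test_functions"
  obtains B where "B > 0" "\<And>x. norm x \<ge> B \<Longrightarrow> f x = 0"
proof -
  obtain B where "\<forall>x. norm x \<ge> B \<longrightarrow> f x = 0"
    using assms test_functions_iff by auto
  then show ?thesis by (intro that[of "max B 1"]) auto
qed

lemma test_function_smooth: "f \<in> test_functions \<Longrightarrow> smooth f"
  by (simp add: test_functions_def)

lemma test_function_continuous: "f \<in> test_functions \<Longrightarrow> continuous_on UNIV f"
  by (simp add: test_function_smooth smooth_continuous)

lemma test_function_add:
  assumes "f \<in> test_functions" "g \<in> test_functions"
  shows "(\<lambda>x. f x + g x) \<in> test_functions"
proof -
  obtain B C where "\<And>x. norm x \<ge> B \<Longrightarrow> f x = 0" "\<And>x. norm x \<ge> C \<Longrightarrow> g x = 0"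
    using assms by (metis test_functionE)
  then have "\<exists>B. \<forall>x. norm x \<ge> B \<longrightarrow> f x + g x = 0"
    by (intro exI[of _ "max B C"]) auto
  then show ?thesis
    using assms by (auto simp: test_functions_iff intro: smooth_add)
qed

lemma test_function_mult:
  assumes "f \<in> test_functions" "smooth g"
  shows "(\<lambda>x. g x * f x) \<in> test_functions"
  using assms by (auto simp: test_functions_iff intro!: smooth_mult)

lemma test_function_cmult: "f \<in> test_functions \<Longrightarrow> (\<lambda>x. c * f x) \<in> test_functions"
  by (rule test_function_mult) (auto intro: smooth_const)

lemma test_function_zero: "(\<lambda>x. 0) \<in> test_functions"
  by (simp add: test_functions_iff smooth_const)

lemma test_function_sum:
  "finite J \<Longrightarrow> (\<And>j. j \<in> J \<Longrightarrow> f j \<in> test_functions) \<Longrightarrow> (\<lambda>x. \<Sum>j\<in>J. f j x) \<in> test_functions"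
  by (induction J rule: finite_induct) (auto intro: test_function_zero test_function_add)

lemma partial_deriv_eq_0_outside:
  assumes "\<And>x. norm x \<ge> B \<Longrightarrow> f x = 0" "norm x > B"
  shows "partial_deriv i f x = 0"
proof -
  have "isCont (\<lambda>t. norm (x + t *\<^sub>R axis i 1 :: real^3)) (0::real)"
    by (intro continuous_intros)
  then have "((\<lambda>t. norm (x + t *\<^sub>R axis i 1)) \<longlongrightarrow> norm x) (at 0)"
    by (simp add: isCont_def)
  then have "eventually (\<lambda>t. norm (x + t *\<^sub>R axis i 1) > B) (at 0)"
    using assms(2) by (rule order_tendstoD)
  then have "eventually (\<lambda>t. 0 = f (x + t *\<^sub>R axis i 1)) (at 0)"
    by eventually_elim (use assms(1) in auto)
  then have "line_deriv i f x 0"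
    unfolding line_deriv_def has_vector_derivative_def
    by (rule has_derivative_transform_eventually[rotated]) (use assms in auto)
  then show ?thesis by (rule line_deriv_partial_deriv)
qed

lemma test_function_partial_deriv:
  assumes "f \<in> test_functions"
  shows "partial_deriv i f \<in> test_functions"
proof -
  obtain B where "\<And>x. norm x \<ge> B \<Longrightarrow> f x = 0"
    using assms by (metis test_functionE)
  \<comment> \<open>The radius grows by 1 because the derivative is known to vanish only where a
    whole neighbourhood lies outside radius B.\<close>
  then have "\<forall>x. norm x \<ge> B + 1 \<longrightarrow> partial_deriv i f x = 0"
    by (auto intro!: partial_deriv_eq_0_outside)
  then show ?thesis
    using assms smooth_partial_deriv by (auto simp: test_functions_iff)
qed

lemma test_function_partial_derivs:
  "f \<in> test_functions \<Longrightarrow> partial_derivs is f \<in> test_functions"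
  by (induction "is") (auto simp: partial_derivs_def intro: test_function_partial_deriv)

text \<open>The classical operator 1 - Delta, acting by pointwise derivatives. In contrast,
  \<open>neg_laplacian\<close> is built from chosen weak derivatives, so the two are comparable only
  almost everywhere.\<close>

definition helmholtz :: "(real^3 \<Rightarrow> complex) \<Rightarrow> real^3 \<Rightarrow> complex" where
  "helmholtz f x = f x - (\<Sum>i\<in>UNIV. partial_derivs [i, i] f x)"

lemma helmholtz_eq: "helmholtz f = (\<lambda>x. f x + (\<Sum>i\<in>UNIV. (-1) * partial_derivs [i, i] f x))"
  by (auto simp: helmholtz_def sum_negf)

lemma test_function_helmholtz: "f \<in> test_functions \<Longrightarrow> helmholtz f \<in> test_functions"
  unfolding helmholtz_eq
  by (intro test_function_add test_function_sum test_function_cmult test_function_partial_derivs) auto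

lemma partial_deriv_add:
  "smooth f \<Longrightarrow> smooth g \<Longrightarrow> partial_deriv i (\<lambda>x. f x + g x) = (\<lambda>x. partial_deriv i f x + partial_deriv i g x)"
  by (rule ext) (intro line_deriv_partial_deriv line_deriv_add smooth_line_deriv)

lemma partial_deriv_cmult:
  assumes "smooth f"
  shows "partial_deriv i (\<lambda>x. c * f x) = (\<lambda>x. c * partial_deriv i f x)"
proof
  fix x
  show "partial_deriv i (\<lambda>x. c * f x) x = c * partial_deriv i f x"
    using line_deriv_mult[OF line_deriv_const[of i c x] smooth_line_deriv[OF assms]]
    by (intro line_deriv_partial_deriv) simp
qed

lemma partial_deriv_cnj:
  assumes "smooth f"
  shows "partial_deriv i (\<lambda>x. cnj (f x)) = (\<lambda>x. cnj (partial_deriv i f x))"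
proof
  fix x
  show "partial_deriv i (\<lambda>x. cnj (f x)) x = cnj (partial_deriv i f x)"
    using smooth_line_deriv[OF assms, of i x]
    by (intro line_deriv_partial_deriv) (simp add: line_deriv_def has_vector_derivative_cnj)
qed

lemma helmholtz_add:
  "smooth f \<Longrightarrow> smooth g \<Longrightarrow> helmholtz (\<lambda>x. f x + g x) = (\<lambda>x. helmholtz f x + helmholtz g x)"
  by (simp add: helmholtz_def partial_derivs_def partial_deriv_add smooth_partial_deriv sum.distrib fun_eq_iff)

lemma helmholtz_cmult:
  "smooth f \<Longrightarrow> helmholtz (\<lambda>x. c * f x) = (\<lambda>x. c * helmholtz f x)"
  by (simp add: helmholtz_def partial_derivs_def partial_deriv_cmult smooth_partial_deriv
      sum_distrib_left right_diff_distrib fun_eq_iff)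

lemma smooth_cnj:
  assumes "smooth f" shows "smooth (\<lambda>x. cnj (f x))"
proof -
  have "smooth f \<Longrightarrow> Ck k (\<lambda>x. cnj (f x))" for k and f :: "real^3 \<Rightarrow> complex"
  proof (induction k arbitrary: f)
    case (Suc k)
    show ?case
    proof (rule Ck_SucI[where D = "\<lambda>i x. cnj (partial_deriv i f x)"])
      show "line_deriv i (\<lambda>x. cnj (f x)) x (cnj (partial_deriv i f x))" for i x
        using smooth_line_deriv[OF Suc.prems, of i x]
        by (simp add: line_deriv_def has_vector_derivative_cnj)
      show "continuous_on UNIV (\<lambda>x. cnj (f x))"
        using smooth_continuous[OF Suc.prems] by (rule continuous_on_cnj)
    qed (use Suc in \<open>auto intro!: smooth_partial_deriv\<close>)
  qed (simp add: continuous_on_cnj smooth_continuous)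
  from this[OF assms] show ?thesis by (simp add: smooth_iff_Ck)
qed

lemma helmholtz_cnj:
  "smooth f \<Longrightarrow> helmholtz (\<lambda>x. cnj (f x)) = (\<lambda>x. cnj (helmholtz f x))"
  by (simp add: helmholtz_def partial_derivs_def partial_deriv_cnj smooth_partial_deriv fun_eq_iff)

lemma test_function_cnj: "f \<in> test_functions \<Longrightarrow> (\<lambda>x. cnj (f x)) \<in> test_functions"
  by (auto simp: test_functions_iff intro: smooth_cnj)

lemma helmholtz_sum:
  assumes "finite J" "\<And>j. j \<in> J \<Longrightarrow> smooth (f j)"
  shows "smooth (\<lambda>x. \<Sum>j\<in>J. f j x) \<and> helmholtz (\<lambda>x. \<Sum>j\<in>J. f j x) = (\<lambda>x. \<Sum>j\<in>J. helmholtz (f j) x)"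
  using assms
proof (induction J rule: finite_induct)
  case empty
  have "helmholtz (\<lambda>x. 0) = (\<lambda>x. 0)"
    using helmholtz_cmult[OF smooth_const[of 0], of 0] by simp
  then show ?case by (simp add: smooth_const)
next
  case (insert j J)
  then show ?case by (simp add: smooth_add helmholtz_add)
qed

text \<open>Direction i contributes 2 P' + 4 (x_i - y_i)^2 P'' to the Laplacian. The three
  directions give 6 P', and the squares add up to s = |x - y|^2.\<close>

lemma helmholtz_radial:
  assumes P: "\<And>s. s \<in> U \<Longrightarrow> (P has_real_derivative P1 s) (at s)"
    and P1: "\<And>s. s \<in> U \<Longrightarrow> (P1 has_real_derivative P2 s) (at s)"
    and U: "{0..} \<subseteq> U"
  shows "helmholtz (\<lambda>x. complex_of_real (P ((norm (x - y))\<^sup>2))) x =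
    complex_of_real (P ((norm (x - y))\<^sup>2) - 6 * P1 ((norm (x - y))\<^sup>2)
      - 4 * (norm (x - y))\<^sup>2 * P2 ((norm (x - y))\<^sup>2))"
proof -
  let ?s = "(norm (x - y))\<^sup>2"
  have mem: "(norm (x - y))\<^sup>2 \<in> U" for x using U by auto
  have 1: "partial_deriv i (\<lambda>x. complex_of_real (P ((norm (x - y))\<^sup>2))) =
      (\<lambda>x. 2 * (complex_of_real (P1 ((norm (x - y))\<^sup>2)) * complex_of_real (x $ i - y $ i)))" for i
    by (rule ext) (use line_deriv_partial_deriv[OF line_deriv_radial[OF P[OF mem]]] in simp)
  have 2: "partial_derivs [i, i] (\<lambda>x. complex_of_real (P ((norm (x - y))\<^sup>2))) x =
      2 * (complex_of_real (P1 ?s) + complex_of_real (2 * P2 ?s * (x $ i - y $ i)\<^sup>2))" for i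
  proof -
    have "line_deriv i (\<lambda>x. 2 * (complex_of_real (P1 ((norm (x - y))\<^sup>2)) * complex_of_real (x $ i - y $ i))) x
       (2 * (complex_of_real (P1 ?s) * 1 + (complex_of_real (2 * P2 ?s) * complex_of_real (x $ i - y $ i)) * complex_of_real (x $ i - y $ i))
        + 0 * (complex_of_real (P1 ?s) * complex_of_real (x $ i - y $ i)))"
      using line_deriv_coordinate[of i i y x]
      by (intro line_deriv_mult line_deriv_const line_deriv_radial P1 mem) simp
    then show ?thesis
      unfolding partial_derivs_def using 1
      by (auto dest!: line_deriv_partial_deriv simp: power2_eq_square algebra_simps)
  qed
  have S: "(\<Sum>i\<in>UNIV. (x $ i - y $ i)\<^sup>2) = ?s"
    by (simp only: power2_norm_eq_inner inner_vec_def) (simp add: power2_eq_square)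
  have "(\<Sum>i\<in>UNIV. 2 * (P1 ?s + 2 * P2 ?s * (x $ i - y $ i)\<^sup>2)) = 6 * P1 ?s + 4 * P2 ?s * ?s"
    by (simp only: sum_distrib_left[symmetric] sum.distrib S) simp
  then have "complex_of_real (\<Sum>i\<in>UNIV. 2 * (P1 ?s + 2 * P2 ?s * (x $ i - y $ i)\<^sup>2)) =
      complex_of_real (6 * P1 ?s + 4 * P2 ?s * ?s)"
    by (rule arg_cong)
  then have "(\<Sum>i\<in>UNIV. 2 * (complex_of_real (P1 ?s) + complex_of_real (2 * P2 ?s * (x $ i - y $ i)\<^sup>2)))
     = complex_of_real (6 * P1 ?s + 4 * P2 ?s * ?s)"
    by simp
  then show ?thesis
    unfolding helmholtz_def 2 by (simp add: algebra_simps)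
qed

section \<open>Truncated poles\<close>

text \<open>The standard flat function exp(-1/t), extended by 0, divided by the powers t^n that its
  derivatives produce; the resulting family is closed under differentiation.\<close>

definition flat :: "nat \<Rightarrow> real \<Rightarrow> real" where
  "flat n t = (if t > 0 then exp (- 1 / t) / t ^ n else 0)"

lemma flat_nonpos: "t \<le> 0 \<Longrightarrow> flat n t = 0"
  by (simp add: flat_def)

lemma flat_tendsto_0: "(flat n \<longlongrightarrow> 0) (at 0)"
proof -
  have "((\<lambda>t. (inverse t) ^ n / exp (inverse t)) \<longlongrightarrow> 0) (at_right (0::real))"
    by (rule filterlim_compose[OF tendsto_power_div_exp_0 filterlim_inverse_at_top_right])
  moreover have "eventually (\<lambda>t. (inverse t) ^ n / exp (inverse t) = flat n t) (at_right (0::real))"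
    using eventually_at_right_less[of 0]
    by eventually_elim (simp add: flat_def exp_minus divide_simps power_inverse)
  ultimately have "(flat n \<longlongrightarrow> 0) (at_right 0)"
    by (rule Lim_transform_eventually)
  moreover have "(flat n \<longlongrightarrow> 0) (at_left 0)"
  proof (rule Lim_transform_eventually)
    show "eventually (\<lambda>t. 0 = flat n t) (at_left 0)"
      by (auto simp: eventually_at_filter flat_nonpos)
  qed simp
  ultimately show ?thesis
    by (simp add: filterlim_split_at)
qed

text \<open>The factor 1 in front of the last term keeps the shape of the recurrence in
  \<open>Ck_radial_family\<close>.\<close>

lemma DERIV_flat:
  "(flat n has_real_derivative - real n * flat (n + 1) t + 1 * flat (n + 2) t) (at t)"
proof -
  consider "t > 0" | "t < 0" | "t = 0" by linarith
  then show ?thesis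
  proof cases
    case 1
    have "((\<lambda>t. exp (- 1 / t) / t ^ n) has_real_derivative - real n * flat (n + 1) t + 1 * flat (n + 2) t) (at t)"
      using 1 by (auto intro!: derivative_eq_intros simp: flat_def divide_simps power2_eq_square algebra_simps)
        (cases n; simp)
    then show ?thesis
      by (rule DERIV_cong_ev[THEN iffD1, rotated -1])
        (use 1 eventually_nhds_in_open[of "{0<..}" t] in \<open>auto simp: flat_def elim!: eventually_mono\<close>)
  next
    case 2
    have "((\<lambda>t. 0) has_real_derivative - real n * flat (n + 1) t + 1 * flat (n + 2) t) (at t)"
      using 2 by (simp add: flat_def)
    then show ?thesis
      by (rule DERIV_cong_ev[THEN iffD1, rotated -1])
        (use 2 eventually_nhds_in_open[of "{..<0}" t] in \<open>auto simp: flat_def elim!: eventually_mono\<close>)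
  next
    case 3
    \<comment> \<open>The difference quotient of \<open>flat n\<close> at 0 is
      \<open>flat (n + 1)\<close>, which tends to 0.\<close>
    have "((\<lambda>h. (flat n (0 + h) - flat n 0) / h) \<longlongrightarrow> 0) (at 0)"
    proof (rule Lim_transform_eventually[OF flat_tendsto_0[of "n + 1"]])
      show "eventually (\<lambda>h. flat (n + 1) h = (flat n (0 + h) - flat n 0) / h) (at 0)"
        by (auto simp: eventually_at_filter flat_def)
    qed
    then show ?thesis using 3 by (simp add: DERIV_def flat_nonpos)
  qed
qed

lemma flat_bounded: "\<exists>M. M \<ge> 0 \<and> (\<forall>t\<le>1. \<bar>flat n t\<bar> \<le> M)"
proof -
  have "continuous_on {0..1} (flat n)"
    by (intro continuous_at_imp_continuous_on ballI DERIV_isCont[OF DERIV_flat])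
  then have "bounded (flat n ` {0..1})"
    by (rule compact_imp_bounded[OF compact_continuous_image]) auto
  then obtain M where M: "\<And>t. t \<in> {0..1} \<Longrightarrow> \<bar>flat n t\<bar> \<le> M"
    unfolding bounded_iff by force
  have "\<bar>flat n t\<bar> \<le> max M 0" if "t \<le> 1" for t
    using M[of t] that by (cases "t \<ge> 0") (auto simp: flat_nonpos)
  then show ?thesis by (intro exI[of _ "max M 0"]) auto
qed

lemma isCont_flat: "isCont (flat n) t"
  by (rule DERIV_isCont[OF DERIV_flat])

text \<open>In terms of q = sqrt s this is exp(-q)/q^m. As dq/ds = 1/(2 q), an s-derivative leads to
  the exponents m + 1 and m + 2.\<close>

definition pole :: "nat \<Rightarrow> real \<Rightarrow> real" where
  "pole m s = exp (- sqrt s) / sqrt s ^ m"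

lemma DERIV_pole:
  assumes "s > 0"
  shows "(pole m has_real_derivative - 1/2 * pole (m + 1) s + - (real m / 2) * pole (m + 2) s) (at s)"
proof -
  have q: "sqrt s > 0" using assms by simp
  have *: "((\<lambda>s. exp (- s) / s ^ m) has_real_derivative - exp (- sqrt s) / sqrt s ^ m - real m * exp (- sqrt s) / sqrt s ^ (m + 1)) (at (sqrt s))"
    using q by (auto intro!: derivative_eq_intros simp: divide_simps algebra_simps)
      (cases m; simp)
  have "(sqrt has_real_derivative inverse (sqrt s) / 2) (at s)"
    by (rule DERIV_real_sqrt[OF assms])
  from DERIV_chain2[of "\<lambda>s. exp (- s) / s ^ m", OF * this]
  show ?thesis
    unfolding pole_def by (rule DERIV_cong) (use q in \<open>simp add: divide_simps algebra_simps\<close>)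
qed

lemma pole_nonneg: "s \<ge> 0 \<Longrightarrow> pole m s \<ge> 0"
  by (simp add: pole_def)

lemma pole_le_exp:
  assumes "e > 0" "r \<ge> 0"
  shows "pole m (e + r\<^sup>2) \<le> 1 / sqrt e ^ m * exp (- r)"
proof -
  have "sqrt (r\<^sup>2) \<le> sqrt (e + r\<^sup>2)"
    using assms by (intro real_sqrt_le_mono) auto
  then have "exp (- sqrt (e + r\<^sup>2)) \<le> exp (- r)" using assms by simp
  moreover have "sqrt e ^ m \<le> sqrt (e + r\<^sup>2) ^ m"
    using assms by (intro power_mono real_sqrt_le_mono) auto
  ultimately have "exp (- sqrt (e + r\<^sup>2)) / sqrt (e + r\<^sup>2) ^ m \<le> exp (- r) / sqrt e ^ m"
    using assms by (intro frac_le) auto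
  then show ?thesis by (simp add: pole_def)
qed

lemma smooth_bump: "smooth (\<lambda>x. complex_of_real (flat n (1 + (- a) * (norm (x - y))\<^sup>2)))"
  unfolding smooth_iff_Ck
  by (intro allI Ck_radial_family[where U = UNIV and \<alpha> = "\<lambda>m. - real m" and \<beta> = "\<lambda>m. 1"] DERIV_flat) auto

lemma bump_test:
  assumes "a > 0"
  shows "(\<lambda>x. complex_of_real (flat n (1 + (- a) * (norm (x - y))\<^sup>2))) \<in> test_functions"
  unfolding test_functions_iff
proof (intro conjI smooth_bump exI allI impI)
  \<comment> \<open>The exact support radius is 1 / sqrt a; the value 1 / a + 1 exceeds it for every
    a > 0 and involves no root.\<close>
  fix x :: "real^3" assume x: "norm y + 1 / a + 1 \<le> norm x"
  have "norm (x - y) \<ge> 1 / a + 1"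
    using x norm_triangle_ineq2[of x y] by linarith
  moreover have "(1 / a + 1)\<^sup>2 \<ge> 1 / a"
  proof -
    have "(1 / a + 1)\<^sup>2 = (1 / a)\<^sup>2 + 2 / a + 1" by (simp add: power2_eq_square algebra_simps)
    moreover have "2 / a = 1 / a + 1 / a" "1 / a > 0" using assms by auto
    ultimately show ?thesis by (smt (verit) zero_le_power2)
  qed
  ultimately have "1 / a \<le> (norm (x - y))\<^sup>2"
    using assms by (meson order_trans power_mono add_nonneg_nonneg zero_le_divide_1_iff less_imp_le zero_le_one)
  then have "1 + (- a) * (norm (x - y))\<^sup>2 \<le> 0"
    using assms by (simp add: field_simps)
  then show "complex_of_real (flat n (1 + (- a) * (norm (x - y))\<^sup>2)) = 0"
    by (simp only: flat_nonpos) simp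
qed

lemma smooth_pole:
  assumes "e > 0"
  shows "smooth (\<lambda>x. complex_of_real (pole m (e + 1 * (norm (x - y))\<^sup>2)))"
  unfolding smooth_iff_Ck
proof (intro allI Ck_radial_family[where U = "{0<..}" and \<alpha> = "\<lambda>m. - 1/2" and \<beta> = "\<lambda>m. - (real m / 2)"])
  show "s \<in> {0<..} \<Longrightarrow> (pole m has_real_derivative - 1/2 * pole (m + 1) s + - (real m / 2) * pole (m + 2) s) (at s)" for m s
    by (rule DERIV_pole) simp
qed (use assms in \<open>auto simp: add_pos_nonneg\<close>)

text \<open>
  The function \<open>pole 1 (\<epsilon>\<^sup>2 + r\<^sup>2)\<close> is the desingularised \<open>exp (- r) / r\<close>, and
  \<open>approx_delta \<epsilon>\<close> is its image under \<open>1 - \<Delta>\<close>. Every term of \<open>cutoff_error\<close> carries a factor \<open>a\<close>, so it vanishes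
  as the cutoff radius \<open>1 / sqrt a\<close> grows.
\<close>

definition approx_delta :: "real \<Rightarrow> real^3 \<Rightarrow> real" where
  "approx_delta \<epsilon> z = \<epsilon>\<^sup>2 * (pole 3 (\<epsilon>\<^sup>2 + (norm z)\<^sup>2) + 3 * pole 4 (\<epsilon>\<^sup>2 + (norm z)\<^sup>2)
     + 3 * pole 5 (\<epsilon>\<^sup>2 + (norm z)\<^sup>2))"

text \<open>\<open>exp 1\<close> normalises the cutoff, since \<open>flat 0 1\<close> is exp(-1);
  for a tending to 0 the cutoff tends to 1.\<close>

definition cut_pole :: "real \<Rightarrow> real \<Rightarrow> real \<Rightarrow> real" where
  "cut_pole a \<epsilon> s = exp 1 * (flat 0 (1 - a * s) * pole 1 (\<epsilon>\<^sup>2 + s))"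

definition cutoff_error :: "real \<Rightarrow> real \<Rightarrow> real \<Rightarrow> real" where
  "cutoff_error a \<epsilon> s = exp 1 * (6 * a * flat 2 (1 - a * s) * pole 1 (\<epsilon>\<^sup>2 + s)
     - 4 * (a * s) * flat 2 (1 - a * s) * (pole 2 (\<epsilon>\<^sup>2 + s) + pole 3 (\<epsilon>\<^sup>2 + s))
     - 4 * (a * s) * a * (flat 4 (1 - a * s) - 2 * flat 3 (1 - a * s)) * pole 1 (\<epsilon>\<^sup>2 + s))"

lemma cut_pole_test:
  assumes "a > 0" "\<epsilon> > 0"
  shows "(\<lambda>x. complex_of_real (cut_pole a \<epsilon> ((norm (x - y))\<^sup>2))) \<in> test_functions"
proof -
  have "(\<lambda>x. complex_of_real (exp 1) * (complex_of_real (pole 1 (\<epsilon>\<^sup>2 + 1 * (norm (x - y))\<^sup>2))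
       * complex_of_real (flat 0 (1 + (- a) * (norm (x - y))\<^sup>2)))) \<in> test_functions"
    using assms by (intro test_function_cmult test_function_mult smooth_pole bump_test) auto
  then show ?thesis by (simp add: cut_pole_def mult.commute)
qed

text \<open>Put q^2 = \<epsilon>^2 + s and replace s by q^2 - \<epsilon>^2. Multiplication by q^2
  lowers each exponent by two, so that part cancels the first terms, and only the part with
  \<epsilon>^2 survives. The cancellation expresses that 1 - Delta annihilates exp(-r)/r away from
  the origin.\<close>

lemma pole_identity:
  assumes "\<epsilon> > 0" "s \<ge> 0"
  shows "pole 1 (\<epsilon>\<^sup>2 + s) + 3 * (pole 2 (\<epsilon>\<^sup>2 + s) + pole 3 (\<epsilon>\<^sup>2 + s))
     - s * (pole 3 (\<epsilon>\<^sup>2 + s) + 3 * pole 4 (\<epsilon>\<^sup>2 + s) + 3 * pole 5 (\<epsilon>\<^sup>2 + s)) =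
     \<epsilon>\<^sup>2 * (pole 3 (\<epsilon>\<^sup>2 + s) + 3 * pole 4 (\<epsilon>\<^sup>2 + s) + 3 * pole 5 (\<epsilon>\<^sup>2 + s))"
proof -
  define q where "q = sqrt (\<epsilon>\<^sup>2 + s)"
  have q: "q > 0" using assms by (simp add: q_def add_pos_nonneg)
  have s: "s = q * q - \<epsilon>\<^sup>2" using assms by (simp add: q_def)
  show ?thesis
    unfolding pole_def q_def[symmetric] unfolding s using q
    by (simp add: divide_simps eval_nat_numeral) (simp add: algebra_simps)
qed

text \<open>By the product rule, the terms in which the cutoff is not differentiated combine to
  \<open>approx_delta\<close> through \<open>pole_identity\<close>; all others form
  \<open>cutoff_error\<close>.\<close>

lemma helmholtz_cut_pole:
  assumes "\<epsilon> > 0"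
  shows "helmholtz (\<lambda>x. complex_of_real (cut_pole a \<epsilon> ((norm (x - y))\<^sup>2))) x =
    complex_of_real (exp 1 * flat 0 (1 - a * (norm (x - y))\<^sup>2) * approx_delta \<epsilon> (x - y)
      + cutoff_error a \<epsilon> ((norm (x - y))\<^sup>2))"
proof -
  \<comment> \<open>\<open>G1\<close> and \<open>G2\<close> are the first and second s-derivatives
    of the desingularised pole.\<close>
  define G1 where "G1 s = - (pole 2 (\<epsilon>\<^sup>2 + s) + pole 3 (\<epsilon>\<^sup>2 + s)) / 2" for s
  define G2 where "G2 s = (pole 3 (\<epsilon>\<^sup>2 + s) + 3 * pole 4 (\<epsilon>\<^sup>2 + s) + 3 * pole 5 (\<epsilon>\<^sup>2 + s)) / 4" for s
  define F where "F n s = flat n (1 - a * s)" for n s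
  define P1 where "P1 s = exp 1 * (- a * F 2 s * pole 1 (\<epsilon>\<^sup>2 + s) + F 0 s * G1 s)" for s
  define P2 where "P2 s = exp 1 * (a * a * (F 4 s - 2 * F 3 s) * pole 1 (\<epsilon>\<^sup>2 + s)
     - 2 * a * F 2 s * G1 s + F 0 s * G2 s)" for s
  \<comment> \<open>The half-line extends below 0, so that two-sided derivatives are available at s
    = 0.\<close>
  let ?U = "{- \<epsilon>\<^sup>2<..}"
  have DF: "(F n has_real_derivative - a * (- real n * F (n + 1) s + F (n + 2) s)) (at s)" for n s
  proof -
    have "((\<lambda>s. 1 - a * s) has_real_derivative - a) (at s)"
      by (auto intro!: derivative_eq_intros)
    from DERIV_chain2[of "flat n", OF DERIV_flat this] show ?thesis
      unfolding F_def by (simp add: mult.commute)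
  qed
  have Dp: "((\<lambda>s. pole m (\<epsilon>\<^sup>2 + s)) has_real_derivative - 1/2 * pole (m + 1) (\<epsilon>\<^sup>2 + s) - (real m / 2) * pole (m + 2) (\<epsilon>\<^sup>2 + s)) (at s)"
    if "s \<in> ?U" for m s
  proof -
    have "((\<lambda>s. \<epsilon>\<^sup>2 + s) has_real_derivative 1) (at s)"
      by (auto intro!: derivative_eq_intros)
    moreover have "\<epsilon>\<^sup>2 + s > 0" using that by auto
    ultimately show ?thesis
      using DERIV_chain2[of "pole m", OF DERIV_pole] by fastforce
  qed
  have e1: "exp 1 * (flat 0 (1 - a * s) * pole 1 (\<epsilon>\<^sup>2 + s)) = exp 1 * (F 0 s * pole 1 (\<epsilon>\<^sup>2 + s))" for s
    by (simp add: F_def)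
  have D1: "(cut_pole a \<epsilon> has_real_derivative P1 s) (at s)" if "s \<in> ?U" for s
    unfolding cut_pole_def[abs_def] e1
    by (rule derivative_eq_intros DF Dp[OF that] refl)+
      (simp add: P1_def G1_def field_simps eval_nat_numeral)
  have D2: "(P1 has_real_derivative P2 s) (at s)" if "s \<in> ?U" for s
    unfolding P1_def[abs_def] G1_def
    by (rule derivative_eq_intros DF Dp[OF that] refl | simp)+
      (simp add: P2_def G1_def G2_def field_simps eval_nat_numeral)
  have sub: "{0..} \<subseteq> ?U"
    using assms by (auto intro: less_le_trans[of _ 0])
  let ?s = "(norm (x - y))\<^sup>2"
  note id = pole_identity[OF assms, of ?s]
  have "cut_pole a \<epsilon> ?s - 6 * P1 ?s - 4 * ?s * P2 ?s =
     exp 1 * F 0 ?s * (pole 1 (\<epsilon>\<^sup>2 + ?s) - 6 * G1 ?s - 4 * ?s * G2 ?s) + cutoff_error a \<epsilon> ?s"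
    unfolding cut_pole_def P1_def P2_def cutoff_error_def F_def G1_def by (simp add: field_simps)
  also have "pole 1 (\<epsilon>\<^sup>2 + ?s) - 6 * G1 ?s - 4 * ?s * G2 ?s = approx_delta \<epsilon> (x - y)"
    using id unfolding G1_def G2_def approx_delta_def by (simp add: field_simps)
  finally have "cut_pole a \<epsilon> ?s - 6 * P1 ?s - 4 * ?s * P2 ?s =
     exp 1 * F 0 ?s * approx_delta \<epsilon> (x - y) + cutoff_error a \<epsilon> ?s" .
  with helmholtz_radial[OF D1 D2 sub, where x = x and y = y] show ?thesis
    by (simp add: F_def)
qed

lemma approx_delta_nonneg: "approx_delta \<epsilon> z \<ge> 0"
  by (simp add: approx_delta_def pole_nonneg)

lemma pole_measurable [measurable]: "pole m \<in> borel_measurable borel"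
  unfolding pole_def by measurable

lemma approx_delta_measurable [measurable]: "approx_delta \<epsilon> \<in> borel_measurable borel"
  unfolding approx_delta_def by measurable

lemma approx_delta_le_exp:
  assumes "\<epsilon> > 0"
  shows "\<exists>C\<ge>0. \<forall>z. approx_delta \<epsilon> z \<le> C * exp (- norm z)"
proof -
  define C where "C = \<epsilon>\<^sup>2 * (1 / sqrt (\<epsilon>\<^sup>2) ^ 3 + 3 * (1 / sqrt (\<epsilon>\<^sup>2) ^ 4) + 3 * (1 / sqrt (\<epsilon>\<^sup>2) ^ 5))"
  have "approx_delta \<epsilon> z \<le> C * exp (- norm z)" for z
  proof -
    have "approx_delta \<epsilon> z \<le> \<epsilon>\<^sup>2 * (1 / sqrt (\<epsilon>\<^sup>2) ^ 3 * exp (- norm z)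
        + 3 * (1 / sqrt (\<epsilon>\<^sup>2) ^ 4 * exp (- norm z)) + 3 * (1 / sqrt (\<epsilon>\<^sup>2) ^ 5 * exp (- norm z)))"
      unfolding approx_delta_def using assms
      by (intro mult_left_mono add_mono pole_le_exp) auto
    then show ?thesis by (simp add: C_def algebra_simps)
  qed
  moreover have "C \<ge> 0" using assms by (simp add: C_def)
  ultimately show ?thesis by blast
qed

text \<open>The constant may depend on \<epsilon> but not on a, which makes the right-hand side a
  majorant as a tends to 0. Where the cutoff lives one has a s \<le> 1, and every factor s in
  \<open>cutoff_error\<close> comes paired with an a; elsewhere all \<open>flat\<close> terms
  vanish.\<close>

lemma helmholtz_cut_pole_bound:
  assumes "\<epsilon> > 0"
  shows "\<exists>C\<ge>0. \<forall>a x. 0 < a \<and> a \<le> 1 \<longrightarrow>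
     cmod (helmholtz (\<lambda>x. complex_of_real (cut_pole a \<epsilon> ((norm (x - y))\<^sup>2))) x) \<le> C * exp (- norm (x - y))"
proof -
  obtain M0 M2 M3 M4 where M: "M0 \<ge> 0" "M2 \<ge> 0" "M3 \<ge> 0" "M4 \<ge> 0"
    and flat: "\<And>t. t \<le> 1 \<Longrightarrow> \<bar>flat 0 t\<bar> \<le> M0" "\<And>t. t \<le> 1 \<Longrightarrow> \<bar>flat 2 t\<bar> \<le> M2"
      "\<And>t. t \<le> 1 \<Longrightarrow> \<bar>flat 3 t\<bar> \<le> M3" "\<And>t. t \<le> 1 \<Longrightarrow> \<bar>flat 4 t\<bar> \<le> M4"
    using flat_bounded by metis
  obtain D where D: "D \<ge> 0" "\<And>z. approx_delta \<epsilon> z \<le> D * exp (- norm z)"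
    using approx_delta_le_exp[OF assms] by blast
  define B where "B = 1 / sqrt (\<epsilon>\<^sup>2) ^ 1 + 1 / sqrt (\<epsilon>\<^sup>2) ^ 2 + 1 / sqrt (\<epsilon>\<^sup>2) ^ 3"
  have B0: "B \<ge> 0" using assms by (simp add: B_def)
  define C where "C = exp 1 * (M0 * D + (6 * M2 * B + 4 * M2 * (B + B) + 4 * (M4 + 2 * M3) * B))"
  have C0: "C \<ge> 0" using M D B0 by (simp add: C_def)
  have "cmod (helmholtz (\<lambda>x. complex_of_real (cut_pole a \<epsilon> ((norm (x - y))\<^sup>2))) x) \<le> C * exp (- norm (x - y))"
    if a: "0 < a" "a \<le> 1" for a x
  proof -
    define s where "s = (norm (x - y))\<^sup>2"
    define E where "E = exp (- norm (x - y))"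
    have E0: "E > 0" by (simp add: E_def)
    have s0: "s \<ge> 0" by (simp add: s_def)
    have as: "1 - a * s \<le> 1" using a s0 by simp
    have p: "\<bar>pole m (\<epsilon>\<^sup>2 + s)\<bar> \<le> B * E" if "m \<in> {1, 2, 3}" for m
    proof -
      have "pole m (\<epsilon>\<^sup>2 + s) \<le> 1 / sqrt (\<epsilon>\<^sup>2) ^ m * E"
        unfolding s_def E_def using assms by (intro pole_le_exp) auto
      also have "\<dots> \<le> B * E"
        using that assms E0 by (intro mult_right_mono) (auto simp: B_def)
      finally show ?thesis using pole_nonneg[of "\<epsilon>\<^sup>2 + s" m] s0 by simp
    qed
    have err: "\<bar>cutoff_error a \<epsilon> s\<bar> \<le> exp 1 * ((6 * M2 * B + 4 * M2 * (B + B) + 4 * (M4 + 2 * M3) * B) * E)"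
    proof (cases "a * s \<le> 1")
      case True
      have as0: "0 \<le> a * s" using a s0 by simp
      have t1: "\<bar>6 * a * flat 2 (1 - a * s) * pole 1 (\<epsilon>\<^sup>2 + s)\<bar> \<le> 6 * 1 * M2 * (B * E)"
        unfolding abs_mult using a as M p[of 1] flat by (intro mult_mono) auto
      have t2: "\<bar>4 * (a * s) * flat 2 (1 - a * s) * (pole 2 (\<epsilon>\<^sup>2 + s) + pole 3 (\<epsilon>\<^sup>2 + s))\<bar>
          \<le> 4 * 1 * M2 * (B * E + B * E)"
        unfolding abs_mult[of _ "_ + _"] abs_mult[of _ "flat _ _"]
        using True as0 as M p[of 2] p[of 3] flat by (intro mult_mono order_trans[OF abs_triangle_ineq] add_mono) (auto simp: abs_mult)
      have t3: "\<bar>4 * (a * s) * a * (flat 4 (1 - a * s) - 2 * flat 3 (1 - a * s)) * pole 1 (\<epsilon>\<^sup>2 + s)\<bar>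
          \<le> 4 * 1 * 1 * (M4 + 2 * M3) * (B * E)"
      proof -
        have "\<bar>flat 4 (1 - a * s) - 2 * flat 3 (1 - a * s)\<bar> \<le> M4 + 2 * M3"
          using flat(3,4)[OF as] by linarith
        moreover have "\<bar>4 * (a * s) * a\<bar> \<le> 4 * 1 * 1"
          unfolding abs_mult using True as0 a by (intro mult_mono) auto
        ultimately show ?thesis
          unfolding abs_mult[of _ "pole _ _"] abs_mult[of _ "_ - _"]
          using M p[of 1] by (intro mult_mono) auto
      qed
      show ?thesis
        unfolding cutoff_error_def abs_mult
        by (intro mult_mono) (use t1 t2 t3 in \<open>auto simp: algebra_simps\<close>)
    next
      case False
      then have "1 - a * s \<le> 0" by simp
      then have "cutoff_error a \<epsilon> s = 0" by (simp add: cutoff_error_def flat_nonpos)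
      then show ?thesis using M B0 E0 by simp
    qed
    have main: "\<bar>flat 0 (1 - a * s) * approx_delta \<epsilon> (x - y)\<bar> \<le> M0 * (D * E)"
      unfolding abs_mult using flat(1)[OF as] D(2)[of "x - y"] approx_delta_nonneg[of \<epsilon> "x - y"] M(1)
      by (intro mult_mono) (auto simp: E_def)
    have "cmod (helmholtz (\<lambda>x. complex_of_real (cut_pole a \<epsilon> ((norm (x - y))\<^sup>2))) x) =
        \<bar>exp 1 * (flat 0 (1 - a * s) * approx_delta \<epsilon> (x - y)) + cutoff_error a \<epsilon> s\<bar>"
      unfolding helmholtz_cut_pole[OF assms] norm_of_real by (simp add: s_def mult.assoc)
    also have "\<dots> \<le> \<bar>exp 1 * (flat 0 (1 - a * s) * approx_delta \<epsilon> (x - y))\<bar> + \<bar>cutoff_error a \<epsilon> s\<bar>"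
      by (rule abs_triangle_ineq)
    also have "\<dots> \<le> exp 1 * (M0 * (D * E)) + exp 1 * ((6 * M2 * B + 4 * M2 * (B + B) + 4 * (M4 + 2 * M3) * B) * E)"
      using main err by (intro add_mono) (auto simp: abs_mult)
    also have "\<dots> = C * E" by (simp add: C_def algebra_simps)
    finally show ?thesis by (simp add: E_def)
  qed
  with C0 show ?thesis by blast
qed

lemma isCont_flat_at_cutoff: "((\<lambda>a. flat n (1 - a * s)) \<longlongrightarrow> flat n 1) (at_right 0)"
  by (rule isCont_tendsto_compose[OF isCont_flat]) (auto intro!: tendsto_eq_intros)

lemma helmholtz_cut_pole_tendsto:
  assumes "\<epsilon> > 0"
  shows "((\<lambda>a. helmholtz (\<lambda>x. complex_of_real (cut_pole a \<epsilon> ((norm (x - y))\<^sup>2))) x)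
     \<longlongrightarrow> complex_of_real (approx_delta \<epsilon> (x - y))) (at_right 0)"
  unfolding helmholtz_cut_pole[OF assms] cutoff_error_def
  by (rule tendsto_eq_intros isCont_flat_at_cutoff refl)+ (simp add: flat_def exp_minus)

lemma cut_pole_tendsto: "((\<lambda>a. cut_pole a \<epsilon> s) \<longlongrightarrow> pole 1 (\<epsilon>\<^sup>2 + s)) (at_right 0)"
  unfolding cut_pole_def
  by (rule tendsto_eq_intros isCont_flat_at_cutoff refl)+ (simp add: flat_def exp_minus)

lemma cut_pole_bound:
  assumes "\<epsilon> > 0"
  shows "\<exists>C\<ge>0. \<forall>a x. 0 < a \<longrightarrow> \<bar>cut_pole a \<epsilon> ((norm (x - y :: real^3))\<^sup>2)\<bar> \<le> C * exp (- norm (x - y))"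
proof -
  obtain M where M: "M \<ge> 0" "\<And>t. t \<le> 1 \<Longrightarrow> \<bar>flat 0 t\<bar> \<le> M"
    using flat_bounded by blast
  have "\<bar>cut_pole a \<epsilon> ((norm (x - y))\<^sup>2)\<bar> \<le> (exp 1 * (M * (1 / sqrt (\<epsilon>\<^sup>2) ^ 1))) * exp (- norm (x - y))"
    if "a > 0" for a and x :: "real^3"
  proof -
    have "\<bar>cut_pole a \<epsilon> ((norm (x - y))\<^sup>2)\<bar> \<le> exp 1 * (M * (1 / sqrt (\<epsilon>\<^sup>2) ^ 1 * exp (- norm (x - y))))"
      unfolding cut_pole_def abs_mult
      using that assms M pole_le_exp[of "\<epsilon>\<^sup>2" "norm (x - y)" 1] pole_nonneg[of "\<epsilon>\<^sup>2 + (norm (x - y))\<^sup>2" 1]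
      by (intro mult_mono) auto
    then show ?thesis by (simp add: mult.assoc)
  qed
  then show ?thesis using M(1) assms by (intro exI[of _ "exp 1 * (M * (1 / sqrt (\<epsilon>\<^sup>2) ^ 1))"]) auto
qed

section \<open>Affine changes of variables\<close>

lemma
  fixes f :: "real^3 \<Rightarrow> 'b::{banach, second_countable_topology}"
  assumes [measurable]: "f \<in> borel_measurable borel" and "c \<noteq> 0"
  shows integral_affine: "(LINT x|lborel. f x) = \<bar>c\<bar> ^ 3 *\<^sub>R (LINT x|lborel. f (t + c *\<^sub>R x))"
    and integrable_affine_iff: "integrable lborel (\<lambda>x. f (t + c *\<^sub>R x)) \<longleftrightarrow> integrable lborel f"
proof -
  have L: "(lborel :: (real^3) measure) = density (distr lborel borel (\<lambda>x. t + c *\<^sub>R x)) (\<lambda>_. ennreal (\<bar>c\<bar> ^ 3))"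
    using lborel_affine[OF \<open>c \<noteq> 0\<close>, of t] by (simp add: ennreal_power)
  show "(LINT x|lborel. f x) = \<bar>c\<bar> ^ 3 *\<^sub>R (LINT x|lborel. f (t + c *\<^sub>R x))"
    by (subst L, subst integral_density) (auto simp: integral_distr)
  have *: "integrable lborel f \<longleftrightarrow> integrable lborel (\<lambda>x. \<bar>c\<bar> ^ 3 *\<^sub>R f (t + c *\<^sub>R x))"
    by (subst L, subst integrable_density) (auto simp: integrable_distr_eq)
  show "integrable lborel (\<lambda>x. f (t + c *\<^sub>R x)) \<longleftrightarrow> integrable lborel f"
  proof (intro iffI)
    assume "integrable lborel f"
    then have "integrable lborel (\<lambda>x. \<bar>c\<bar> ^ 3 *\<^sub>R f (t + c *\<^sub>R x))"
      by (rule *[THEN iffD1])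
    then have "integrable lborel (\<lambda>x. inverse (\<bar>c\<bar> ^ 3) *\<^sub>R \<bar>c\<bar> ^ 3 *\<^sub>R f (t + c *\<^sub>R x))"
      by (rule integrable_scaleR_right)
    moreover have "(\<lambda>x. inverse (\<bar>c\<bar> ^ 3) *\<^sub>R \<bar>c\<bar> ^ 3 *\<^sub>R f (t + c *\<^sub>R x)) = (\<lambda>x. f (t + c *\<^sub>R x))"
      using \<open>c \<noteq> 0\<close> by (simp add: fun_eq_iff)
    ultimately show "integrable lborel (\<lambda>x. f (t + c *\<^sub>R x))"
      by (simp only:)
  next
    assume "integrable lborel (\<lambda>x. f (t + c *\<^sub>R x))"
    then have "integrable lborel (\<lambda>x. \<bar>c\<bar> ^ 3 *\<^sub>R f (t + c *\<^sub>R x))"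
      by (rule integrable_scaleR_right)
    then show "integrable lborel f"
      by (rule *[THEN iffD2])
  qed
qed

lemma integrable_translate:
  fixes f :: "real^3 \<Rightarrow> 'b::{banach, second_countable_topology}"
  assumes "f \<in> borel_measurable borel"
  shows "integrable lborel (\<lambda>x. f (x - y)) \<longleftrightarrow> integrable lborel f"
  using integrable_affine_iff[OF assms, of 1 "- y"] by simp

lemma integral_translate:
  fixes f :: "real^3 \<Rightarrow> 'b::{banach, second_countable_topology}"
  assumes "f \<in> borel_measurable borel"
  shows "(LINT x|lborel. f (x - y)) = (LINT x|lborel. f x)"
  using integral_affine[OF assms, of 1 "- y"] by simp

section \<open>Square-integrable functions\<close>

lemma L2_measurable: "f \<in> L2 \<Longrightarrow> f \<in> borel_measurable borel"
  by (simp add: L2_def)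

lemma L2I:
  assumes "f \<in> borel_measurable borel" "integrable lborel g" "\<And>x. (cmod (f x))\<^sup>2 \<le> g x"
  shows "f \<in> L2"
proof -
  have "integrable lborel (\<lambda>x. (cmod (f x))\<^sup>2)"
  proof (rule Bochner_Integration.integrable_bound[OF assms(2)])
    show "AE x in lborel. norm ((cmod (f x))\<^sup>2) \<le> norm (g x)"
      using order_trans[OF assms(3) abs_ge_self] by (intro AE_I2) simp
  qed (use assms(1) in simp)
  with assms(1) show ?thesis by (simp add: L2_def)
qed

lemma mult_le_sum_squares: "(a::real) * b \<le> a\<^sup>2 + b\<^sup>2"
proof -
  have "0 \<le> (a - b)\<^sup>2 + a\<^sup>2 + b\<^sup>2" by simp
  then have "0 \<le> a\<^sup>2 + b\<^sup>2 - 2 * a * b + a\<^sup>2 + b\<^sup>2" by (simp only: power2_diff)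
  then show ?thesis by linarith
qed

lemma L2_mult_integrable:
  assumes "f \<in> L2" "g \<in> L2"
  shows "integrable lborel (\<lambda>x. f x * g x)"
proof (rule Bochner_Integration.integrable_bound)
  show "integrable lborel (\<lambda>x. (cmod (f x))\<^sup>2 + (cmod (g x))\<^sup>2)"
    using assms by (simp add: L2_def)
  show "(\<lambda>x. f x * g x) \<in> borel_measurable lborel"
    using assms by (simp add: L2_def borel_measurable_times)
  show "AE x in lborel. cmod (f x * g x) \<le> norm ((cmod (f x))\<^sup>2 + (cmod (g x))\<^sup>2)"
    by (auto simp: norm_mult intro!: AE_I2 order_trans[OF mult_le_sum_squares])
qed

lemma L2_add:
  assumes "f \<in> L2" "g \<in> L2"
  shows "(\<lambda>x. f x + g x) \<in> L2"
proof (rule L2I)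
  show "(\<lambda>x. f x + g x) \<in> borel_measurable borel"
    by (intro borel_measurable_add L2_measurable assms)
  show "integrable lborel (\<lambda>x. 2 * (cmod (f x))\<^sup>2 + 2 * (cmod (g x))\<^sup>2)"
    using assms by (simp add: L2_def)
  show "(cmod (f x + g x))\<^sup>2 \<le> 2 * (cmod (f x))\<^sup>2 + 2 * (cmod (g x))\<^sup>2" for x
  proof -
    have "(cmod (f x + g x))\<^sup>2 \<le> (cmod (f x) + cmod (g x))\<^sup>2"
      by (intro power_mono norm_triangle_ineq) auto
    also have "\<dots> \<le> 2 * (cmod (f x))\<^sup>2 + 2 * (cmod (g x))\<^sup>2"
      using zero_le_power2[of "cmod (f x) - cmod (g x)"] by (simp add: power2_sum power2_diff)
    finally show ?thesis .
  qed
qed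

lemma L2_cmult: "f \<in> L2 \<Longrightarrow> (\<lambda>x. c * f x) \<in> L2"
  by (simp add: L2_def norm_mult power_mult_distrib borel_measurable_times)

lemma L2_diff: "f \<in> L2 \<Longrightarrow> g \<in> L2 \<Longrightarrow> (\<lambda>x. f x - g x) \<in> L2"
  using L2_add[OF _ L2_cmult[of g "-1"], of f] by simp

lemma L2_zero: "(\<lambda>x. 0) \<in> L2"
  by (simp add: L2_def)

lemma L2_sum: "finite J \<Longrightarrow> (\<And>j. j \<in> J \<Longrightarrow> f j \<in> L2) \<Longrightarrow> (\<lambda>x. \<Sum>j\<in>J. f j x) \<in> L2"
  by (induction J rule: finite_induct) (auto intro: L2_zero L2_add)

lemma L2_cnj: "f \<in> L2 \<Longrightarrow> (\<lambda>x. cnj (f x)) \<in> L2"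
  using borel_measurable_continuous_on[of cnj f lborel] by (simp add: L2_def continuous_on_cnj)

text \<open>Only moduli enter the estimate, so it holds for the bilinear pairing without
  conjugation, which is the one used against test functions.\<close>

lemma L2_Cauchy_Schwarz:
  assumes "f \<in> L2" "g \<in> L2"
  shows "(cmod (LINT x|lborel. f x * g x))\<^sup>2 \<le> (LINT x|lborel. (cmod (f x))\<^sup>2) * (LINT x|lborel. (cmod (g x))\<^sup>2)"
proof -
  have m: "f \<in> borel_measurable lborel" "g \<in> borel_measurable lborel"
    and i: "integrable lborel (\<lambda>x. (cmod (f x))\<^sup>2)" "integrable lborel (\<lambda>x. (cmod (g x))\<^sup>2)"
    using assms by (auto simp: L2_def)
  have ifg: "integrable lborel (\<lambda>x. cmod (f x) * cmod (g x))"
    using integrable_norm[OF L2_mult_integrable[OF assms]] by (simp add: norm_mult)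
  have "(\<integral>\<^sup>+x. ennreal (cmod (f x)) * ennreal (cmod (g x)) \<partial>lborel)\<^sup>2 \<le>
      (\<integral>\<^sup>+x. (ennreal (cmod (f x)))\<^sup>2 \<partial>lborel) * (\<integral>\<^sup>+x. (ennreal (cmod (g x)))\<^sup>2 \<partial>lborel)"
    using m by (intro Cauchy_Schwarz_nn_integral) auto
  also have "(\<integral>\<^sup>+x. ennreal (cmod (f x)) * ennreal (cmod (g x)) \<partial>lborel) = ennreal (LINT x|lborel. cmod (f x) * cmod (g x))"
    using ifg by (simp add: ennreal_mult[symmetric] nn_integral_eq_integral)
  also have "(\<integral>\<^sup>+x. (ennreal (cmod (f x)))\<^sup>2 \<partial>lborel) = ennreal (LINT x|lborel. (cmod (f x))\<^sup>2)"
    using i(1) by (simp add: ennreal_power nn_integral_eq_integral)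
  also have "(\<integral>\<^sup>+x. (ennreal (cmod (g x)))\<^sup>2 \<partial>lborel) = ennreal (LINT x|lborel. (cmod (g x))\<^sup>2)"
    using i(2) by (simp add: ennreal_power nn_integral_eq_integral)
  finally have "(LINT x|lborel. cmod (f x) * cmod (g x))\<^sup>2 \<le> (LINT x|lborel. (cmod (f x))\<^sup>2) * (LINT x|lborel. (cmod (g x))\<^sup>2)"
    by (simp add: ennreal_power ennreal_mult[symmetric] mult_nonneg_nonneg)
  moreover have "cmod (LINT x|lborel. f x * g x) \<le> (LINT x|lborel. cmod (f x) * cmod (g x))"
    using integral_norm_bound[of lborel "\<lambda>x. f x * g x"] by (simp add: norm_mult)
  ultimately show ?thesis
    by (meson norm_ge_zero order_trans power_mono)
qed

lemma test_function_L2: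
  assumes "f \<in> test_functions" shows "f \<in> L2"
proof -
  obtain B where B: "\<And>x. norm x \<ge> B \<Longrightarrow> f x = 0"
    using assms by (metis test_functionE)
  have "continuous_on UNIV f" using assms by (rule test_function_continuous)
  then have "integrable lborel (\<lambda>x. indicator (cball 0 B) x *\<^sub>R (cmod (f x))\<^sup>2)"
    by (intro borel_integrable_compact) (auto intro!: continuous_intros intro: continuous_on_subset)
  moreover have "(\<lambda>x. indicator (cball 0 B) x *\<^sub>R (cmod (f x))\<^sup>2) = (\<lambda>x. (cmod (f x))\<^sup>2)"
    using B by (auto simp: indicator_def fun_eq_iff)
  ultimately show ?thesis
    using borel_measurable_continuous_onI[OF \<open>continuous_on UNIV f\<close>] by (simp add: L2_def)
qed

lemma exp_minus_norm_L2: "(\<lambda>x. complex_of_real (exp (- norm (x - y)))) \<in> L2"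
proof (rule L2I)
  show "integrable lborel (\<lambda>x. exp (- norm (x - y)))"
    using integrable_translate[of "\<lambda>x. exp (- norm x)" y] exp_minus_norm_integrable by simp
  show "(cmod (complex_of_real (exp (- norm (x - y)))))\<^sup>2 \<le> exp (- norm (x - y))" for x
    by (simp add: exp_double[symmetric] power2_eq_square exp_add[symmetric])
qed simp

lemma L2_mult_exp_integrable:
  assumes "f \<in> L2"
  shows "integrable lborel (\<lambda>x. cmod (f x) * exp (- norm (x - y)))"
  using integrable_norm[OF L2_mult_integrable[OF assms exp_minus_norm_L2[of y]]]
  by (simp add: norm_mult)

section \<open>The kernel exp(-r)/r as a square-integrable function of x, for an arbitrary
  centre\<close>

definition yukawa :: "real^3 \<Rightarrow> real^3 \<Rightarrow> real" where
  "yukawa y x = exp (- norm (x - y)) / norm (x - y)"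

lemma phi_eq_yukawa: "phi X j = (\<lambda>x. complex_of_real (yukawa (X j) x))"
  by (auto simp: phi_def yukawa_def)

lemma yukawa_measurable [measurable]: "yukawa y \<in> borel_measurable borel"
  unfolding yukawa_def by measurable

lemma yukawa_nonneg: "yukawa y x \<ge> 0"
  by (simp add: yukawa_def)

lemma yukawa_square: "(yukawa y x)\<^sup>2 = exp (- 2 * norm (x - y)) / (norm (x - y))\<^sup>2"
  by (simp add: yukawa_def power_divide exp_double[symmetric])

lemma yukawa_square_integrable: "integrable lborel (\<lambda>x. (yukawa y x)\<^sup>2)"
  unfolding yukawa_square
  using integrable_translate[of "\<lambda>x. exp (- 2 * norm x) / (norm x)\<^sup>2" y] exp_div_square_integrable[of 2]
  by simp

lemma yukawa_L2: "(\<lambda>x. complex_of_real (yukawa y x)) \<in> L2"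
  using yukawa_square_integrable by (simp add: L2_def)

section \<open>Very weak solutions of the Helmholtz equation\<close>

text \<open>Distributional form of (1 - Delta) f = h, in which no derivative falls on f. It covers
  elements of \<open>W22\<close>, test functions, and the merely square-integrable solutions with h
  = 0 of the uniqueness argument.\<close>

definition weak_helmholtz :: "(real^3 \<Rightarrow> complex) \<Rightarrow> (real^3 \<Rightarrow> complex) \<Rightarrow> bool" where
  "weak_helmholtz f h \<longleftrightarrow> (\<forall>\<psi>\<in>test_functions.
     (LINT x|lborel. f x * helmholtz \<psi> x) = (LINT x|lborel. h x * \<psi> x))"

lemma inverse_Suc_at_right: "filterlim (\<lambda>n. inverse (real (Suc n))) (at_right 0) sequentially"
  unfolding filterlim_at using LIMSEQ_inverse_real_of_nat by auto

lemma inverse_Suc_le_1: "inverse (real (Suc n)) \<le> 1"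
  by (simp add: inverse_eq_divide)

text \<open>The desingularised pole has unbounded support, so the hypothesis applies only to its
  cutoffs. Both sides converge as the cutoff parameter a = 1/(n + 1) tends to 0, with majorants that
  are multiples of |f| exp(-r) and |h| exp(-r).\<close>

lemma weak_helmholtz_mollified_pole:
  assumes f: "f \<in> L2" and h: "h \<in> L2" and wk: "weak_helmholtz f h" and "\<epsilon> > 0"
  shows "(LINT x|lborel. f x * complex_of_real (approx_delta \<epsilon> (x - y))) =
    (LINT x|lborel. h x * complex_of_real (pole 1 (\<epsilon>\<^sup>2 + (norm (x - y))\<^sup>2)))"
proof -
  define a where "a n = inverse (real (Suc n))" for n
  have a: "0 < a n" "a n \<le> 1" for n
    using inverse_Suc_le_1 by (auto simp: a_def)
  have a0: "filterlim a (at_right 0) sequentially"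
    unfolding a_def[abs_def] by (rule inverse_Suc_at_right)
  define \<psi> where "\<psi> n x = complex_of_real (cut_pole (a n) \<epsilon> ((norm (x - y))\<^sup>2))" for n x
  have test: "\<psi> n \<in> test_functions" for n
    unfolding \<psi>_def by (rule cut_pole_test) (use a \<open>\<epsilon> > 0\<close> in auto)
  have [measurable]: "f \<in> borel_measurable borel" "h \<in> borel_measurable borel"
    using f h L2_measurable by auto
  have [measurable]: "\<psi> n \<in> borel_measurable borel" "helmholtz (\<psi> n) \<in> borel_measurable borel" for n
    using test test_function_helmholtz test_function_L2 L2_measurable by blast+
  obtain C where C: "\<And>n x. cmod (helmholtz (\<psi> n) x) \<le> C * exp (- norm (x - y))"
    unfolding \<psi>_def using helmholtz_cut_pole_bound[OF \<open>\<epsilon> > 0\<close>, of y] a by blast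
  obtain D where D: "\<And>n x. \<bar>cut_pole (a n) \<epsilon> ((norm (x - y))\<^sup>2)\<bar> \<le> D * exp (- norm (x - y))"
    using cut_pole_bound[OF \<open>\<epsilon> > 0\<close>, of y] a by blast
  have 1: "(\<lambda>n. LINT x|lborel. f x * helmholtz (\<psi> n) x) \<longlonglongrightarrow>
     (LINT x|lborel. f x * complex_of_real (approx_delta \<epsilon> (x - y)))"
  proof (rule integral_dominated_convergence[where w = "\<lambda>x. C * (cmod (f x) * exp (- norm (x - y)))"])
    show "AE x in lborel. (\<lambda>n. f x * helmholtz (\<psi> n) x) \<longlonglongrightarrow> f x * complex_of_real (approx_delta \<epsilon> (x - y))"
      unfolding \<psi>_def
      by (intro AE_I2 tendsto_mult tendsto_const filterlim_compose[OF helmholtz_cut_pole_tendsto[OF \<open>\<epsilon> > 0\<close>] a0])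
    show "AE x in lborel. cmod (f x * helmholtz (\<psi> n) x) \<le> C * (cmod (f x) * exp (- norm (x - y)))" for n
      using mult_left_mono[OF C norm_ge_zero] by (auto simp: norm_mult algebra_simps)
  qed (use L2_mult_exp_integrable[OF f] in \<open>auto intro!: integrable_mult_right\<close>)
  have 2: "(\<lambda>n. LINT x|lborel. h x * \<psi> n x) \<longlonglongrightarrow>
     (LINT x|lborel. h x * complex_of_real (pole 1 (\<epsilon>\<^sup>2 + (norm (x - y))\<^sup>2)))"
  proof (rule integral_dominated_convergence[where w = "\<lambda>x. D * (cmod (h x) * exp (- norm (x - y)))"])
    show "AE x in lborel. (\<lambda>n. h x * \<psi> n x) \<longlonglongrightarrow> h x * complex_of_real (pole 1 (\<epsilon>\<^sup>2 + (norm (x - y))\<^sup>2))"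
      unfolding \<psi>_def
      by (intro AE_I2 tendsto_mult tendsto_const tendsto_of_real filterlim_compose[OF cut_pole_tendsto a0])
    show "AE x in lborel. cmod (h x * \<psi> n x) \<le> D * (cmod (h x) * exp (- norm (x - y)))" for n
      using mult_left_mono[OF D norm_ge_zero] by (auto simp: \<psi>_def norm_mult algebra_simps)
  qed (use L2_mult_exp_integrable[OF h] in \<open>auto intro!: integrable_mult_right\<close>)
  have "(LINT x|lborel. f x * helmholtz (\<psi> n) x) = (LINT x|lborel. h x * \<psi> n x)" for n
    using wk test by (simp add: weak_helmholtz_def)
  with 1 2 show ?thesis using LIMSEQ_unique by simp
qed

section \<open>Concentration of the mollified delta function and the reproducing property\<close>

definition scaled_delta :: "real \<Rightarrow> real^3 \<Rightarrow> real" where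
  "scaled_delta \<epsilon> z = exp (- (\<epsilon> * bracket z)) * ((\<epsilon> * bracket z)\<^sup>2 + 3 * (\<epsilon> * bracket z) + 3) / bracket z ^ 5"

text \<open>The factor \<epsilon>^3 is the Jacobian of x = y + \<epsilon> z. The profile on the
  right tends to \<open>3 / bracket z ^ 5\<close> as \<epsilon> tends to 0, which is where
  \<open>kappa\<close> comes from.\<close>

lemma approx_delta_scale:
  assumes "\<epsilon> > 0"
  shows "\<epsilon> ^ 3 * approx_delta \<epsilon> (\<epsilon> *\<^sub>R z) = scaled_delta \<epsilon> z"
proof -
  have "\<epsilon>\<^sup>2 + (norm (\<epsilon> *\<^sub>R z))\<^sup>2 = \<epsilon>\<^sup>2 * (1 + (norm z)\<^sup>2)"
    by (simp add: power_mult_distrib algebra_simps)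
  then have q: "sqrt (\<epsilon>\<^sup>2 + (norm (\<epsilon> *\<^sub>R z))\<^sup>2) = \<epsilon> * bracket z"
    using assms by (simp add: real_sqrt_mult bracket_def)
  have "bracket z > 0" using bracket_ge_1[of z] by linarith
  then show ?thesis
    unfolding approx_delta_def pole_def q scaled_delta_def using assms
    by (simp add: divide_simps eval_nat_numeral) (simp add: algebra_simps)
qed

text \<open>With t = \<epsilon> * \<open>bracket z\<close>, exp(-t) absorbs the quartic (t^2 + 3 t +
  3)(1 + t^2) at the cost of the constant 64. The version with the extra weight keeps the second
  moments of \<open>approx_delta\<close> bounded uniformly in \<epsilon>.\<close>

lemma scaled_delta_bounds:
  assumes "\<epsilon> > 0"
  shows "0 \<le> scaled_delta \<epsilon> z" "scaled_delta \<epsilon> z * (1 + (norm (\<epsilon> *\<^sub>R z))\<^sup>2) \<le> 64 / bracket z ^ 5"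
    "scaled_delta \<epsilon> z \<le> 64 / bracket z ^ 5"
proof -
  define t where "t = \<epsilon> * bracket z"
  have j: "bracket z > 0" using bracket_ge_1[of z] by linarith
  have t: "t > 0" using assms j by (simp add: t_def)
  have "norm (\<epsilon> *\<^sub>R z) \<le> t"
    using assms by (simp add: t_def bracket_def real_le_rsqrt)
  then have nt: "(norm (\<epsilon> *\<^sub>R z))\<^sup>2 \<le> t\<^sup>2" by (intro power_mono) auto
  have pos: "t\<^sup>2 + 3 * t + 3 \<ge> 0" using t by simp
  show 0: "0 \<le> scaled_delta \<epsilon> z"
    using pos j by (simp add: scaled_delta_def t_def[symmetric])
  have "(t\<^sup>2 + 3 * t + 3) * (1 + t\<^sup>2) = 3 + 3 * t + 4 * t\<^sup>2 + 3 * t ^ 3 + t ^ 4"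
    by (simp add: algebra_simps power2_eq_square power3_eq_cube power4_eq_xxxx)
  also have "\<dots> \<le> 64 * (1 + t + t\<^sup>2 / 2 + t ^ 3 / 8 + t ^ 4 / 64)"
  proof -
    have "t\<^sup>2 \<ge> 0" "t ^ 3 \<ge> 0" using t by auto
    then show ?thesis using t by (simp add: algebra_simps)
  qed
  also have "\<dots> \<le> 64 * exp t"
    using exp_lower_quartic[of t] t by simp
  finally have "(t\<^sup>2 + 3 * t + 3) * (1 + t\<^sup>2) \<le> 64 * exp t" .
  then have "exp (- t) * ((t\<^sup>2 + 3 * t + 3) * (1 + t\<^sup>2)) \<le> exp (- t) * (64 * exp t)"
    by (rule mult_left_mono) simp
  also have "\<dots> = 64" by (simp add: exp_minus)
  finally have "exp (- t) * (t\<^sup>2 + 3 * t + 3) * (1 + t\<^sup>2) \<le> 64" by (simp add: mult.assoc)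
  moreover have "exp (- t) * (t\<^sup>2 + 3 * t + 3) * (1 + (norm (\<epsilon> *\<^sub>R z))\<^sup>2) \<le> exp (- t) * (t\<^sup>2 + 3 * t + 3) * (1 + t\<^sup>2)"
    using nt pos by (intro mult_left_mono) auto
  ultimately have "exp (- t) * (t\<^sup>2 + 3 * t + 3) * (1 + (norm (\<epsilon> *\<^sub>R z))\<^sup>2) \<le> 64" by linarith
  then have "exp (- t) * (t\<^sup>2 + 3 * t + 3) * (1 + (norm (\<epsilon> *\<^sub>R z))\<^sup>2) / bracket z ^ 5 \<le> 64 / bracket z ^ 5"
    using j by (intro divide_right_mono) auto
  then show 1: "scaled_delta \<epsilon> z * (1 + (norm (\<epsilon> *\<^sub>R z))\<^sup>2) \<le> 64 / bracket z ^ 5"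
    by (simp add: scaled_delta_def t_def)
  have "scaled_delta \<epsilon> z * 1 \<le> scaled_delta \<epsilon> z * (1 + (norm (\<epsilon> *\<^sub>R z))\<^sup>2)"
    using 0 by (intro mult_left_mono) auto
  with 1 show "scaled_delta \<epsilon> z \<le> 64 / bracket z ^ 5" by linarith
qed

lemma scaled_delta_measurable [measurable]: "scaled_delta \<epsilon> \<in> borel_measurable borel"
  unfolding scaled_delta_def by measurable

text \<open>Equal to \<open>4 * pi\<close>, but only its positivity matters.\<close>

definition kappa :: real where
  "kappa = (LINT z|lborel. 3 / bracket z ^ 5)"

lemma inverse_bracket5_integrable: "integrable lborel (\<lambda>z. c / bracket z ^ 5)"
  using integrable_mult_right[OF inverse_bracket_power_integrable[of 5], of c] by simp

lemma kappa_pos: "kappa > 0"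
proof -
  have j: "3 / bracket z ^ 5 > 0" for z using bracket_ge_1[of z] by simp
  have "kappa \<ge> 0" unfolding kappa_def
    by (rule Bochner_Integration.integral_nonneg) (use j less_imp_le in blast)
  moreover have "kappa \<noteq> 0"
  proof
    assume "kappa = 0"
    then have "AE z::real^3 in lborel. 3 / bracket z ^ 5 = 0"
      unfolding kappa_def using integral_nonneg_eq_0_iff_AE[OF inverse_bracket5_integrable[of 3]] j
      by (simp add: less_imp_le)
    then have "AE z::real^3 in lborel. False"
      by eventually_elim (use j in \<open>simp add: less_le\<close>)
    then show False using AE_iff_null[of "lborel :: (real^3) measure" "\<lambda>_. False"] by (simp add: null_sets_def)
  qed
  ultimately show ?thesis by simp
qed

text \<open>A fixed null sequence in (0, 1]; dominated convergence is applied along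
  sequences.\<close>

definition eps :: "nat \<Rightarrow> real" where
  "eps n = inverse (real (Suc n))"

lemma eps_pos: "eps n > 0" and eps_tendsto: "eps \<longlonglongrightarrow> 0"
  unfolding eps_def[abs_def] using LIMSEQ_inverse_real_of_nat by auto

lemma approx_delta_limit_bounded:
  fixes f :: "real^3 \<Rightarrow> complex"
  assumes [measurable]: "f \<in> borel_measurable borel" and M: "\<And>x. cmod (f x) \<le> M" and cont: "isCont f y"
  shows "(\<lambda>n. LINT x|lborel. f x * complex_of_real (approx_delta (eps n) (x - y))) \<longlonglongrightarrow> of_real kappa * f y"
proof -
  have eq: "(LINT x|lborel. f x * complex_of_real (approx_delta (eps n) (x - y))) =
      (LINT z|lborel. f (y + eps n *\<^sub>R z) * complex_of_real (scaled_delta (eps n) z))" for n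
  proof -
    have "(LINT x|lborel. f x * complex_of_real (approx_delta (eps n) (x - y))) =
       \<bar>eps n\<bar> ^ 3 *\<^sub>R (LINT z|lborel. f (y + eps n *\<^sub>R z) * complex_of_real (approx_delta (eps n) (eps n *\<^sub>R z)))"
      using eps_pos[of n] by (subst integral_affine[where c = "eps n" and t = y]) auto
    also have "\<dots> = (LINT z|lborel. f (y + eps n *\<^sub>R z) * complex_of_real (eps n ^ 3 * approx_delta (eps n) (eps n *\<^sub>R z)))"
      using eps_pos[of n] unfolding integral_scaleR_right[symmetric]
      by (intro Bochner_Integration.integral_cong) (auto simp: scaleR_conv_of_real)
    finally show ?thesis by (simp only: approx_delta_scale[OF eps_pos])
  qed
  have "(\<lambda>n. LINT z|lborel. f (y + eps n *\<^sub>R z) * complex_of_real (scaled_delta (eps n) z)) \<longlonglongrightarrow>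
     (LINT z|lborel. f y * complex_of_real (3 / bracket z ^ 5))"
  proof (rule integral_dominated_convergence[where w = "\<lambda>z. (M * 64) / bracket z ^ 5"])
    show "integrable lborel (\<lambda>z. (M * 64) / bracket z ^ 5)"
      by (rule inverse_bracket5_integrable)
    show "AE z in lborel. cmod (f (y + eps n *\<^sub>R z) * complex_of_real (scaled_delta (eps n) z)) \<le> (M * 64) / bracket z ^ 5" for n
    proof (rule AE_I2)
      fix z
      have "cmod (f (y + eps n *\<^sub>R z)) * \<bar>scaled_delta (eps n) z\<bar> \<le> M * (64 / bracket z ^ 5)"
        using M[of 0] norm_ge_zero[of "f 0"] scaled_delta_bounds[OF eps_pos, of n z]
        by (intro mult_mono M) (auto simp del: norm_ge_zero)
      then show "cmod (f (y + eps n *\<^sub>R z) * complex_of_real (scaled_delta (eps n) z)) \<le> (M * 64) / bracket z ^ 5"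
        by (simp add: norm_mult)
    qed
    show "AE z in lborel. (\<lambda>n. f (y + eps n *\<^sub>R z) * complex_of_real (scaled_delta (eps n) z)) \<longlonglongrightarrow>
        f y * complex_of_real (3 / bracket z ^ 5)"
    proof (rule AE_I2)
      fix z
      have "bracket z \<noteq> 0" using bracket_ge_1[of z] by linarith
      then have "(\<lambda>n. scaled_delta (eps n) z) \<longlonglongrightarrow> 3 / bracket z ^ 5"
        unfolding scaled_delta_def by (auto intro!: tendsto_eq_intros eps_tendsto)
      moreover have "(\<lambda>n. f (y + eps n *\<^sub>R z)) \<longlonglongrightarrow> f y"
        by (rule isCont_tendsto_compose[OF cont]) (auto intro!: tendsto_eq_intros eps_tendsto)
      ultimately show "(\<lambda>n. f (y + eps n *\<^sub>R z) * complex_of_real (scaled_delta (eps n) z)) \<longlonglongrightarrow>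
        f y * complex_of_real (3 / bracket z ^ 5)"
        by (intro tendsto_mult tendsto_of_real)
    qed
  qed measurable
  also have "(LINT z|lborel. f y * complex_of_real (3 / bracket z ^ 5)) = of_real kappa * f y"
    unfolding kappa_def by (simp only: integral_mult_right_zero integral_complex_of_real mult.commute)
  finally show ?thesis unfolding eq .
qed

text \<open>At distance at least 1 the denominators are at least 1, and 7 = 1 + 3 + 3 collects the
  coefficients.\<close>

lemma approx_delta_le_away:
  assumes "norm z \<ge> 1"
  shows "approx_delta \<epsilon> z \<le> 7 * \<epsilon>\<^sup>2 * exp (- norm z)"
proof -
  have p: "pole m (\<epsilon>\<^sup>2 + (norm z)\<^sup>2) \<le> exp (- norm z)" for m
  proof -
    have q: "sqrt (\<epsilon>\<^sup>2 + (norm z)\<^sup>2) \<ge> norm z" by (intro real_le_rsqrt) simp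
    then have "1 \<le> sqrt (\<epsilon>\<^sup>2 + (norm z)\<^sup>2) ^ m" using assms by (intro one_le_power) linarith
    then have "exp (- sqrt (\<epsilon>\<^sup>2 + (norm z)\<^sup>2)) / sqrt (\<epsilon>\<^sup>2 + (norm z)\<^sup>2) ^ m \<le> exp (- norm z) / 1"
      using q by (intro frac_le) auto
    then show ?thesis by (simp add: pole_def)
  qed
  have "approx_delta \<epsilon> z \<le> \<epsilon>\<^sup>2 * (exp (- norm z) + 3 * exp (- norm z) + 3 * exp (- norm z))"
    unfolding approx_delta_def by (intro mult_left_mono add_mono p) (auto intro: p)
  then show ?thesis by (simp add: algebra_simps)
qed

text \<open>f may be unbounded far away, so it is split at the unit ball about y. The inner part is
  bounded and continuous at y; the outer part sees the kernel only where it is of order \<epsilon>^2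
  exp(-r).\<close>

lemma approx_delta_limit_L2:
  assumes f: "f \<in> L2" and cont: "continuous_on UNIV f"
  shows "(\<lambda>n. LINT x|lborel. f x * complex_of_real (approx_delta (eps n) (x - y))) \<longlonglongrightarrow> of_real kappa * f y"
proof -
  have [measurable]: "f \<in> borel_measurable borel" using f by (rule L2_measurable)
  define f1 where "f1 x = indicator (cball y 1) x *\<^sub>R f x" for x
  define f2 where "f2 x = indicator (- cball y 1) x *\<^sub>R f x" for x
  have m1 [measurable]: "f1 \<in> borel_measurable borel" and m2 [measurable]: "f2 \<in> borel_measurable borel"
    unfolding f1_def[abs_def] f2_def[abs_def]
    by (intro borel_measurable_scaleR borel_measurable_indicator; simp)+
  have ff: "f1 x + f2 x = f x" for x by (auto simp: f1_def f2_def indicator_def)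
  have le: "cmod (f1 x) \<le> cmod (f x)" "cmod (f2 x) \<le> cmod (f x)" for x
    by (auto simp: f1_def f2_def indicator_def)
  have L: "f1 \<in> L2" "f2 \<in> L2"
  proof -
    have fi: "integrable lborel (\<lambda>x. (cmod (f x))\<^sup>2)" using f by (simp add: L2_def)
    show "f1 \<in> L2" by (rule L2I[OF m1 fi power_mono[OF le(1)]]) simp
    show "f2 \<in> L2" by (rule L2I[OF m2 fi power_mono[OF le(2)]]) simp
  qed
  have "bounded (f ` cball y 1)"
    by (intro compact_imp_bounded compact_continuous_image continuous_on_subset[OF cont]) auto
  then obtain M where M: "\<And>x. x \<in> cball y 1 \<Longrightarrow> cmod (f x) \<le> M"
    unfolding bounded_iff by blast
  have M1: "cmod (f1 x) \<le> max M 0" for x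
    using M[of x] by (auto simp: f1_def indicator_def)
  have "isCont f1 y"
  proof -
    have "isCont f y" using cont by (simp add: continuous_on_eq_continuous_at)
    moreover have "eventually (\<lambda>x. f x = f1 x) (nhds y)"
      using eventually_nhds_in_open[of "ball y 1" y]
      by (auto elim!: eventually_mono simp: f1_def)
    ultimately show ?thesis using isCont_cong by blast
  qed
  from approx_delta_limit_bounded[OF m1 M1 this]
  have l1: "(\<lambda>n. LINT x|lborel. f1 x * complex_of_real (approx_delta (eps n) (x - y))) \<longlonglongrightarrow> of_real kappa * f y"
    by (simp add: f1_def)
  define I where "I = (LINT x|lborel. cmod (f2 x) * exp (- norm (x - y)))"
  have l2: "(\<lambda>n. LINT x|lborel. f2 x * complex_of_real (approx_delta (eps n) (x - y))) \<longlonglongrightarrow> 0"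
  proof (rule Lim_null_comparison)
    have "cmod (LINT x|lborel. f2 x * complex_of_real (approx_delta (eps n) (x - y))) \<le> 7 * (eps n)\<^sup>2 * I" for n
    proof -
      have "cmod (LINT x|lborel. f2 x * complex_of_real (approx_delta (eps n) (x - y)))
         \<le> (LINT x|lborel. 7 * (eps n)\<^sup>2 * (cmod (f2 x) * exp (- norm (x - y))))"
      proof (rule Bochner_Integration.integral_norm_bound_integral)
        have bd: "cmod (f2 x * complex_of_real (approx_delta (eps n) (x - y))) \<le> 7 * (eps n)\<^sup>2 * (cmod (f2 x) * exp (- norm (x - y)))" for x
        proof (cases "x \<in> cball y 1")
          case False
          then have "norm (x - y) \<ge> 1" by (simp add: dist_norm norm_minus_commute)
          from approx_delta_le_away[OF this, of "eps n"]
          have "cmod (f2 x) * approx_delta (eps n) (x - y) \<le> cmod (f2 x) * (7 * (eps n)\<^sup>2 * exp (- norm (x - y)))"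
            by (rule mult_left_mono) simp
          then show ?thesis
            by (simp add: norm_mult approx_delta_nonneg algebra_simps)
        qed (simp add: f2_def)
        then show "cmod (f2 x * complex_of_real (approx_delta (eps n) (x - y))) \<le> 7 * (eps n)\<^sup>2 * (cmod (f2 x) * exp (- norm (x - y)))" for x .
        show i: "integrable lborel (\<lambda>x. 7 * (eps n)\<^sup>2 * (cmod (f2 x) * exp (- norm (x - y))))"
          by (intro integrable_mult_right L2_mult_exp_integrable L)
        show "integrable lborel (\<lambda>x. f2 x * complex_of_real (approx_delta (eps n) (x - y)))"
          by (rule Bochner_Integration.integrable_bound[OF i]) (auto intro!: AE_I2 order_trans[OF bd])
      qed
      then show ?thesis by (simp add: I_def)
    qed
    then show "eventually (\<lambda>n. cmod (LINT x|lborel. f2 x * complex_of_real (approx_delta (eps n) (x - y))) \<le> 7 * (eps n)\<^sup>2 * I) sequentially"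
      by simp
    show "(\<lambda>n. 7 * (eps n)\<^sup>2 * I) \<longlonglongrightarrow> 0"
      by (auto intro!: tendsto_eq_intros eps_tendsto)
  qed
  have int: "integrable lborel (\<lambda>x. g x * complex_of_real (approx_delta (eps n) (x - y)))" if "g \<in> L2" for g n
  proof -
    obtain C where C: "C \<ge> 0" "\<And>z. approx_delta (eps n) z \<le> C * exp (- norm z)"
      using approx_delta_le_exp[OF eps_pos] by blast
    have [measurable]: "g \<in> borel_measurable borel" using that by (rule L2_measurable)
    show ?thesis
    proof (rule Bochner_Integration.integrable_bound)
      show "integrable lborel (\<lambda>x. C * (cmod (g x) * exp (- norm (x - y))))"
        by (intro integrable_mult_right L2_mult_exp_integrable that)
      show "AE x in lborel. cmod (g x * complex_of_real (approx_delta (eps n) (x - y))) \<le> norm (C * (cmod (g x) * exp (- norm (x - y))))"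
        using mult_left_mono[OF C(2) norm_ge_zero] C(1)
        by (auto intro!: AE_I2 simp: norm_mult approx_delta_nonneg algebra_simps)
    qed measurable
  qed
  have "(LINT x|lborel. f x * complex_of_real (approx_delta (eps n) (x - y))) =
      (LINT x|lborel. f1 x * complex_of_real (approx_delta (eps n) (x - y)))
      + (LINT x|lborel. f2 x * complex_of_real (approx_delta (eps n) (x - y)))" for n
    by (subst Bochner_Integration.integral_add[symmetric]) (auto intro: int L simp: ff[symmetric] algebra_simps)
  then show ?thesis using tendsto_add[OF l1 l2] by simp
qed

text \<open>
  This is the Green function identity \<open>(1 - \<Delta>) (exp (- r) / r) = 4 * pi * \<delta>\<close> tested against \<open>f\<close>.
\<close>

lemma reproducing_property:
  assumes f: "f \<in> L2" "continuous_on UNIV f" and h: "h \<in> L2" and wk: "weak_helmholtz f h"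
  shows "(LINT x|lborel. h x * complex_of_real (yukawa y x)) = of_real kappa * f y"
proof -
  have [measurable]: "h \<in> borel_measurable borel" using h by (rule L2_measurable)
  have "(\<lambda>n. LINT x|lborel. h x * complex_of_real (pole 1 ((eps n)\<^sup>2 + (norm (x - y))\<^sup>2)))
     \<longlonglongrightarrow> (LINT x|lborel. h x * complex_of_real (yukawa y x))"
  \<comment> \<open>exp(-q)/q decreases in q and q \<ge> r, so the singular kernel itself is the
    majorant. It fails at x = y, where \<open>yukawa\<close> has the default value 0.\<close>
  proof (rule integral_dominated_convergence[where w = "\<lambda>x. cmod (h x) * yukawa y x"])
    show "integrable lborel (\<lambda>x. cmod (h x) * yukawa y x)"
      using integrable_norm[OF L2_mult_integrable[OF h yukawa_L2[of y]]]
      by (simp add: norm_mult yukawa_nonneg)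
    show "AE x in lborel. cmod (h x * complex_of_real (pole 1 ((eps n)\<^sup>2 + (norm (x - y))\<^sup>2))) \<le> cmod (h x) * yukawa y x" for n
      using AE_lborel_singleton[of y]
    proof eventually_elim
      fix x assume "x \<noteq> y"
      then have r: "norm (x - y) > 0" by simp
      have q: "sqrt ((eps n)\<^sup>2 + (norm (x - y))\<^sup>2) \<ge> norm (x - y)" by (intro real_le_rsqrt) simp
      have "exp (- sqrt ((eps n)\<^sup>2 + (norm (x - y))\<^sup>2)) / sqrt ((eps n)\<^sup>2 + (norm (x - y))\<^sup>2) \<le> exp (- norm (x - y)) / norm (x - y)"
        using q r by (intro frac_le) auto
      then have "\<bar>pole 1 ((eps n)\<^sup>2 + (norm (x - y))\<^sup>2)\<bar> \<le> yukawa y x"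
        by (simp add: pole_def yukawa_def)
      then show "cmod (h x * complex_of_real (pole 1 ((eps n)\<^sup>2 + (norm (x - y))\<^sup>2))) \<le> cmod (h x) * yukawa y x"
        by (simp add: norm_mult mult_left_mono)
    qed
    show "AE x in lborel. (\<lambda>n. h x * complex_of_real (pole 1 ((eps n)\<^sup>2 + (norm (x - y))\<^sup>2))) \<longlonglongrightarrow> h x * complex_of_real (yukawa y x)"
      using AE_lborel_singleton[of y]
    proof eventually_elim
      fix x assume "x \<noteq> y"
      then have "(\<lambda>n. pole 1 ((eps n)\<^sup>2 + (norm (x - y))\<^sup>2)) \<longlonglongrightarrow> yukawa y x"
        unfolding pole_def yukawa_def by (auto intro!: tendsto_eq_intros eps_tendsto)
      then show "(\<lambda>n. h x * complex_of_real (pole 1 ((eps n)\<^sup>2 + (norm (x - y))\<^sup>2))) \<longlonglongrightarrow> h x * complex_of_real (yukawa y x)"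
        by (intro tendsto_intros)
    qed
  qed measurable
  moreover have "(\<lambda>n. LINT x|lborel. h x * complex_of_real (pole 1 ((eps n)\<^sup>2 + (norm (x - y))\<^sup>2))) \<longlonglongrightarrow> of_real kappa * f y"
    using approx_delta_limit_L2[OF f, of y]
    by (simp add: weak_helmholtz_mollified_pole[OF f(1) h wk eps_pos])
  ultimately show ?thesis by (rule LIMSEQ_unique)
qed

section \<open>Uniqueness of square-integrable solutions with zero source\<close>

lemma inverse_bracket_L2: "(\<lambda>x. complex_of_real (1 / (1 + (norm x)\<^sup>2))) \<in> L2"
proof (rule L2I)
  show "integrable lborel (\<lambda>x. 1 / bracket x ^ 4)"
    by (rule inverse_bracket_power_integrable) simp
  have "bracket x ^ 4 = (1 + (norm x)\<^sup>2)\<^sup>2" for x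
    by (simp add: bracket_def power2_eq_square power4_eq_xxxx)
  then show "(cmod (complex_of_real (1 / (1 + (norm x)\<^sup>2))))\<^sup>2 \<le> 1 / bracket x ^ 4" for x :: "real^3"
    by (simp only: norm_of_real power2_abs) (simp add: power_divide)
qed measurable

lemma L2_mult_bracket_integrable:
  assumes "f \<in> L2"
  shows "integrable lborel (\<lambda>x. cmod (f x) * (1 / (1 + (norm x)\<^sup>2)))"
proof -
  have "cmod (f x * complex_of_real (1 / (1 + (norm x)\<^sup>2))) = cmod (f x) * (1 / (1 + (norm x)\<^sup>2))" for x
    by (simp only: norm_mult norm_of_real abs_of_nonneg zero_le_divide_1_iff add_nonneg_nonneg zero_le_one zero_le_power2)
  then show ?thesis
    using integrable_norm[OF L2_mult_integrable[OF assms inverse_bracket_L2]] by simp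
qed

text \<open>Peetre's inequality. With y confined to a box it trades a weight in y - x for decay in
  x, which makes the double integral of the averaging argument absolutely convergent.\<close>

lemma Peetre: "1 + (norm (x::real^3))\<^sup>2 \<le> 2 * (1 + (norm y)\<^sup>2) * (1 + (norm (y - x))\<^sup>2)"
proof -
  have "norm x \<le> norm y + norm (y - x)"
    using norm_triangle_ineq4[of y "y - x"] by simp
  then have "(norm x)\<^sup>2 \<le> (norm y + norm (y - x))\<^sup>2" by (intro power_mono) auto
  also have "\<dots> \<le> 2 * (norm y)\<^sup>2 + 2 * (norm (y - x))\<^sup>2"
    using zero_le_power2[of "norm y - norm (y - x)"] by (simp add: power2_sum power2_diff)
  finally have "1 + (norm x)\<^sup>2 \<le> 2 * (1 + (norm y)\<^sup>2 + (norm (y - x))\<^sup>2)" by simp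
  also have "\<dots> \<le> 2 * ((1 + (norm y)\<^sup>2) * (1 + (norm (y - x))\<^sup>2))"
    by (simp add: algebra_simps)
  finally show ?thesis by (simp only: mult.assoc)
qed

lemma approx_delta_bracket:
  shows "integrable lborel (\<lambda>z. approx_delta (eps n) z * (1 + (norm z)\<^sup>2))"
    and "(LINT z|lborel. approx_delta (eps n) z * (1 + (norm z)\<^sup>2)) \<le> (LINT z|lborel. 64 / bracket z ^ 5)"
proof -
  let ?g = "\<lambda>z. approx_delta (eps n) z * (1 + (norm z)\<^sup>2)"
  have [measurable]: "?g \<in> borel_measurable borel" by measurable
  have e: "eps n > 0" by (rule eps_pos)
  have b: "eps n ^ 3 * ?g (0 + eps n *\<^sub>R z) \<le> 64 / bracket z ^ 5" "0 \<le> eps n ^ 3 * ?g (0 + eps n *\<^sub>R z)" for z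
    using scaled_delta_bounds(1,2)[OF e, of z] approx_delta_scale[OF e, of z]
    by (auto simp: mult.assoc[symmetric])
  have i: "integrable lborel (\<lambda>z. eps n ^ 3 * ?g (0 + eps n *\<^sub>R z))"
  proof (rule Bochner_Integration.integrable_bound[OF inverse_bracket5_integrable[of 64]])
    show "AE z in lborel. norm (eps n ^ 3 * ?g (0 + eps n *\<^sub>R z)) \<le> norm (64 / bracket z ^ 5)"
      unfolding real_norm_def abs_of_nonneg[OF b(2)] by (intro AE_I2 order_trans[OF b(1) abs_ge_self])
  qed measurable
  then have "integrable lborel (\<lambda>z. inverse (eps n ^ 3) * (eps n ^ 3 * ?g (0 + eps n *\<^sub>R z)))"
    by (rule integrable_mult_right)
  moreover have "inverse (eps n ^ 3) * (eps n ^ 3 * ?g (0 + eps n *\<^sub>R z)) = ?g (0 + eps n *\<^sub>R z)" for z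
    using e by simp
  ultimately show "integrable lborel ?g"
    using integrable_affine_iff[of ?g "eps n" 0] e by simp
  have "(LINT z|lborel. ?g z) = (LINT z|lborel. eps n ^ 3 * ?g (0 + eps n *\<^sub>R z))"
    using e by (subst integral_affine[where c = "eps n" and t = 0]) auto
  also have "\<dots> \<le> (LINT z|lborel. 64 / bracket z ^ 5)"
    using b by (intro Bochner_Integration.integral_mono[OF i inverse_bracket5_integrable]) auto
  finally show "(LINT z|lborel. ?g z) \<le> (LINT z|lborel. 64 / bracket z ^ 5)" .
qed

lemma approx_delta_minus: "approx_delta \<epsilon> (x - y) = approx_delta \<epsilon> (y - x)"
  by (simp add: approx_delta_def norm_minus_commute)

text \<open>
  Averaging the vanishing smoothings of \<open>v\<close> over a box and letting \<open>\<epsilon>\<close> tend to \<open>0\<close> recovers the integral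
  of \<open>v\<close> over the box.
\<close>

lemma weak_helmholtz_zero_box:
  fixes a b :: "real^3"
  assumes v: "v \<in> L2" and wk: "weak_helmholtz v (\<lambda>x. 0)"
  shows "integrable lborel (\<lambda>x. indicator (cbox a b) x *\<^sub>R v x)"
    and "(LINT x|lborel. indicator (cbox a b) x *\<^sub>R v x) = 0"
proof -
  define w :: "real^3 \<Rightarrow> complex" where "w x = indicator (cbox a b) x" for x
  have [measurable]: "v \<in> borel_measurable borel" using v by (rule L2_measurable)
  have [measurable]: "w \<in> borel_measurable borel"
    unfolding w_def by (intro borel_measurable_indicator) simp
  obtain R where R: "\<And>y. y \<in> cbox a b \<Longrightarrow> norm y \<le> R" "R \<ge> 0"
    using bounded_cbox[of a b] bounded_pos[of "cbox a b"] less_imp_le by metis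
  have wle: "cmod (w y) \<le> 1" for y by (simp add: w_def indicator_def)
  \<comment> \<open>\<open>g n\<close> is the smoothed indicator of the box. By Fubini and the
    symmetry of the kernel, pairing v with it integrates the smoothings of v over the box, and these
    vanish.\<close>
  define g where "g n x = (LINT y|lborel. w y * complex_of_real (approx_delta (eps n) (y - x)))" for n x
  \<comment> \<open>The decay that Peetre's inequality leaves in x. It is of order |x|^-2, hence
    square-integrable, so |v| D is integrable.\<close>
  define D where "D x = 2 * (1 + R\<^sup>2) * (1 / (1 + (norm x)\<^sup>2))" for x :: "real^3"
  have D0: "D x > 0" for x
    by (auto simp: D_def add_pos_nonneg)
  have peet: "cmod (w y) * approx_delta (eps n) (y - x) \<le> D x * (approx_delta (eps n) (y - x) * (1 + (norm (y - x))\<^sup>2))" for n x y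
  proof (cases "y \<in> cbox a b")
    case True
    have "1 + (norm x)\<^sup>2 \<le> 2 * (1 + (norm y)\<^sup>2) * (1 + (norm (y - x))\<^sup>2)" by (rule Peetre)
    also have "\<dots> \<le> 2 * (1 + R\<^sup>2) * (1 + (norm (y - x))\<^sup>2)"
      using R(1)[OF True] by (intro mult_right_mono mult_left_mono add_left_mono power_mono) auto
    finally have "1 \<le> 2 * (1 + R\<^sup>2) * (1 + (norm (y - x))\<^sup>2) / (1 + (norm x)\<^sup>2)"
      by (subst pos_le_divide_eq) (auto simp: add_pos_nonneg)
    also have "\<dots> = D x * (1 + (norm (y - x))\<^sup>2)" by (simp add: D_def)
    finally have "1 \<le> D x * (1 + (norm (y - x))\<^sup>2)" .
    from mult_right_mono[OF this approx_delta_nonneg[of "eps n" "y - x"]]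
    show ?thesis using True by (simp add: w_def algebra_simps)
  next
    case False
    then show ?thesis using D0[of x] by (simp add: w_def approx_delta_nonneg)
  qed
  have id: "integrable lborel (\<lambda>y. approx_delta (eps n) (y - x) * (1 + (norm (y - x))\<^sup>2))" for n x
    using integrable_translate[of "\<lambda>z. approx_delta (eps n) z * (1 + (norm z)\<^sup>2)" x] approx_delta_bracket(1)[of n] by simp
  have wint: "integrable lborel (\<lambda>y. cmod (w y) * approx_delta (eps n) (y - x))" for n x
  proof (rule Bochner_Integration.integrable_bound[OF integrable_mult_right[OF id[of n x], of "D x"]])
    show "AE y in lborel. norm (cmod (w y) * approx_delta (eps n) (y - x)) \<le> norm (D x * (approx_delta (eps n) (y - x) * (1 + (norm (y - x))\<^sup>2)))"
    proof (rule AE_I2)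
      fix y
      have "0 \<le> cmod (w y) * approx_delta (eps n) (y - x)"
        by (intro mult_nonneg_nonneg approx_delta_nonneg norm_ge_zero)
      with peet[of y n x] show "norm (cmod (w y) * approx_delta (eps n) (y - x)) \<le> norm (D x * (approx_delta (eps n) (y - x) * (1 + (norm (y - x))\<^sup>2)))"
        unfolding real_norm_def by linarith
    qed
  qed measurable
  define K where "K = (LINT z::real^3|lborel. 64 / bracket z ^ 5)"
  have wle2: "(LINT y|lborel. cmod (w y) * approx_delta (eps n) (y - x)) \<le> D x * K" for n x
  proof -
    have "(LINT y|lborel. cmod (w y) * approx_delta (eps n) (y - x)) \<le>
      (LINT y|lborel. D x * (approx_delta (eps n) (y - x) * (1 + (norm (y - x))\<^sup>2)))"
      by (rule Bochner_Integration.integral_mono[OF wint integrable_mult_right[OF id]]) (rule peet)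
    also have "\<dots> = D x * (LINT z|lborel. approx_delta (eps n) z * (1 + (norm z)\<^sup>2))"
      using integral_translate[of "\<lambda>z. approx_delta (eps n) z * (1 + (norm z)\<^sup>2)" x] by simp
    also have "\<dots> \<le> D x * K"
      unfolding K_def using D0[of x] by (intro mult_left_mono approx_delta_bracket(2)) simp
    finally show ?thesis .
  qed
  have nrm: "cmod (w y * complex_of_real (approx_delta (eps n) (y - x))) = cmod (w y) * approx_delta (eps n) (y - x)" for n x y
    by (simp add: norm_mult approx_delta_nonneg)
  have gle: "cmod (g n x) \<le> D x * K" for n x
    unfolding g_def using integral_norm_bound[of lborel "\<lambda>y. w y * complex_of_real (approx_delta (eps n) (y - x))"] wle2[of n x]
    by (simp only: nrm)
  have vD: "integrable lborel (\<lambda>x. cmod (v x) * D x)"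
    using integrable_mult_right[OF L2_mult_bracket_integrable[OF v], of "2 * (1 + R\<^sup>2)"]
    by (simp only: D_def mult.left_commute)
  have Fub: "integrable (lborel \<Otimes>\<^sub>M lborel) (\<lambda>(x, y). v x * (w y * complex_of_real (approx_delta (eps n) (y - x))))" for n
  proof (rule lborel_pair.Fubini_integrable)
    show "AE x in lborel. integrable lborel (\<lambda>y. case (x, y) of (x, y) \<Rightarrow> v x * (w y * complex_of_real (approx_delta (eps n) (y - x))))"
    proof (rule AE_I2)
      fix x
      have "integrable lborel (\<lambda>y. w y * complex_of_real (approx_delta (eps n) (y - x)))"
        by (rule Bochner_Integration.integrable_bound[OF wint[of n x]])
          (auto simp: nrm approx_delta_nonneg)
      then show "integrable lborel (\<lambda>y. case (x, y) of (x, y) \<Rightarrow> v x * (w y * complex_of_real (approx_delta (eps n) (y - x))))"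
        by simp
    qed
    have "integrable lborel (\<lambda>x. cmod (v x) * (LINT y|lborel. cmod (w y) * approx_delta (eps n) (y - x)))"
    proof (rule Bochner_Integration.integrable_bound[OF integrable_mult_right[OF vD, of K]])
      show "AE x in lborel. norm (cmod (v x) * (LINT y|lborel. cmod (w y) * approx_delta (eps n) (y - x))) \<le> norm (K * (cmod (v x) * D x))"
      proof (rule AE_I2)
        fix x
        have "0 \<le> (LINT y|lborel. cmod (w y) * approx_delta (eps n) (y - x))"
          by (rule Bochner_Integration.integral_nonneg) (simp add: approx_delta_nonneg)
        then have "norm (cmod (v x) * (LINT y|lborel. cmod (w y) * approx_delta (eps n) (y - x))) \<le> cmod (v x) * (D x * K)"
          using mult_left_mono[OF wle2[of n x] norm_ge_zero[of "v x"]] by simp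
        then show "norm (cmod (v x) * (LINT y|lborel. cmod (w y) * approx_delta (eps n) (y - x))) \<le> norm (K * (cmod (v x) * D x))"
          using abs_ge_self[of "K * (cmod (v x) * D x)"] unfolding real_norm_def
          by (simp only: mult_ac)
      qed
    qed measurable
    then show "integrable lborel (\<lambda>x. LINT y|lborel. norm (case (x, y) of (x, y) \<Rightarrow> v x * (w y * complex_of_real (approx_delta (eps n) (y - x)))))"
      by (simp only: split_conv norm_mult[of "v _"] nrm integral_mult_right_zero)
  qed measurable
  have zero: "(LINT x|lborel. v x * g n x) = 0" for n
  proof -
    have "(LINT x|lborel. v x * g n x) = (LINT x|lborel. LINT y|lborel. v x * (w y * complex_of_real (approx_delta (eps n) (y - x))))"
      by (simp add: g_def)
    also have "\<dots> = (LINT y|lborel. LINT x|lborel. v x * (w y * complex_of_real (approx_delta (eps n) (y - x))))"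
      by (rule lborel_pair.Fubini_integral[OF Fub, symmetric])
    also have "\<dots> = (LINT y|lborel. w y * (LINT x|lborel. v x * complex_of_real (approx_delta (eps n) (x - y))))"
    proof -
      have "v x * (w y * complex_of_real (approx_delta (eps n) (y - x))) = w y * (v x * complex_of_real (approx_delta (eps n) (x - y)))" for x y
        by (subst approx_delta_minus) (rule mult.left_commute)
      then show ?thesis by (simp only: integral_mult_right_zero)
    qed
    also have "\<dots> = 0"
      using weak_helmholtz_mollified_pole[OF v L2_zero wk eps_pos] by simp
    finally show ?thesis .
  qed
  have gm [measurable]: "g n \<in> borel_measurable borel" for n
    unfolding g_def[abs_def] by measurable
  have "(\<lambda>n. LINT x|lborel. v x * g n x) \<longlonglongrightarrow> (LINT x|lborel. v x * (of_real kappa * w x))"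
  proof (rule integral_dominated_convergence[where w = "\<lambda>x. K * (cmod (v x) * D x)"])
    \<comment> \<open>Off the boundary of the box, a null set, the indicator is continuous and the
      limit lemma for bounded functions applies.\<close>
    show "AE x in lborel. (\<lambda>n. v x * g n x) \<longlonglongrightarrow> v x * (of_real kappa * w x)"
      using AE_not_in[OF null_sets_cbox_Diff_box[of a b]]
    proof eventually_elim
      fix x assume x: "x \<notin> cbox a b - box a b"
      have "isCont w x"
      proof (cases "x \<in> box a b")
        case True
        have "eventually (\<lambda>y. w y = 1) (nhds x)"
          using eventually_nhds_in_open[OF open_box True] box_subset_cbox[of a b]
          by (auto elim!: eventually_mono simp: w_def)
        then show ?thesis using isCont_cong[of w "\<lambda>_. 1"] by simp
      next
        case False
        with x have "x \<in> - cbox a b" by auto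
        then have "eventually (\<lambda>y. y \<in> - cbox a b) (nhds x)"
          using closed_cbox[of a b] by (intro eventually_nhds_in_open) auto
        then have "eventually (\<lambda>y. w y = 0) (nhds x)"
          by eventually_elim (simp add: w_def)
        then show ?thesis using isCont_cong[of w "\<lambda>_. 0"] by simp
      qed
      from approx_delta_limit_bounded[OF \<open>w \<in> borel_measurable borel\<close> wle this]
      show "(\<lambda>n. v x * g n x) \<longlonglongrightarrow> v x * (of_real kappa * w x)"
        unfolding g_def by (intro tendsto_mult tendsto_const)
    qed
    show "AE x in lborel. cmod (v x * g n x) \<le> K * (cmod (v x) * D x)" for n
      using mult_left_mono[OF gle norm_ge_zero] by (intro AE_I2) (simp add: norm_mult algebra_simps)
    show "integrable lborel (\<lambda>x. K * (cmod (v x) * D x))"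
      by (rule integrable_mult_right[OF vD])
  qed measurable
  then have "(LINT x|lborel. of_real kappa * (v x * w x)) = 0"
    unfolding zero by (simp add: LIMSEQ_const_iff mult.left_commute)
  then have "(LINT x|lborel. v x * w x) = 0"
    using kappa_pos by simp
  moreover have vw: "v x * w x = indicator (cbox a b) x *\<^sub>R v x" for x
    by (simp add: w_def indicator_def)
  ultimately show "(LINT x|lborel. indicator (cbox a b) x *\<^sub>R v x) = 0" by simp
  have "w \<in> L2"
  proof (rule L2I)
    show "integrable lborel (\<lambda>x. indicator (cbox a b) x :: real)"
      by (intro integrable_real_indicator) (use emeasure_lborel_cbox_finite[of a b] in auto)
    show "(cmod (w x))\<^sup>2 \<le> indicator (cbox a b) x" for x by (simp add: w_def indicator_def)
  qed measurable
  then show "integrable lborel (\<lambda>x. indicator (cbox a b) x *\<^sub>R v x)"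
    unfolding vw[symmetric] by (rule L2_mult_integrable[OF v])
qed

text \<open>All box integrals of v vanish, and Lebesgue differentiation along cubes with lower
  corner x recovers v x almost everywhere. The differentiation theorem speaks of gauge integrals and
  negligible sets, hence the conversions from and to \<open>lborel\<close>.\<close>

lemma weak_helmholtz_zero:
  assumes v: "v \<in> L2" and wk: "weak_helmholtz v (\<lambda>x. 0)"
  shows "AE x in lborel. v x = 0"
proof -
  have si: "set_integrable lborel (cbox a b) v" for a b
    unfolding set_integrable_def using weak_helmholtz_zero_box(1)[OF v wk] .
  have int: "v integrable_on cbox a b" "integral (cbox a b) v = 0" for a b
    using set_borel_integral_eq_integral[OF si[of a b]] weak_helmholtz_zero_box(2)[OF v wk, of a b]
    by (auto simp: set_lebesgue_integral_def)
  obtain N where N: "negligible N"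
    "\<And>x e. x \<notin> N \<Longrightarrow> 0 < e \<Longrightarrow> \<exists>d>0. \<forall>h. 0 < h \<and> h < d \<longrightarrow>
       norm (integral (cbox x (x + h *\<^sub>R One)) v /\<^sub>R h ^ DIM(real^3) - v x) < e"
    using integrable_ccontinuous_explicit[of v] int(1) by blast
  have "v x = 0" if x: "x \<notin> N" for x
  proof (rule ccontr)
    assume "v x \<noteq> 0"
    then obtain d where "d > 0" "\<forall>h. 0 < h \<and> h < d \<longrightarrow>
       norm (integral (cbox x (x + h *\<^sub>R One)) v /\<^sub>R h ^ DIM(real^3) - v x) < cmod (v x)"
      using N(2)[OF x, of "cmod (v x)"] by auto
    then have "norm (integral (cbox x (x + (d / 2) *\<^sub>R One)) v /\<^sub>R (d / 2) ^ DIM(real^3) - v x) < cmod (v x)"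
      by auto
    then show False by (simp add: int(2))
  qed
  moreover have "AE x in lebesgue. x \<notin> N"
    using N(1) AE_not_in by (simp add: negligible_iff_null_sets)
  ultimately have "AE x in lebesgue. v x = 0"
    by (auto elim: eventually_mono)
  then show ?thesis by (simp add: AE_completion_iff)
qed

section \<open>Test functions in the Sobolev space\<close>

lemma line_deriv_along:
  assumes "line_deriv i f (x + s *\<^sub>R axis i 1) D"
  shows "((\<lambda>t. f (x + t *\<^sub>R axis i 1)) has_vector_derivative D) (at s)"
proof -
  have "((\<lambda>t. t - s) has_vector_derivative 1) (at s)"
    by (auto intro!: derivative_eq_intros)
  moreover have "((\<lambda>t. f (x + s *\<^sub>R axis i 1 + t *\<^sub>R axis i 1)) has_vector_derivative D) (at (s - s))"
    using assms by (simp add: line_deriv_def)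
  ultimately have "(((\<lambda>t. f (x + s *\<^sub>R axis i 1 + t *\<^sub>R axis i 1)) \<circ> (\<lambda>t. t - s)) has_vector_derivative 1 *\<^sub>R D) (at s)"
    by (rule vector_diff_chain_at)
  moreover have "(\<lambda>t. f (x + s *\<^sub>R axis i 1 + t *\<^sub>R axis i 1)) \<circ> (\<lambda>t. t - s) = (\<lambda>t. f (x + t *\<^sub>R axis i 1))"
    by (auto simp: fun_eq_iff algebra_simps scaleR_diff_left)
  ultimately show ?thesis by simp
qed

lemma smooth_line_Lipschitz:
  assumes f: "smooth f" and M: "\<And>x. cmod (partial_deriv i f x) \<le> M" and t: "t \<ge> 0"
  shows "cmod (f (x + t *\<^sub>R axis i 1) - f x) \<le> M * t"
proof -
  have "norm ((\<lambda>s. f (x + s *\<^sub>R axis i 1)) t - (\<lambda>s. f (x + s *\<^sub>R axis i 1)) 0) \<le> M * norm (t - 0)"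
  proof (rule differentiable_bound[where S = "{0..t}" and f' = "\<lambda>s h. h *\<^sub>R partial_deriv i f (x + s *\<^sub>R axis i 1)"])
    show "((\<lambda>s. f (x + s *\<^sub>R axis i 1)) has_derivative (\<lambda>h. h *\<^sub>R partial_deriv i f (x + s *\<^sub>R axis i 1))) (at s within {0..t})" for s
      using line_deriv_along[OF smooth_line_deriv[OF f]]
      by (auto simp: has_vector_derivative_def intro: has_derivative_at_withinI)
    show "onorm (\<lambda>h. h *\<^sub>R partial_deriv i f (x + s *\<^sub>R axis i 1)) \<le> M" for s
    proof (rule onorm_bound)
      show "0 \<le> M" using M[of x] norm_ge_zero order_trans by blast
      show "norm (h *\<^sub>R partial_deriv i f (x + s *\<^sub>R axis i 1)) \<le> M * norm h" for h :: real
        using mult_left_mono[OF M abs_ge_zero[of h]] by (simp add: mult.commute)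
    qed
  qed (use t in auto)
  then show ?thesis using t by simp
qed

lemma test_function_bounded:
  assumes "f \<in> test_functions"
  obtains M where "\<And>x. cmod (f x) \<le> M" "M \<ge> 0"
proof -
  obtain B where B: "B > 0" "\<And>x. norm x \<ge> B \<Longrightarrow> f x = 0"
    using assms by (metis test_functionE)
  have "bounded (f ` cball 0 B)"
    using test_function_continuous[OF assms]
    by (intro compact_imp_bounded compact_continuous_image) (auto intro: continuous_on_subset)
  then obtain M where M: "\<And>x. norm x \<le> B \<Longrightarrow> cmod (f x) \<le> M"
    unfolding bounded_iff by force
  have "cmod (f x) \<le> max M 0" for x
    using M[of x] B(2)[of x] by (cases "norm x \<le> B") auto
  then show ?thesis by (intro that[of "max M 0"]) auto
qed

lemma test_function_measurable: "f \<in> test_functions \<Longrightarrow> f \<in> borel_measurable borel"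
  using test_function_L2 L2_measurable by blast

lemma test_function_integrable:
  assumes "f \<in> test_functions" shows "integrable lborel f"
proof -
  obtain B where B: "B > 0" "\<And>x. norm x \<ge> B \<Longrightarrow> f x = 0"
    using assms by (metis test_functionE)
  have "integrable lborel (\<lambda>x. indicator (cball 0 B) x *\<^sub>R f x)"
    using test_function_continuous[OF assms]
    by (intro borel_integrable_compact) (auto intro: continuous_on_subset)
  moreover have "(\<lambda>x. indicator (cball 0 B) x *\<^sub>R f x) = f"
    using B by (auto simp: indicator_def fun_eq_iff)
  ultimately show ?thesis by simp
qed

text \<open>
  Integration by parts without Fubini: difference quotients integrate to zero by translation
  invariance.
\<close>

lemma integral_partial_deriv_0:
  assumes u: "u \<in> test_functions"
  shows "(LINT x|lborel. partial_deriv i u x) = 0"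
proof -
  let ?e = "axis i 1 :: real^3"
  obtain B where B: "B > 0" "\<And>x. norm x \<ge> B \<Longrightarrow> u x = 0"
    using u by (metis test_functionE)
  obtain M where M: "\<And>x. cmod (partial_deriv i u x) \<le> M" "M \<ge> 0"
    using test_function_bounded[OF test_function_partial_deriv[OF u]] by metis
  have um [measurable]: "u \<in> borel_measurable borel" "partial_deriv i u \<in> borel_measurable borel"
    using u test_function_partial_deriv test_function_measurable by blast+
  \<comment> \<open>The shift is written as subtraction of a negative vector to match
    \<open>integral_translate\<close>.\<close>
  define q where "q n x = inverse (eps n) *\<^sub>R (u (x - (- (eps n *\<^sub>R ?e))) - u x)" for n x
  have "(\<lambda>n. LINT x|lborel. q n x) \<longlonglongrightarrow> (LINT x|lborel. partial_deriv i u x)"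
  \<comment> \<open>The mean value inequality bounds the quotients by M, and steps of length at most
    1 keep them supported within radius B + 1.\<close>
  proof (rule integral_dominated_convergence[where w = "\<lambda>x. M * indicator (cball 0 (B + 1)) x"])
    show "integrable lborel (\<lambda>x::real^3. M * indicator (cball 0 (B + 1)) x)"
      by (intro integrable_mult_right integrable_real_indicator) (use emeasure_lborel_cball_finite[of "0::real^3" "B + 1"] in auto)
    show "AE x in lborel. (\<lambda>n. q n x) \<longlonglongrightarrow> partial_deriv i u x"
    proof (rule AE_I2)
      fix x
      have "((\<lambda>t. u (x + t *\<^sub>R ?e)) has_vector_derivative partial_deriv i u x) (at 0)"
        using smooth_line_deriv[OF test_function_smooth[OF u]] unfolding line_deriv_def .
      then have "((\<lambda>h. norm (u (x + (0 + h) *\<^sub>R ?e) - u (x + 0 *\<^sub>R ?e) - h *\<^sub>R partial_deriv i u x) / norm h) \<longlongrightarrow> 0) (at 0)"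
        unfolding has_vector_derivative_def has_derivative_at by blast
      moreover have q: "norm (u (x + (0 + h) *\<^sub>R ?e) - u (x + 0 *\<^sub>R ?e) - h *\<^sub>R partial_deriv i u x) / norm h =
          norm (inverse h *\<^sub>R (u (x + h *\<^sub>R ?e) - u x) - partial_deriv i u x)" if "h \<noteq> 0" for h :: real
      proof -
        have "inverse h *\<^sub>R (u (x + h *\<^sub>R ?e) - u x) - partial_deriv i u x =
            inverse h *\<^sub>R (u (x + h *\<^sub>R ?e) - u x - h *\<^sub>R partial_deriv i u x)"
          using that by (simp add: scaleR_diff_right)
        then show ?thesis using that by (simp add: divide_inverse mult.commute)
      qed
      ultimately have "((\<lambda>h. norm (inverse h *\<^sub>R (u (x + h *\<^sub>R ?e) - u x) - partial_deriv i u x)) \<longlongrightarrow> 0) (at 0)"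
        using q by (elim Lim_transform_eventually) (simp add: eventually_at_filter)
      then have "((\<lambda>h. inverse h *\<^sub>R (u (x + h *\<^sub>R ?e) - u x)) \<longlongrightarrow> partial_deriv i u x) (at 0)"
        by (simp add: tendsto_norm_zero_iff LIM_zero_iff)
      moreover have "filterlim eps (at 0) sequentially"
        using eps_tendsto eps_pos by (auto simp: filterlim_at less_imp_neq[THEN not_sym])
      ultimately have "(\<lambda>n. inverse (eps n) *\<^sub>R (u (x + eps n *\<^sub>R ?e) - u x)) \<longlonglongrightarrow> partial_deriv i u x"
        by (rule filterlim_compose)
      then show "(\<lambda>n. q n x) \<longlonglongrightarrow> partial_deriv i u x" by (simp add: q_def)
    qed
    show "AE x in lborel. cmod (q n x) \<le> M * indicator (cball 0 (B + 1)) x" for n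
    proof (rule AE_I2)
      fix x
      show "cmod (q n x) \<le> M * indicator (cball 0 (B + 1)) x"
      proof (cases "x \<in> cball 0 (B + 1)")
        case True
        have "cmod (u (x + eps n *\<^sub>R ?e) - u x) \<le> M * eps n"
          using test_function_smooth[OF u] M(1) eps_pos by (intro smooth_line_Lipschitz) (auto intro: less_imp_le)
        then have "inverse (eps n) * cmod (u (x + eps n *\<^sub>R ?e) - u x) \<le> inverse (eps n) * (M * eps n)"
          using eps_pos[of n] by (intro mult_left_mono) auto
        also have "\<dots> = M" using eps_pos[of n] by simp
        finally show ?thesis using True eps_pos[of n] by (simp add: q_def)
      next
        case False
        have "eps n \<le> 1" unfolding eps_def by (rule inverse_Suc_le_1)
        then have "norm (eps n *\<^sub>R ?e) \<le> 1" using eps_pos[of n] by (simp add: norm_axis_1)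
        then have "norm (x + eps n *\<^sub>R ?e) \<ge> B"
          using norm_diff_ineq[of x "eps n *\<^sub>R ?e"] False by (simp only: mem_cball_0)
        moreover have "norm x \<ge> B" using False by simp
        ultimately have "q n x = 0" using B(2) by (simp add: q_def)
        then show ?thesis using M(2) by simp
      qed
    qed
    show "q n \<in> borel_measurable lborel" for n unfolding q_def by measurable
  qed measurable
  moreover have "(LINT x|lborel. q n x) = 0" for n
  proof -
    have i: "integrable lborel u" by (rule test_function_integrable[OF u])
    then have "integrable lborel (\<lambda>x. u (x - (- (eps n *\<^sub>R ?e))))"
      by (subst integrable_translate[OF um(1)])
    then have "(LINT x|lborel. q n x) = inverse (eps n) *\<^sub>R ((LINT x|lborel. u (x - (- (eps n *\<^sub>R ?e)))) - (LINT x|lborel. u x))"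
      unfolding q_def using i by (subst integral_scaleR_right, subst Bochner_Integration.integral_diff) auto
    also have "(LINT x|lborel. u (x - (- (eps n *\<^sub>R ?e)))) = (LINT x|lborel. u x)"
      by (rule integral_translate[OF um(1)])
    finally show ?thesis by simp
  qed
  ultimately show ?thesis by (simp add: LIMSEQ_const_iff)
qed

section \<open>Weak derivatives of test functions, and the link between \<open>W22\<close> and the
  very weak equation\<close>

lemma integration_by_parts:
  assumes f: "f \<in> test_functions" and g: "g \<in> test_functions"
  shows "(LINT x|lborel. f x * partial_deriv i g x) = - (LINT x|lborel. partial_deriv i f x * g x)"
proof -
  have "partial_deriv i (\<lambda>x. f x * g x) = (\<lambda>x. f x * partial_deriv i g x + partial_deriv i f x * g x)"
    using f g by (intro ext line_deriv_partial_deriv line_deriv_mult smooth_line_deriv test_function_smooth)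
  moreover have "(LINT x|lborel. partial_deriv i (\<lambda>x. f x * g x) x) = 0"
    by (intro integral_partial_deriv_0 test_function_mult g test_function_smooth f)
  ultimately have "(LINT x|lborel. f x * partial_deriv i g x + partial_deriv i f x * g x) = 0" by simp
  moreover have "integrable lborel (\<lambda>x. f x * partial_deriv i g x)" "integrable lborel (\<lambda>x. partial_deriv i f x * g x)"
    using f g by (auto intro!: L2_mult_integrable test_function_L2 test_function_partial_deriv)
  ultimately show ?thesis by (simp add: add_eq_0_iff)
qed

text \<open>Integration by parts moves the head of the list, the outermost derivative of \<phi>,
  onto f first, where it becomes the innermost one; hence the reversed list. For [i, i] the reversal
  is invisible.\<close>

lemma test_function_has_weak_deriv:
  "f \<in> test_functions \<Longrightarrow> has_weak_deriv f is (partial_derivs (rev is) f)"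
proof (induction "is" arbitrary: f)
  case Nil
  then show ?case by (simp add: has_weak_deriv_def partial_derivs_def)
next
  case (Cons i "is")
  show ?case
    unfolding has_weak_deriv_def
  proof
    fix \<phi> assume \<phi>: "\<phi> \<in> test_functions"
    have "(LINT x|lborel. f x * partial_derivs (i # is) \<phi> x) = (LINT x|lborel. f x * partial_deriv i (partial_derivs is \<phi>) x)"
      by (simp add: partial_derivs_def)
    also have "\<dots> = - (LINT x|lborel. partial_deriv i f x * partial_derivs is \<phi> x)"
      by (intro integration_by_parts Cons.prems test_function_partial_derivs \<phi>)
    also have "(LINT x|lborel. partial_deriv i f x * partial_derivs is \<phi> x) =
        (-1) ^ length is * (LINT x|lborel. partial_derivs (rev is) (partial_deriv i f) x * \<phi> x)"
      using Cons.IH[OF test_function_partial_deriv[OF Cons.prems], of i] \<phi> by (simp add: has_weak_deriv_def)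
    also have "partial_derivs (rev is) (partial_deriv i f) = partial_derivs (rev (i # is)) f"
      by (simp add: partial_derivs_def)
    finally show "(LINT x|lborel. f x * partial_derivs (i # is) \<phi> x) =
        (-1) ^ length (i # is) * (LINT x|lborel. partial_derivs (rev (i # is)) f x * \<phi> x)"
      by simp
  qed
qed

lemma test_function_W22: "f \<in> test_functions \<Longrightarrow> f \<in> W22"
  unfolding W22_def
  using test_function_has_weak_deriv test_function_L2 test_function_partial_derivs by blast

lemma integral_helmholtz:
  assumes f: "f \<in> L2" and \<psi>: "\<psi> \<in> test_functions"
  shows "(LINT x|lborel. f x * helmholtz \<psi> x) =
    (LINT x|lborel. f x * \<psi> x) - (\<Sum>i\<in>UNIV. LINT x|lborel. f x * partial_derivs [i, i] \<psi> x)"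
proof -
  have i: "integrable lborel (\<lambda>x. f x * \<psi> x)" "integrable lborel (\<lambda>x. f x * partial_derivs [i, i] \<psi> x)" for i
    using f \<psi> by (auto intro!: L2_mult_integrable test_function_L2 test_function_partial_derivs)
  have "(LINT x|lborel. f x * helmholtz \<psi> x) =
     (LINT x|lborel. f x * \<psi> x - (\<Sum>i\<in>UNIV. f x * partial_derivs [i, i] \<psi> x))"
    by (simp add: helmholtz_def right_diff_distrib sum_distrib_left)
  also have "\<dots> = (LINT x|lborel. f x * \<psi> x) - (LINT x|lborel. (\<Sum>i\<in>UNIV. f x * partial_derivs [i, i] \<psi> x))"
    by (rule Bochner_Integration.integral_diff) (auto intro: i)
  also have "(LINT x|lborel. (\<Sum>i\<in>UNIV. f x * partial_derivs [i, i] \<psi> x)) = (\<Sum>i\<in>UNIV. LINT x|lborel. f x * partial_derivs [i, i] \<psi> x)"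
    by (rule Bochner_Integration.integral_sum) (rule i)
  finally show ?thesis .
qed

lemma weak_helmholtz_if_weak_derivs:
  assumes f: "f \<in> L2" and g: "\<And>i. g i \<in> L2" "\<And>i. has_weak_deriv f [i, i] (g i)"
  shows "weak_helmholtz f (\<lambda>x. f x - (\<Sum>i\<in>UNIV. g i x))"
  unfolding weak_helmholtz_def
proof
  fix \<psi> assume \<psi>: "\<psi> \<in> test_functions"
  have i: "integrable lborel (\<lambda>x. f x * \<psi> x)" "integrable lborel (\<lambda>x. g i x * \<psi> x)" for i
    by (intro L2_mult_integrable f g test_function_L2[OF \<psi>])+
  have w: "(LINT x|lborel. f x * partial_derivs [i, i] \<psi> x) = (LINT x|lborel. g i x * \<psi> x)" for i
    using g(2)[of i] \<psi> unfolding has_weak_deriv_def by simp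
  have "(LINT x|lborel. (f x - (\<Sum>i\<in>UNIV. g i x)) * \<psi> x) =
     (LINT x|lborel. f x * \<psi> x - (\<Sum>i\<in>UNIV. g i x * \<psi> x))"
    by (simp add: left_diff_distrib sum_distrib_right)
  also have "\<dots> = (LINT x|lborel. f x * \<psi> x) - (LINT x|lborel. (\<Sum>i\<in>UNIV. g i x * \<psi> x))"
    by (rule Bochner_Integration.integral_diff) (auto intro: i)
  also have "(LINT x|lborel. (\<Sum>i\<in>UNIV. g i x * \<psi> x)) = (\<Sum>i\<in>UNIV. LINT x|lborel. g i x * \<psi> x)"
    by (rule Bochner_Integration.integral_sum) (rule i)
  finally show "(LINT x|lborel. f x * helmholtz \<psi> x) = (LINT x|lborel. (f x - (\<Sum>i\<in>UNIV. g i x)) * \<psi> x)"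
    by (simp add: integral_helmholtz[OF f \<psi>] w)
qed

lemma W22_weak_deriv:
  assumes "f \<in> W22"
  shows "weak_deriv [i, i] f \<in> L2" "has_weak_deriv f [i, i] (weak_deriv [i, i] f)"
proof -
  have "\<exists>g. g \<in> L2 \<and> has_weak_deriv f [i, i] g"
    using assms unfolding W22_def by (auto dest!: spec[of _ "[i, i]"])
  then have "weak_deriv [i, i] f \<in> L2 \<and> has_weak_deriv f [i, i] (weak_deriv [i, i] f)"
    unfolding weak_deriv_def by (rule someI_ex)
  then show "weak_deriv [i, i] f \<in> L2" "has_weak_deriv f [i, i] (weak_deriv [i, i] f)" by auto
qed

lemma W22_weak_helmholtz:
  assumes "f \<in> W22"
  shows "(\<lambda>x. neg_laplacian f x + f x) \<in> L2" "weak_helmholtz f (\<lambda>x. neg_laplacian f x + f x)"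
proof -
  have f: "f \<in> L2" using assms by (simp add: W22_def)
  have eq: "(\<lambda>x. neg_laplacian f x + f x) = (\<lambda>x. f x - (\<Sum>i\<in>UNIV. weak_deriv [i, i] f x))"
    by (simp add: neg_laplacian_def fun_eq_iff)
  show "(\<lambda>x. neg_laplacian f x + f x) \<in> L2"
    unfolding eq by (intro L2_diff f L2_sum W22_weak_deriv assms) auto
  show "weak_helmholtz f (\<lambda>x. neg_laplacian f x + f x)"
    unfolding eq by (intro weak_helmholtz_if_weak_derivs f W22_weak_deriv assms)
qed

lemma test_function_weak_helmholtz:
  assumes "f \<in> test_functions"
  shows "weak_helmholtz f (helmholtz f)"
proof -
  have eq: "helmholtz f = (\<lambda>x. f x - (\<Sum>i\<in>UNIV. partial_derivs [i, i] f x))"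
    by (simp add: helmholtz_def fun_eq_iff)
  show ?thesis
    unfolding eq
    using assms test_function_has_weak_deriv[OF assms, of "[i, i]" for i]
    by (intro weak_helmholtz_if_weak_derivs test_function_L2 test_function_partial_derivs) auto
qed

text \<open>Uniqueness in the form used twice: to identify the chosen weak Laplacian of a test
  function with the classical one, and an element of the defect subspace with its series.\<close>

lemma L2_eq_if_equal_on_test_functions:
  assumes f: "f \<in> L2" and g: "g \<in> L2"
    and eq: "\<And>\<psi>. \<psi> \<in> test_functions \<Longrightarrow>
      (LINT x|lborel. f x * helmholtz \<psi> x) = (LINT x|lborel. g x * helmholtz \<psi> x)"
  shows "AE x in lborel. f x = g x"
proof -
  have "weak_helmholtz (\<lambda>x. f x - g x) (\<lambda>x. 0)"
    unfolding weak_helmholtz_def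
  proof
    fix \<psi> assume \<psi>: "\<psi> \<in> test_functions"
    have i: "integrable lborel (\<lambda>x. f x * helmholtz \<psi> x)" "integrable lborel (\<lambda>x. g x * helmholtz \<psi> x)"
      using f g \<psi> by (auto intro!: L2_mult_integrable test_function_L2 test_function_helmholtz)
    then show "(LINT x|lborel. (f x - g x) * helmholtz \<psi> x) = (LINT x|lborel. 0 * \<psi> x)"
      using eq[OF \<psi>] by (simp add: left_diff_distrib)
  qed
  from weak_helmholtz_zero[OF L2_diff[OF f g] this] show ?thesis by simp
qed

text \<open>Both sides are very weak images of the same f. Since \<open>helmholtz \<psi>\<close> is
  again a test function, it may be inserted into both equations, which gives equal pairings with
  every \<open>helmholtz \<psi>\<close>.\<close>

lemma test_function_neg_laplacian:
  assumes "f \<in> test_functions"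
  shows "AE x in lborel. neg_laplacian f x + f x = helmholtz f x"
proof (rule L2_eq_if_equal_on_test_functions)
  fix \<psi> assume "\<psi> \<in> test_functions"
  then have "helmholtz \<psi> \<in> test_functions" by (rule test_function_helmholtz)
  then show "(LINT x|lborel. (neg_laplacian f x + f x) * helmholtz \<psi> x) = (LINT x|lborel. helmholtz f x * helmholtz \<psi> x)"
    using W22_weak_helmholtz(2)[OF test_function_W22[OF assms]] test_function_weak_helmholtz[OF assms]
    by (simp add: weak_helmholtz_def)
qed (use assms W22_weak_helmholtz(1) test_function_W22 test_function_L2 test_function_helmholtz in auto)

lemma test_function_reproducing:
  assumes "f \<in> test_functions"
  shows "(LINT x|lborel. complex_of_real (yukawa y x) * helmholtz f x) = of_real kappa * f y"
  using reproducing_property[OF test_function_L2[OF assms] test_function_continuous[OF assms]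
      test_function_L2[OF test_function_helmholtz[OF assms]] test_function_weak_helmholtz[OF assms], of y]
  by (simp add: mult.commute)

text \<open>The reproducing property is applied to the continuous representative supplied by
  \<open>dom_H\<close>, not to f. Changing f on a null set affects neither its pairings nor its
  membership in \<open>L2\<close>, and the representative vanishes at X j. As the kernel is real,
  the conjugate in the inner product can be taken outside.\<close>

lemma phi_in_defect_subspace: "phi X j \<in> defect_subspace X"
  unfolding defect_subspace_def L2_orthogonal_complement_def
proof (intro CollectI conjI ballI)
  show "phi X j \<in> L2" unfolding phi_eq_yukawa by (rule yukawa_L2)
  fix h assume "h \<in> ran_H_plus_I X"
  then obtain f where f: "f \<in> dom_H X" and h: "h = (\<lambda>x. neg_laplacian f x + f x)"
    unfolding ran_H_plus_I_def by blast
  from f obtain g where fW: "f \<in> W22" and g: "continuous_on UNIV g" "AE x in lborel. f x = g x" "g (X j) = 0"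
    unfolding dom_H_def by blast
  have fL: "f \<in> L2" using fW by (simp add: W22_def)
  note [measurable] = L2_measurable[OF fL] borel_measurable_continuous_onI[OF g(1)]
  have gL: "g \<in> L2"
  proof -
    have "integrable lborel (\<lambda>x. (cmod (g x))\<^sup>2) \<longleftrightarrow> integrable lborel (\<lambda>x. (cmod (f x))\<^sup>2)"
      by (rule integrable_cong_AE) (use g(2) in \<open>auto elim: eventually_mono\<close>)
    then show ?thesis using fL by (simp add: L2_def)
  qed
  have hL: "h \<in> L2" unfolding h by (rule W22_weak_helmholtz(1)[OF fW])
  have "weak_helmholtz g h"
    unfolding weak_helmholtz_def
  proof
    fix \<psi> assume \<psi>: "\<psi> \<in> test_functions"
    note [measurable] = test_function_measurable[OF test_function_helmholtz[OF \<psi>]]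
    have "(LINT x|lborel. g x * helmholtz \<psi> x) = (LINT x|lborel. f x * helmholtz \<psi> x)"
      by (rule integral_cong_AE) (use g(2) in \<open>auto elim: eventually_mono\<close>)
    then show "(LINT x|lborel. g x * helmholtz \<psi> x) = (LINT x|lborel. h x * \<psi> x)"
      using W22_weak_helmholtz(2)[OF fW] \<psi> by (simp add: weak_helmholtz_def h)
  qed
  from reproducing_property[OF gL g(1) hL this, of "X j"]
  have "(LINT x|lborel. h x * complex_of_real (yukawa (X j) x)) = 0" using g(3) by simp
  moreover have "L2_inner (phi X j) h = cnj (LINT x|lborel. h x * complex_of_real (yukawa (X j) x))"
    unfolding L2_inner_def phi_eq_yukawa Bochner_Integration.integral_cnj[symmetric] by (simp add: mult.commute)
  ultimately show "L2_inner (phi X j) h = 0" by simp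
qed

text \<open>\<open>L2_inner\<close> conjugates its second argument while the pairings are bilinear,
  so orthogonality is tested with the conjugate of f, which vanishes at the same points.\<close>

lemma defect_subspace_orthogonal:
  assumes g: "g \<in> defect_subspace X" and f: "f \<in> test_functions" and zero: "\<And>j. f (X j) = 0"
  shows "(LINT x|lborel. g x * helmholtz f x) = 0"
proof -
  define F where "F x = cnj (f x)" for x
  have F: "F \<in> test_functions" unfolding F_def by (rule test_function_cnj[OF f])
  have "F \<in> dom_H X"
    unfolding dom_H_def using F zero test_function_continuous[OF F]
    by (auto intro!: test_function_W22 exI[of _ F] simp: F_def)
  then have 0: "L2_inner g (\<lambda>x. neg_laplacian F x + F x) = 0"
    using g by (simp add: defect_subspace_def L2_orthogonal_complement_def ran_H_plus_I_def)
  have gL: "g \<in> L2" using g by (simp add: defect_subspace_def L2_orthogonal_complement_def)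
  have FL: "(\<lambda>x. cnj (neg_laplacian F x + F x)) \<in> L2"
    by (intro L2_cnj W22_weak_helmholtz test_function_W22 F)
  note [measurable] = L2_measurable[OF gL] L2_measurable[OF FL] test_function_measurable[OF test_function_helmholtz[OF f]]
  have "helmholtz F = (\<lambda>x. cnj (helmholtz f x))"
    unfolding F_def using helmholtz_cnj[OF test_function_smooth[OF f]] .
  then have "(LINT x|lborel. g x * helmholtz f x) = L2_inner g (\<lambda>x. neg_laplacian F x + F x)"
    unfolding L2_inner_def
  proof (intro integral_cong_AE)
    assume hF: "helmholtz F = (\<lambda>x. cnj (helmholtz f x))"
    show "AE x in lborel. g x * helmholtz f x = g x * cnj (neg_laplacian F x + F x)"
      using test_function_neg_laplacian[OF F] by eventually_elim (simp only: hF complex_cnj_cnj)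
  qed measurable
  with 0 show ?thesis by simp
qed

section \<open>Separated points\<close>

locale separated =
  fixes X :: "nat \<Rightarrow> real^3" and d :: real
  assumes d_pos: "d > 0" and separation: "k \<noteq> j \<Longrightarrow> d \<le> norm (X k - X j)"
begin

lemma ball_unique:
  assumes "norm (x - X k) < d / 2" "norm (x - X j) < d / 2"
  shows "k = j"
proof (rule ccontr)
  assume "k \<noteq> j"
  then have "d \<le> norm (X k - X j)" by (rule separation)
  also have "\<dots> \<le> norm (x - X k) + norm (x - X j)"
    using norm_triangle_ineq4[of "x - X j" "x - X k"] by simp
  finally show False using assms by linarith
qed

text \<open>The coefficient 4 / d^2 makes the argument of \<open>flat\<close> positive exactly for
  |x - X j| < d / 2, and \<open>exp 1\<close> normalises the value at X j to 1.\<close>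

definition bump :: "nat \<Rightarrow> real^3 \<Rightarrow> complex" where
  "bump j x = complex_of_real (exp 1) * complex_of_real (flat 0 (1 + (- (4 / d\<^sup>2)) * (norm (x - X j))\<^sup>2))"

text \<open>The image under 1 - Delta of the bump centred at the origin. All
  \<open>helmholtz (bump j)\<close> are translates of this one function, so their norms do not
  depend on j.\<close>

definition bump_source :: "real^3 \<Rightarrow> real" where
  "bump_source z = exp 1 * (flat 0 (1 - 4 / d\<^sup>2 * (norm z)\<^sup>2) + 6 * (4 / d\<^sup>2) * flat 2 (1 - 4 / d\<^sup>2 * (norm z)\<^sup>2)
     - 4 * (norm z)\<^sup>2 * (4 / d\<^sup>2)\<^sup>2 * (flat 4 (1 - 4 / d\<^sup>2 * (norm z)\<^sup>2) - 2 * flat 3 (1 - 4 / d\<^sup>2 * (norm z)\<^sup>2)))"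

lemma bump_test: "bump j \<in> test_functions"
  unfolding bump_def[abs_def] using d_pos by (intro test_function_cmult bump_test) simp

lemma outside_nonpos:
  assumes "norm z \<ge> d / 2"
  shows "1 - 4 / d\<^sup>2 * (norm z)\<^sup>2 \<le> 0"
proof -
  have "(d / 2)\<^sup>2 \<le> (norm z)\<^sup>2" using assms d_pos by (intro power_mono) auto
  then have "4 / d\<^sup>2 * (d / 2)\<^sup>2 \<le> 4 / d\<^sup>2 * (norm z)\<^sup>2" by (intro mult_left_mono) auto
  moreover have "4 / d\<^sup>2 * (d / 2)\<^sup>2 = 1" using d_pos by (simp add: power_divide)
  ultimately show ?thesis by linarith
qed

lemma bump_at: "bump j (X k) = (if j = k then 1 else 0)"
proof (cases "j = k")
  case True
  then show ?thesis
    by (simp add: bump_def flat_def of_real_mult[symmetric] exp_add[symmetric] del: of_real_mult)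
next
  case False
  then have "norm (X k - X j) \<ge> d / 2" using separation[of k j] d_pos by linarith
  from outside_nonpos[OF this] False show ?thesis by (simp add: bump_def flat_nonpos)
qed

lemma bump_source_outside:
  assumes "norm z \<ge> d / 2"
  shows "bump_source z = 0"
  unfolding bump_source_def flat_nonpos[OF outside_nonpos[OF assms]] by simp

lemma helmholtz_bump: "helmholtz (bump j) x = complex_of_real (bump_source (x - X j))"
proof -
  define a where "a = 4 / d\<^sup>2"
  define F where "F n s = flat n (1 - a * s)" for n s
  have DF: "(F n has_real_derivative - a * (- real n * F (n + 1) s + F (n + 2) s)) (at s)" for n s
  proof -
    have "((\<lambda>s. 1 - a * s) has_real_derivative - a) (at s)"
      by (auto intro!: derivative_eq_intros)
    from DERIV_chain2[of "flat n", OF DERIV_flat this] show ?thesis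
      unfolding F_def by (simp add: mult.commute)
  qed
  have D1: "((\<lambda>s. exp 1 * F 0 s) has_real_derivative exp 1 * (- a * F 2 s)) (at s)" for s
    by (rule derivative_eq_intros DF refl)+ (simp add: eval_nat_numeral)
  have D2: "((\<lambda>s. exp 1 * (- a * F 2 s)) has_real_derivative exp 1 * (a\<^sup>2 * (F 4 s - 2 * F 3 s))) (at s)" for s
    by (rule derivative_eq_intros DF refl)+ (simp add: eval_nat_numeral algebra_simps)
  have "bump j = (\<lambda>x. complex_of_real (exp 1 * F 0 ((norm (x - X j))\<^sup>2)))"
    by (simp add: bump_def F_def a_def fun_eq_iff)
  then have "helmholtz (bump j) x = complex_of_real (exp 1 * F 0 ((norm (x - X j))\<^sup>2)
      - 6 * (exp 1 * (- a * F 2 ((norm (x - X j))\<^sup>2)))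
      - 4 * (norm (x - X j))\<^sup>2 * (exp 1 * (a\<^sup>2 * (F 4 ((norm (x - X j))\<^sup>2) - 2 * F 3 ((norm (x - X j))\<^sup>2)))))"
    using helmholtz_radial[of UNIV "\<lambda>s. exp 1 * F 0 s", OF D1 D2, of "X j" x] by simp
  also have "\<dots> = complex_of_real (bump_source (x - X j))"
    unfolding bump_source_def a_def[symmetric] F_def by (simp only: of_real_eq_iff) (simp add: algebra_simps)
  finally show ?thesis .
qed

lemma bump_source_measurable [measurable]: "bump_source \<in> borel_measurable borel"
proof -
  have [measurable]: "flat n \<in> borel_measurable borel" for n
    by (intro borel_measurable_continuous_onI continuous_at_imp_continuous_on ballI isCont_flat)
  show ?thesis unfolding bump_source_def by measurable
qed

lemma bump_source_square_integrable: "integrable lborel (\<lambda>x. (bump_source (x - y))\<^sup>2)"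
proof -
  have "helmholtz (bump 0) \<in> L2" by (intro test_function_L2 test_function_helmholtz bump_test)
  then have "integrable lborel (\<lambda>x. (bump_source (x - X 0))\<^sup>2)" by (simp add: L2_def helmholtz_bump)
  then show ?thesis by (simp add: integrable_translate[of "\<lambda>z. (bump_source z)\<^sup>2"])
qed

text \<open>The summand 1 secures positivity, as the constant is later divided by.\<close>

definition bump_energy :: real where "bump_energy = (LINT z|lborel. (bump_source z)\<^sup>2) + 1"

lemma bump_energy_pos: "bump_energy > 0"
proof -
  have "(LINT z|lborel. (bump_source z)\<^sup>2) \<ge> 0" by (rule Bochner_Integration.integral_nonneg) simp
  then show ?thesis unfolding bump_energy_def by linarith
qed

definition bump_sum :: "(nat \<Rightarrow> complex) \<Rightarrow> nat \<Rightarrow> real^3 \<Rightarrow> complex" where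
  "bump_sum \<xi> m x = (\<Sum>j<m. \<xi> j * bump j x)"

lemma bump_sum_test: "bump_sum \<xi> m \<in> test_functions"
  unfolding bump_sum_def[abs_def] by (intro test_function_sum test_function_cmult bump_test) auto

lemma helmholtz_bump_sum: "helmholtz (bump_sum \<xi> m) x = (\<Sum>j<m. \<xi> j * helmholtz (bump j) x)"
  unfolding bump_sum_def[abs_def]
  using helmholtz_sum[of "{..<m}" "\<lambda>j x. \<xi> j * bump j x"] test_function_smooth[OF bump_test]
  by (simp add: helmholtz_cmult smooth_mult smooth_const)

text \<open>Disjointness of the supports turns the square of the sum into the sum of the squares.\<close>

lemma helmholtz_bump_sum_norm:
  "(LINT x|lborel. (cmod (helmholtz (bump_sum \<xi> m) x))\<^sup>2) \<le> bump_energy * (\<Sum>j<m. (cmod (\<xi> j))\<^sup>2)"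
proof -
  have pt: "(cmod (helmholtz (bump_sum \<xi> m) x))\<^sup>2 = (\<Sum>j<m. (cmod (\<xi> j))\<^sup>2 * (bump_source (x - X j))\<^sup>2)" for x
  proof (cases "\<exists>k<m. norm (x - X k) < d / 2")
    case True
    then obtain k where k: "k < m" "norm (x - X k) < d / 2" by blast
    have z: "bump_source (x - X j) = 0" if "j \<noteq> k" for j
      using ball_unique[OF _ k(2), of j] that by (intro bump_source_outside) force
    have "helmholtz (bump_sum \<xi> m) x = (\<Sum>j<m. if j = k then \<xi> k * complex_of_real (bump_source (x - X k)) else 0)"
      unfolding helmholtz_bump_sum helmholtz_bump by (rule sum.cong) (auto simp: z)
    moreover have "(\<Sum>j<m. (cmod (\<xi> j))\<^sup>2 * (bump_source (x - X j))\<^sup>2) = (\<Sum>j<m. if j = k then (cmod (\<xi> k))\<^sup>2 * (bump_source (x - X k))\<^sup>2 else 0)"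
      by (rule sum.cong) (auto simp: z)
    ultimately show ?thesis using k(1) by (simp add: norm_mult power_mult_distrib)
  next
    case False
    then have "bump_source (x - X j) = 0" if "j < m" for j using that by (intro bump_source_outside) force
    then show ?thesis by (simp add: helmholtz_bump_sum helmholtz_bump)
  qed
  have "(LINT x|lborel. (cmod (helmholtz (bump_sum \<xi> m) x))\<^sup>2) = (\<Sum>j<m. LINT x|lborel. (cmod (\<xi> j))\<^sup>2 * (bump_source (x - X j))\<^sup>2)"
    unfolding pt by (rule Bochner_Integration.integral_sum) (intro integrable_mult_right bump_source_square_integrable)
  also have "\<dots> = (\<Sum>j<m. (cmod (\<xi> j))\<^sup>2 * (LINT z|lborel. (bump_source z)\<^sup>2))"
    by (simp add: integral_translate[of "\<lambda>z. (bump_source z)\<^sup>2"])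
  also have "\<dots> \<le> (\<Sum>j<m. (cmod (\<xi> j))\<^sup>2 * bump_energy)"
    unfolding bump_energy_def by (intro sum_mono mult_left_mono) auto
  finally show ?thesis by (simp add: sum_distrib_left mult.commute)
qed

text \<open>Duality: writing S for the sum of squares, the pairing equals c S, while the square norm
  of the tested function is at most \<open>bump_energy * S\<close>. Cauchy-Schwarz and division by S
  give the bound. It is used with c = \<open>kappa\<close> for the lower Riesz bound and with c = 1
  for the coefficients of a general g.\<close>

lemma pairing_bound:
  assumes g: "g \<in> L2" and eq: "(LINT x|lborel. g x * helmholtz (bump_sum \<xi> m) x) = complex_of_real (c * (\<Sum>j<m. (cmod (\<xi> j))\<^sup>2))"
  shows "c\<^sup>2 * (\<Sum>j<m. (cmod (\<xi> j))\<^sup>2) \<le> bump_energy * (LINT x|lborel. (cmod (g x))\<^sup>2)"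
proof -
  define S where "S = (\<Sum>j<m. (cmod (\<xi> j))\<^sup>2)"
  define G where "G = (LINT x|lborel. (cmod (g x))\<^sup>2)"
  have S0: "S \<ge> 0" by (simp add: S_def sum_nonneg)
  have G0: "G \<ge> 0" unfolding G_def by (rule Bochner_Integration.integral_nonneg) simp
  have "(c * S)\<^sup>2 = (cmod (LINT x|lborel. g x * helmholtz (bump_sum \<xi> m) x))\<^sup>2"
    unfolding eq S_def norm_of_real by simp
  also have "\<dots> \<le> G * (LINT x|lborel. (cmod (helmholtz (bump_sum \<xi> m) x))\<^sup>2)"
    unfolding G_def by (intro L2_Cauchy_Schwarz g test_function_L2 test_function_helmholtz bump_sum_test)
  also have "\<dots> \<le> G * (bump_energy * S)"
    unfolding S_def by (intro mult_left_mono helmholtz_bump_sum_norm G0)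
  finally have *: "(c\<^sup>2 * S) * S \<le> (bump_energy * G) * S" by (simp add: power2_eq_square algebra_simps)
  show ?thesis
  proof (cases "S = 0")
    case True
    then show ?thesis using G0 bump_energy_pos by (simp add: S_def G_def)
  next
    case False
    then show ?thesis using * S0 by (simp add: S_def[symmetric] G_def[symmetric])
  qed
qed

section \<open>Riesz bounds for finite combinations\<close>

definition partial_sum :: "(nat \<Rightarrow> complex) \<Rightarrow> nat \<Rightarrow> real^3 \<Rightarrow> complex" where
  "partial_sum \<xi> m x = (\<Sum>k<m. \<xi> k * phi X k x)"

lemma partial_sum_L2: "partial_sum \<xi> m \<in> L2"
  unfolding partial_sum_def[abs_def] phi_eq_yukawa by (intro L2_sum L2_cmult yukawa_L2) auto

lemma integral_partial_sum_helmholtz: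
  assumes f: "f \<in> test_functions"
  shows "(LINT x|lborel. partial_sum \<xi> m x * helmholtz f x) = of_real kappa * (\<Sum>k<m. \<xi> k * f (X k))"
proof -
  have "(LINT x|lborel. partial_sum \<xi> m x * helmholtz f x) =
     (LINT x|lborel. (\<Sum>k<m. \<xi> k * (complex_of_real (yukawa (X k) x) * helmholtz f x)))"
    by (simp add: partial_sum_def phi_eq_yukawa sum_distrib_right mult.assoc)
  also have "\<dots> = (\<Sum>k<m. LINT x|lborel. \<xi> k * (complex_of_real (yukawa (X k) x) * helmholtz f x))"
    by (intro Bochner_Integration.integral_sum integrable_mult_right L2_mult_integrable yukawa_L2
        test_function_L2 test_function_helmholtz f)
  also have "\<dots> = (\<Sum>k<m. \<xi> k * (of_real kappa * f (X k)))"
    by (simp only: integral_mult_right_zero test_function_reproducing[OF f])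
  finally show ?thesis by (simp add: sum_distrib_left mult.left_commute)
qed

lemma bump_sum_at: "bump_sum \<xi> m (X k) = (if k < m then \<xi> k else 0)"
  by (simp add: bump_sum_def bump_at if_distrib[of "(*) _"] cong: if_cong)

lemma riesz_lower_bound:
  "kappa\<^sup>2 / bump_energy * (\<Sum>k<m. (cmod (\<xi> k))\<^sup>2) \<le> (LINT x|lborel. (cmod (partial_sum \<xi> m x))\<^sup>2)"
proof -
  have "(LINT x|lborel. partial_sum \<xi> m x * helmholtz (bump_sum (\<lambda>k. cnj (\<xi> k)) m) x) =
      of_real kappa * (\<Sum>k<m. \<xi> k * cnj (\<xi> k))"
    by (simp add: integral_partial_sum_helmholtz[OF bump_sum_test] bump_sum_at)
  also have "\<dots> = complex_of_real (kappa * (\<Sum>k<m. (cmod (cnj (\<xi> k)))\<^sup>2))"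
    by (simp add: complex_norm_square del: of_real_power)
  finally have "kappa\<^sup>2 * (\<Sum>k<m. (cmod (cnj (\<xi> k)))\<^sup>2) \<le> bump_energy * (LINT x|lborel. (cmod (partial_sum \<xi> m x))\<^sup>2)"
    by (rule pairing_bound[OF partial_sum_L2])
  then show ?thesis using bump_energy_pos by (simp add: field_simps)
qed

text \<open>On the ball of radius d / 2 about X k the function exp(-|y - x|) is at least exp(-d / 2)
  exp(-|x - X k|). Each term of the sum is thus at most exp(d / 2) / V times the integral over that
  ball, and the balls are disjoint, so the whole sum is controlled by the integral over the
  space.\<close>

lemma exp_sum_bounded: "\<exists>D>0. \<forall>x m. (\<Sum>k<m. exp (- norm (x - X k))) \<le> D"
proof -
  define V where "V = measure lborel (ball (0::real^3) (d / 2))"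
  have V: "V > 0" unfolding V_def using d_pos content_ball[of "d / 2" "0::real^3"] by simp
  define I where "I = (LINT y::real^3|lborel. exp (- norm y))"
  have I0: "I \<ge> 0" unfolding I_def by (rule Bochner_Integration.integral_nonneg) simp
  have ie: "integrable lborel (\<lambda>y. exp (- norm (y - x)))" for x :: "real^3"
    using integrable_translate[of "\<lambda>x. exp (- norm x)" x] exp_minus_norm_integrable by simp
  have "(\<Sum>k<m. exp (- norm (x - X k))) \<le> exp (d / 2) * I / V" for x m
  proof -
    have ib: "integrable lborel (\<lambda>y. indicator (ball (X k) (d / 2)) y * exp (- norm (y - x)))" for k
    proof (rule Bochner_Integration.integrable_bound[OF ie[of x]])
      show "AE y in lborel. norm (indicator (ball (X k) (d / 2)) y * exp (- norm (y - x))) \<le> norm (exp (- norm (y - x)))"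
        by (intro AE_I2) (simp add: indicator_def)
      show "(\<lambda>y. indicator (ball (X k) (d / 2)) y * exp (- norm (y - x))) \<in> borel_measurable lborel"
        by (intro borel_measurable_times borel_measurable_indicator) auto
    qed
    have Vk: "measure lborel (ball (X k) (d / 2)) = V" for k
      unfolding V_def using content_ball[of "d / 2" "X k"] content_ball[of "d / 2" "0::real^3"] d_pos
      by simp
    have one: "V * exp (- norm (x - X k)) \<le> exp (d / 2) * (LINT y|lborel. indicator (ball (X k) (d / 2)) y * exp (- norm (y - x)))" for k
    proof -
      have "V * exp (- norm (x - X k)) = (LINT y|lborel. exp (- norm (x - X k)) * indicator (ball (X k) (d / 2)) y)"
        using Vk[of k] by simp
      also have "\<dots> \<le> (LINT y|lborel. exp (d / 2) * (indicator (ball (X k) (d / 2)) y * exp (- norm (y - x))))"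
      proof (rule Bochner_Integration.integral_mono)
        show "integrable lborel (\<lambda>y. exp (- norm (x - X k)) * indicator (ball (X k) (d / 2)) y :: real)"
          by (intro integrable_mult_right integrable_real_indicator) (use emeasure_lborel_ball_finite[of "X k" "d / 2"] in auto)
        fix y :: "real^3"
        show "exp (- norm (x - X k)) * indicator (ball (X k) (d / 2)) y \<le> exp (d / 2) * (indicator (ball (X k) (d / 2)) y * exp (- norm (y - x)))"
        proof (cases "y \<in> ball (X k) (d / 2)")
          case True
          then have "norm (X k - y) < d / 2" by (simp add: dist_norm)
          moreover have "norm (y - x) \<le> norm (x - X k) + norm (X k - y)"
            using norm_triangle_ineq[of "x - X k" "X k - y"] by (simp add: norm_minus_commute)
          ultimately show ?thesis using True by (simp add: exp_add[symmetric])
        qed simp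
      qed (intro integrable_mult_right ib)
      finally show ?thesis by simp
    qed
    have "V * (\<Sum>k<m. exp (- norm (x - X k))) \<le> (\<Sum>k<m. exp (d / 2) * (LINT y|lborel. indicator (ball (X k) (d / 2)) y * exp (- norm (y - x))))"
      unfolding sum_distrib_left by (intro sum_mono one)
    also have "\<dots> = exp (d / 2) * (LINT y|lborel. (\<Sum>k<m. indicator (ball (X k) (d / 2)) y * exp (- norm (y - x))))"
      unfolding sum_distrib_left[symmetric] by (subst Bochner_Integration.integral_sum) (rule ib, rule refl)
    also have "(LINT y|lborel. (\<Sum>k<m. indicator (ball (X k) (d / 2)) y * exp (- norm (y - x)))) \<le> (LINT y|lborel. exp (- norm (y - x)))"
    proof (rule Bochner_Integration.integral_mono)
      show "integrable lborel (\<lambda>y. (\<Sum>k<m. indicator (ball (X k) (d / 2)) y * exp (- norm (y - x))))"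
        by (intro Bochner_Integration.integrable_sum ib)
      fix y
      have "(\<Sum>k<m. indicator (ball (X k) (d / 2)) y :: real) \<le> 1"
      proof (cases "\<exists>k<m. y \<in> ball (X k) (d / 2)")
        case True
        then obtain k where k: "k < m" "y \<in> ball (X k) (d / 2)" by blast
        have "(\<Sum>j<m. indicator (ball (X j) (d / 2)) y :: real) = (\<Sum>j<m. if j = k then 1 else 0)"
        proof (rule sum.cong)
          fix j
          show "(indicator (ball (X j) (d / 2)) y :: real) = (if j = k then 1 else 0)"
          proof (cases "j = k")
            case False
            then have "y \<notin> ball (X j) (d / 2)"
              using ball_unique[of y j k] k(2) by (auto simp: dist_norm norm_minus_commute)
            with False show ?thesis by simp
          qed (use k(2) in simp)
        qed simp
        then show ?thesis by simp
      next
        case False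
        then have "(\<Sum>j<m. indicator (ball (X j) (d / 2)) y :: real) = 0"
          by (intro sum.neutral) (auto simp: indicator_def)
        then show ?thesis by simp
      qed
      from mult_right_mono[OF this, of "exp (- norm (y - x))"]
      show "(\<Sum>k<m. indicator (ball (X k) (d / 2)) y * exp (- norm (y - x))) \<le> exp (- norm (y - x))"
        by (simp add: sum_distrib_right)
    qed (rule ie)
    also have "(LINT y|lborel. exp (- norm (y - x))) = I"
      unfolding I_def by (rule integral_translate) measurable
    finally have "V * (\<Sum>k<m. exp (- norm (x - X k))) \<le> exp (d / 2) * I" by simp
    then show ?thesis using V by (subst pos_le_divide_eq) (simp_all add: mult.commute)
  qed
  then have "(\<Sum>k<m. exp (- norm (x - X k))) \<le> exp (d / 2) * I / V + 1" for x m
    by (rule order_trans) simp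
  moreover have "exp (d / 2) * I / V + 1 > 0"
    using I0 V by (intro add_nonneg_pos divide_nonneg_pos mult_nonneg_nonneg) auto
  ultimately show ?thesis by blast
qed

definition overlap_bound :: real where
  "overlap_bound = (SOME D. D > 0 \<and> (\<forall>x m. (\<Sum>k<m. exp (- norm (x - X k))) \<le> D))"

lemma overlap_bound_pos: "overlap_bound > 0" and exp_sum_le: "(\<Sum>k<m. exp (- norm (x - X k))) \<le> overlap_bound"
proof -
  have "overlap_bound > 0 \<and> (\<forall>x m. (\<Sum>k<m. exp (- norm (x - X k))) \<le> overlap_bound)"
    unfolding overlap_bound_def using exp_sum_bounded by (rule someI_ex)
  then show "overlap_bound > 0" "(\<Sum>k<m. exp (- norm (x - X k))) \<le> overlap_bound" by auto
qed

text \<open>The square of exp(-r / 2)/r, the singular factor in the splitting of the kernel; its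
  integral is the same for all k.\<close>

definition weight :: "nat \<Rightarrow> real^3 \<Rightarrow> real" where
  "weight k x = exp (- norm (x - X k)) / (norm (x - X k))\<^sup>2"

lemma weight_nonneg: "weight k x \<ge> 0"
  by (simp add: weight_def)

lemma weight_measurable [measurable]: "weight k \<in> borel_measurable borel"
  unfolding weight_def[abs_def] by measurable

lemma weight_integrable: "integrable lborel (weight k)"
  unfolding weight_def[abs_def]
  using integrable_translate[of "\<lambda>x. exp (- norm x) / (norm x)\<^sup>2" "X k"] exp_div_square_integrable[of 1]
  by simp

definition weight_integral :: real where "weight_integral = (LINT z::real^3|lborel. exp (- norm z) / (norm z)\<^sup>2)"

lemma integral_weight: "(LINT x|lborel. weight k x) = weight_integral"
  unfolding weight_def weight_integral_def by (rule integral_translate[of "\<lambda>x. exp (- norm x) / (norm x)\<^sup>2"]) measurable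

lemma weight_integral_nonneg: "weight_integral \<ge> 0"
  unfolding weight_integral_def by (rule Bochner_Integration.integral_nonneg) simp

text \<open>
  Splitting \<open>exp (- r) / r\<close> as \<open>exp (- r / 2) / r\<close> times \<open>exp (- r / 2)\<close> lets the pointwise
  Cauchy-Schwarz inequality decouple the singularities from the overlap of the tails.
\<close>

lemma yukawa_sum_square_le:
  assumes "J \<subseteq> {..<m}" "\<And>k. c k \<ge> 0"
  shows "(\<Sum>k\<in>J. c k * yukawa (X k) x)\<^sup>2 \<le> overlap_bound * (\<Sum>k\<in>J. (c k)\<^sup>2 * weight k x)"
proof -
  have J: "finite J" using assms(1) finite_subset by blast
  have "(\<Sum>k\<in>J. c k * yukawa (X k) x) =
     (\<Sum>k\<in>J. (c k * (exp (- norm (x - X k) / 2) / norm (x - X k))) * exp (- norm (x - X k) / 2))"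
    by (rule sum.cong) (auto simp: yukawa_def exp_add[symmetric])
  also have "\<dots>\<^sup>2 \<le> (\<Sum>k\<in>J. (c k * (exp (- norm (x - X k) / 2) / norm (x - X k)))\<^sup>2) * (\<Sum>k\<in>J. (exp (- norm (x - X k) / 2))\<^sup>2)"
    by (rule Cauchy_Schwarz_ineq_sum)
  also have "(\<Sum>k\<in>J. (c k * (exp (- norm (x - X k) / 2) / norm (x - X k)))\<^sup>2) = (\<Sum>k\<in>J. (c k)\<^sup>2 * weight k x)"
    by (rule sum.cong) (auto simp: weight_def power_mult_distrib power_divide exp_double[symmetric])
  also have "(\<Sum>k\<in>J. (exp (- norm (x - X k) / 2))\<^sup>2) = (\<Sum>k\<in>J. exp (- norm (x - X k)))"
    by (rule sum.cong) (auto simp: exp_double[symmetric])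
  also have "(\<Sum>k\<in>J. (c k)\<^sup>2 * weight k x) * (\<Sum>k\<in>J. exp (- norm (x - X k))) \<le> (\<Sum>k\<in>J. (c k)\<^sup>2 * weight k x) * overlap_bound"
  proof (rule mult_left_mono)
    have "(\<Sum>k\<in>J. exp (- norm (x - X k))) \<le> (\<Sum>k<m. exp (- norm (x - X k)))"
      by (rule sum_mono2) (use assms in auto)
    then show "(\<Sum>k\<in>J. exp (- norm (x - X k))) \<le> overlap_bound" using exp_sum_le[of x m] by linarith
    show "0 \<le> (\<Sum>k\<in>J. (c k)\<^sup>2 * weight k x)" by (intro sum_nonneg mult_nonneg_nonneg weight_nonneg) auto
  qed
  finally show ?thesis by (simp add: mult.commute)
qed

text \<open>General index sets J are allowed so that the estimate also controls blocks {m..<p} of a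
  series.\<close>

lemma phi_sum_square_le:
  assumes "J \<subseteq> {..<m}"
  shows "(cmod (\<Sum>k\<in>J. \<xi> k * phi X k x))\<^sup>2 \<le> overlap_bound * (\<Sum>k\<in>J. (cmod (\<xi> k))\<^sup>2 * weight k x)"
proof -
  have "cmod (\<Sum>k\<in>J. \<xi> k * phi X k x) \<le> (\<Sum>k\<in>J. cmod (\<xi> k) * yukawa (X k) x)"
    by (rule order_trans[OF norm_sum]) (simp add: norm_mult phi_eq_yukawa yukawa_nonneg)
  then have "(cmod (\<Sum>k\<in>J. \<xi> k * phi X k x))\<^sup>2 \<le> (\<Sum>k\<in>J. cmod (\<xi> k) * yukawa (X k) x)\<^sup>2"
    by (intro power_mono) auto
  also have "\<dots> \<le> overlap_bound * (\<Sum>k\<in>J. (cmod (\<xi> k))\<^sup>2 * weight k x)"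
    by (rule yukawa_sum_square_le[OF assms]) simp
  finally show ?thesis .
qed

lemma riesz_upper_bound:
  "(LINT x|lborel. (cmod (partial_sum \<xi> m x))\<^sup>2) \<le> overlap_bound * weight_integral * (\<Sum>k<m. (cmod (\<xi> k))\<^sup>2)"
proof -
  have i: "integrable lborel (\<lambda>x. (\<Sum>k<m. (cmod (\<xi> k))\<^sup>2 * weight k x))"
    by (intro Bochner_Integration.integrable_sum integrable_mult_right weight_integrable)
  have "(LINT x|lborel. (cmod (partial_sum \<xi> m x))\<^sup>2) \<le> (LINT x|lborel. overlap_bound * (\<Sum>k<m. (cmod (\<xi> k))\<^sup>2 * weight k x))"
  proof (rule Bochner_Integration.integral_mono)
    show "integrable lborel (\<lambda>x. (cmod (partial_sum \<xi> m x))\<^sup>2)" using partial_sum_L2 by (simp add: L2_def)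
    show "integrable lborel (\<lambda>x. overlap_bound * (\<Sum>k<m. (cmod (\<xi> k))\<^sup>2 * weight k x))" by (rule integrable_mult_right[OF i])
    show "(cmod (partial_sum \<xi> m x))\<^sup>2 \<le> overlap_bound * (\<Sum>k<m. (cmod (\<xi> k))\<^sup>2 * weight k x)" for x
      unfolding partial_sum_def by (rule phi_sum_square_le) auto
  qed
  also have "\<dots> = overlap_bound * (\<Sum>k<m. (cmod (\<xi> k))\<^sup>2 * weight_integral)"
    by (subst integral_mult_right_zero, subst Bochner_Integration.integral_sum)
      (auto intro!: integrable_mult_right weight_integrable simp: integral_weight)
  finally show ?thesis by (simp add: sum_distrib_left mult_ac)
qed

end

section \<open>Completeness of the system in the defect subspace\<close>

context separated
begin

text \<open>The series is summed pointwise. Let B be the sum of |a_k|^2 \<open>weight k\<close>,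
  which is integrable and hence finite almost everywhere. Where it is finite, the weighted
  Cauchy-Schwarz estimate gives absolute convergence and bounds every |g - partial sum|^2 by
  \<open>overlap_bound * B\<close>; dominated convergence turns this into convergence in
  norm.\<close>

lemma L2_coefficients_limit:
  assumes a: "summable (\<lambda>k. (cmod (a k))\<^sup>2)"
  obtains g where "g \<in> L2" "(\<lambda>m. LINT x|lborel. (cmod (g x - partial_sum a m x))\<^sup>2) \<longlonglongrightarrow> 0"
proof -
  define s where "s k x = (cmod (a k))\<^sup>2 * weight k x" for k x
  have s0: "s k x \<ge> 0" for k x by (simp add: s_def weight_nonneg)
  have [measurable]: "s k \<in> borel_measurable borel" for k unfolding s_def[abs_def] by measurable
  have si: "integrable lborel (s k)" for k
    unfolding s_def[abs_def] by (intro integrable_mult_right weight_integrable)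
  have sI: "(LINT x|lborel. s k x) = (cmod (a k))\<^sup>2 * weight_integral" for k
    unfolding s_def by (simp add: integral_weight)
  have sumI: "summable (\<lambda>k. LINT x|lborel. norm (s k x))"
    using summable_mult2[OF a, of weight_integral] by (simp add: s0 sI)
  have AE: "AE x in lborel. summable (\<lambda>k. norm (s k x))"
  proof -
    have "(\<integral>\<^sup>+x. (\<Sum>k. ennreal (s k x)) \<partial>lborel) = (\<Sum>k. ennreal ((cmod (a k))\<^sup>2 * weight_integral))"
      by (subst nn_integral_suminf) (auto simp: nn_integral_eq_integral[OF si] s0 sI)
    also have "\<dots> = ennreal (\<Sum>k. (cmod (a k))\<^sup>2 * weight_integral)"
      using summable_mult2[OF a, of weight_integral] weight_integral_nonneg by (intro suminf_ennreal2) auto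
    finally have "(\<integral>\<^sup>+x. (\<Sum>k. ennreal (s k x)) \<partial>lborel) \<noteq> \<infinity>" by simp
    then have "AE x in lborel. (\<Sum>k. ennreal (s k x)) \<noteq> \<infinity>"
      by (intro nn_integral_noteq_infinite) auto
    then show ?thesis
      by eventually_elim (use s0 summable_suminf_not_top in auto)
  qed
  define B where "B x = (\<Sum>k. s k x)" for x
  have Bi: "integrable lborel B"
    unfolding B_def[abs_def] by (rule integrable_suminf[OF si AE sumI])
  define g where "g x = (\<Sum>k. a k * phi X k x)" for x
  have [measurable]: "phi X k \<in> borel_measurable borel" for k
    unfolding phi_eq_yukawa by measurable
  have gm [measurable]: "g \<in> borel_measurable borel" unfolding g_def[abs_def] by measurable
  have pm [measurable]: "partial_sum a m \<in> borel_measurable borel" for m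
    using partial_sum_L2 by (rule L2_measurable)
  have conv: "(\<lambda>m. partial_sum a m x) \<longlonglongrightarrow> g x \<and> (\<forall>m. (cmod (g x - partial_sum a m x))\<^sup>2 \<le> overlap_bound * B x)"
    if sx: "summable (\<lambda>k. norm (s k x))" for x
  proof -
    have ss: "summable (\<lambda>k. s k x)" using sx s0 by simp
    have sle: "(\<Sum>k\<in>J. s k x) \<le> B x" if "finite J" for J
      unfolding B_def by (rule sum_le_suminf[OF ss that]) (simp add: s0)
    have "summable (\<lambda>k. cmod (a k * phi X k x))"
    proof (rule summableI_nonneg_bounded)
      fix n
      have "(\<Sum>k<n. cmod (a k) * yukawa (X k) x)\<^sup>2 \<le> overlap_bound * (\<Sum>k<n. s k x)"
        using yukawa_sum_square_le[of "{..<n}" n "\<lambda>k. cmod (a k)" x] by (simp add: s_def)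
      also have "\<dots> \<le> overlap_bound * B x" using overlap_bound_pos by (intro mult_left_mono sle) auto
      finally have "(\<Sum>k<n. cmod (a k) * yukawa (X k) x) \<le> sqrt (overlap_bound * B x)"
        by (rule real_le_rsqrt)
      then show "(\<Sum>k<n. cmod (a k * phi X k x)) \<le> sqrt (overlap_bound * B x)"
        by (simp add: norm_mult phi_eq_yukawa yukawa_nonneg)
    qed simp
    then have "summable (\<lambda>k. a k * phi X k x)" by (rule summable_norm_cancel)
    then have lim: "(\<lambda>m. partial_sum a m x) \<longlonglongrightarrow> g x"
      unfolding partial_sum_def g_def by (rule summable_LIMSEQ)
    have "(cmod (g x - partial_sum a m x))\<^sup>2 \<le> overlap_bound * B x" for m
    proof (rule LIMSEQ_le_const2)
      show "(\<lambda>p. (cmod (partial_sum a p x - partial_sum a m x))\<^sup>2) \<longlonglongrightarrow> (cmod (g x - partial_sum a m x))\<^sup>2"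
        by (intro tendsto_intros lim)
      have "(cmod (partial_sum a p x - partial_sum a m x))\<^sup>2 \<le> overlap_bound * B x" if "p \<ge> m" for p
      proof -
        have "partial_sum a p x - partial_sum a m x = (\<Sum>k\<in>{m..<p}. a k * phi X k x)"
          unfolding partial_sum_def using that sum_diff_nat_ivl[of 0 m p "\<lambda>k. a k * phi X k x"]
          by (simp add: atLeast0LessThan)
        then have "(cmod (partial_sum a p x - partial_sum a m x))\<^sup>2 \<le> overlap_bound * (\<Sum>k\<in>{m..<p}. s k x)"
          using phi_sum_square_le[of "{m..<p}" p a x] by (simp add: s_def subset_eq)
        also have "\<dots> \<le> overlap_bound * B x" using overlap_bound_pos by (intro mult_left_mono sle) auto
        finally show ?thesis .
      qed
      then show "\<exists>N. \<forall>p\<ge>N. (cmod (partial_sum a p x - partial_sum a m x))\<^sup>2 \<le> overlap_bound * B x" by blast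
    qed
    with lim show ?thesis by blast
  qed
  have CB: "integrable lborel (\<lambda>x. overlap_bound * B x)" by (rule integrable_mult_right[OF Bi])
  show thesis
  proof (rule that)
    have "integrable lborel (\<lambda>x. (cmod (g x))\<^sup>2)"
    proof (rule Bochner_Integration.integrable_bound[OF CB])
      show "AE x in lborel. norm ((cmod (g x))\<^sup>2) \<le> norm (overlap_bound * B x)"
        using AE
      proof eventually_elim
        fix x assume "summable (\<lambda>k. norm (s k x))"
        \<comment> \<open>The empty partial sum turns the remainder estimate into a bound for g
          itself.\<close>
        from conv[OF this] have "(cmod (g x - partial_sum a 0 x))\<^sup>2 \<le> overlap_bound * B x" by blast
        then have "(cmod (g x))\<^sup>2 \<le> overlap_bound * B x" by (simp add: partial_sum_def)
        then show "norm ((cmod (g x))\<^sup>2) \<le> norm (overlap_bound * B x)"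
          using abs_ge_self[of "overlap_bound * B x"] by (simp only: real_norm_def abs_power2 power2_abs)
      qed
    qed measurable
    then show "g \<in> L2" using gm by (simp add: L2_def)
    have "(\<lambda>m. LINT x|lborel. (cmod (g x - partial_sum a m x))\<^sup>2) \<longlonglongrightarrow> (LINT x::real^3|lborel. (0::real))"
    proof (rule integral_dominated_convergence[where w = "\<lambda>x. overlap_bound * B x"])
      show "AE x in lborel. (\<lambda>m. (cmod (g x - partial_sum a m x))\<^sup>2) \<longlonglongrightarrow> 0"
        using AE
      proof eventually_elim
        fix x assume "summable (\<lambda>k. norm (s k x))"
        from conv[OF this] have "(\<lambda>m. partial_sum a m x) \<longlonglongrightarrow> g x" by blast
        then have "(\<lambda>m. (cmod (g x - partial_sum a m x))\<^sup>2) \<longlonglongrightarrow> (cmod (g x - g x))\<^sup>2"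
          by (intro tendsto_intros)
        then show "(\<lambda>m. (cmod (g x - partial_sum a m x))\<^sup>2) \<longlonglongrightarrow> 0" by simp
      qed
      show "AE x in lborel. norm ((cmod (g x - partial_sum a m x))\<^sup>2) \<le> overlap_bound * B x" for m
        using AE by eventually_elim (use conv in simp)
    qed (use CB in measurable)
    then show "(\<lambda>m. LINT x|lborel. (cmod (g x - partial_sum a m x))\<^sup>2) \<longlonglongrightarrow> 0" by simp
  qed
qed

text \<open>Every point within distance R of the origin contributes at least exp(-R) to the
  exponential sum at 0, which bounds the cardinality of finite sets of such indices.\<close>

lemma finite_in_ball: "finite {j. norm (X j) \<le> R}"
proof -
  have "card G \<le> nat \<lceil>overlap_bound * exp R\<rceil>" if G: "G \<subseteq> {j. norm (X j) \<le> R}" "finite G" for G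
  proof -
    obtain m where m: "G \<subseteq> {..<m}"
      using G(2) finite_nat_iff_bounded by blast
    have "real (card G) * exp (- R) = (\<Sum>k\<in>G. exp (- R))" by simp
    also have "\<dots> \<le> (\<Sum>k\<in>G. exp (- norm (0 - X k)))" using G(1) by (intro sum_mono) auto
    also have "\<dots> \<le> (\<Sum>k<m. exp (- norm (0 - X k)))" by (rule sum_mono2) (use m in auto)
    also have "\<dots> \<le> overlap_bound" by (rule exp_sum_le)
    finally have "real (card G) * exp (- R) * exp R \<le> overlap_bound * exp R" by (rule mult_right_mono) simp
    then have "real (card G) \<le> overlap_bound * exp R" by (simp add: mult.assoc exp_add[symmetric])
    then show ?thesis by linarith
  qed
  then show ?thesis using finite_if_finite_subsets_card_bdd by blast
qed

text \<open>For g a finite combination of the kernels with coefficients a_k, the reproducing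
  property and \<open>bump_at\<close> make this \<open>kappa\<close> times a_j. This explains the
  later division by \<open>kappa\<close>.\<close>

definition coef :: "(real^3 \<Rightarrow> complex) \<Rightarrow> nat \<Rightarrow> complex" where
  "coef g j = (LINT x|lborel. g x * helmholtz (bump j) x)"

text \<open>A Bessel inequality by duality: combining the bumps with the conjugate coefficients
  makes the pairing with g equal to the sum of squares.\<close>

lemma coef_square_summable:
  assumes g: "g \<in> L2"
  shows "summable (\<lambda>j. (cmod (coef g j))\<^sup>2)"
proof (rule summableI_nonneg_bounded)
  fix m
  have "(LINT x|lborel. g x * helmholtz (bump_sum (\<lambda>j. cnj (coef g j)) m) x) =
     (LINT x|lborel. (\<Sum>j<m. cnj (coef g j) * (g x * helmholtz (bump j) x)))"
    by (simp add: helmholtz_bump_sum sum_distrib_left mult.left_commute)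
  also have "\<dots> = (\<Sum>j<m. LINT x|lborel. cnj (coef g j) * (g x * helmholtz (bump j) x))"
    by (intro Bochner_Integration.integral_sum integrable_mult_right L2_mult_integrable g
        test_function_L2 test_function_helmholtz bump_test)
  also have "\<dots> = (\<Sum>j<m. cnj (coef g j) * coef g j)"
    by (simp only: integral_mult_right_zero coef_def)
  also have "\<dots> = complex_of_real (1 * (\<Sum>j<m. (cmod (cnj (coef g j)))\<^sup>2))"
    by (simp add: complex_norm_square mult.commute del: of_real_power)
  finally have "1\<^sup>2 * (\<Sum>j<m. (cmod (cnj (coef g j)))\<^sup>2) \<le> bump_energy * (LINT x|lborel. (cmod (g x))\<^sup>2)"
    by (rule pairing_bound[OF g])
  then show "(\<Sum>j<m. (cmod (coef g j))\<^sup>2) \<le> bump_energy * (LINT x|lborel. (cmod (g x))\<^sup>2)" by simp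
qed simp

text \<open>
  Subtracting \<open>f (X j) * bump j\<close> for the finitely many \<open>j\<close> with \<open>f (X j) \<noteq> 0\<close> moves \<open>f\<close> into \<open>dom_H X\<close>.
\<close>

lemma defect_pairing:
  assumes g: "g \<in> defect_subspace X" and f: "f \<in> test_functions"
    and J: "finite J" "{j. f (X j) \<noteq> 0} \<subseteq> J"
  shows "(LINT x|lborel. g x * helmholtz f x) = (\<Sum>j\<in>J. f (X j) * coef g j)"
proof -
  have gL: "g \<in> L2" using g by (simp add: defect_subspace_def L2_orthogonal_complement_def)
  define r where "r x = (\<Sum>j\<in>J. (- f (X j)) * bump j x)" for x
  have rt: "r \<in> test_functions"
    unfolding r_def[abs_def] by (intro test_function_sum test_function_cmult bump_test J)
  have "f (X k) + r (X k) = 0" for k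
  proof -
    have "r (X k) = (\<Sum>j\<in>J. if j = k then - f (X k) else 0)"
      unfolding r_def by (rule sum.cong) (auto simp: bump_at)
    also have "\<dots> = - f (X k)" using J by (auto simp: sum.delta)
    finally show ?thesis by simp
  qed
  then have "(LINT x|lborel. g x * helmholtz (\<lambda>x. f x + r x) x) = 0"
    by (intro defect_subspace_orthogonal[OF g] test_function_add f rt)
  also have "helmholtz (\<lambda>x. f x + r x) = (\<lambda>x. helmholtz f x + (\<Sum>j\<in>J. (- f (X j)) * helmholtz (bump j) x))"
  proof -
    have sm: "smooth (\<lambda>x. (- f (X j)) * bump j x)" for j
      by (intro test_function_smooth test_function_cmult bump_test)
    have "helmholtz r = (\<lambda>x. \<Sum>j\<in>J. helmholtz (\<lambda>x. (- f (X j)) * bump j x) x)"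
      unfolding r_def[abs_def] using helmholtz_sum[of J "\<lambda>j x. (- f (X j)) * bump j x", OF J(1) sm] by blast
    then show ?thesis
      by (simp only: helmholtz_add[OF test_function_smooth[OF f] test_function_smooth[OF rt]]
          helmholtz_cmult[OF test_function_smooth[OF bump_test]])
  qed
  finally have "(LINT x|lborel. g x * (helmholtz f x + (\<Sum>j\<in>J. (- f (X j)) * helmholtz (bump j) x))) = 0" .
  moreover have "(LINT x|lborel. g x * (helmholtz f x + (\<Sum>j\<in>J. (- f (X j)) * helmholtz (bump j) x))) =
     (LINT x|lborel. g x * helmholtz f x) - (\<Sum>j\<in>J. f (X j) * coef g j)"
  proof -
    have i: "integrable lborel (\<lambda>x. g x * helmholtz f x)" "integrable lborel (\<lambda>x. (- f (X j)) * (g x * helmholtz (bump j) x))" for j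
      by (intro integrable_mult_right L2_mult_integrable gL test_function_L2 test_function_helmholtz f bump_test)+
    have "(LINT x|lborel. g x * (helmholtz f x + (\<Sum>j\<in>J. (- f (X j)) * helmholtz (bump j) x))) =
        (LINT x|lborel. g x * helmholtz f x + (\<Sum>j\<in>J. (- f (X j)) * (g x * helmholtz (bump j) x)))"
      by (simp only: distrib_left sum_distrib_left mult.left_commute)
    also have "\<dots> = (LINT x|lborel. g x * helmholtz f x) + (LINT x|lborel. (\<Sum>j\<in>J. (- f (X j)) * (g x * helmholtz (bump j) x)))"
      by (intro Bochner_Integration.integral_add Bochner_Integration.integrable_sum i)
    also have "(LINT x|lborel. (\<Sum>j\<in>J. (- f (X j)) * (g x * helmholtz (bump j) x))) = (\<Sum>j\<in>J. LINT x|lborel. (- f (X j)) * (g x * helmholtz (bump j) x))"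
      by (intro Bochner_Integration.integral_sum i)
    also have "\<dots> = (\<Sum>j\<in>J. (- f (X j)) * coef g j)"
      by (simp only: integral_mult_right_zero coef_def)
    finally show ?thesis by (simp add: sum_negf)
  qed
  ultimately show ?thesis by simp
qed

text \<open>The support of a test function f meets only finitely many points, so all late partial
  sums pair with \<open>helmholtz f\<close> exactly as g does. Their limit h inherits these
  pairings, and uniqueness gives g = h almost everywhere; the convergence known for h is then
  convergence to g.\<close>

lemma span_dense_in_defect_subspace:
  assumes g: "g \<in> defect_subspace X"
  shows "(\<lambda>m. L2_norm (\<lambda>x. g x - partial_sum (\<lambda>k. coef g k / of_real kappa) m x)) \<longlonglongrightarrow> 0"
proof -
  define a where "a k = coef g k / of_real kappa" for k
  have gL: "g \<in> L2" using g by (simp add: defect_subspace_def L2_orthogonal_complement_def)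
  have "summable (\<lambda>k. (cmod (coef g k))\<^sup>2 / kappa\<^sup>2)"
    by (rule summable_divide[OF coef_square_summable[OF gL]])
  then have "summable (\<lambda>k. (cmod (a k))\<^sup>2)"
    by (simp add: a_def norm_divide power_divide)
  then obtain h where h: "h \<in> L2" and lim: "(\<lambda>m. LINT x|lborel. (cmod (h x - partial_sum a m x))\<^sup>2) \<longlonglongrightarrow> 0"
    by (rule L2_coefficients_limit)
  have "AE x in lborel. g x = h x"
  proof (rule L2_eq_if_equal_on_test_functions[OF gL h])
    fix f assume f: "f \<in> test_functions"
    have Hf: "helmholtz f \<in> L2" by (intro test_function_L2 test_function_helmholtz f)
    obtain R where R: "\<And>x. norm x \<ge> R \<Longrightarrow> f x = 0" using f by (metis test_functionE)
    have sub: "{j. f (X j) \<noteq> 0} \<subseteq> {j. norm (X j) \<le> R}"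
      using R by (auto intro: ccontr simp: not_le less_imp_le)
    obtain n where n: "{j. norm (X j) \<le> R} \<subseteq> {..<n}"
      using finite_in_ball finite_nat_iff_bounded by blast
    have pm: "(LINT x|lborel. partial_sum a m x * helmholtz f x) = (LINT x|lborel. g x * helmholtz f x)" if "m \<ge> n" for m
    proof -
      have "{j. f (X j) \<noteq> 0} \<subseteq> {..<m}" using sub n that by force
      from defect_pairing[OF g f finite_lessThan this]
      have "(LINT x|lborel. g x * helmholtz f x) = (\<Sum>j<m. f (X j) * coef g j)" .
      moreover have "of_real kappa * (\<Sum>k<m. a k * f (X k)) = (\<Sum>j<m. f (X j) * coef g j)"
        using kappa_pos by (simp add: a_def sum_distrib_left mult.commute)
      ultimately show ?thesis using integral_partial_sum_helmholtz[OF f, of a m] by simp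
    qed
    have le: "(cmod ((LINT x|lborel. h x * helmholtz f x) - (LINT x|lborel. g x * helmholtz f x)))\<^sup>2 \<le>
        (LINT x|lborel. (cmod (h x - partial_sum a m x))\<^sup>2) * (LINT x|lborel. (cmod (helmholtz f x))\<^sup>2)" if "m \<ge> n" for m
    proof -
      have "(LINT x|lborel. (h x - partial_sum a m x) * helmholtz f x) = (LINT x|lborel. h x * helmholtz f x) - (LINT x|lborel. partial_sum a m x * helmholtz f x)"
        unfolding left_diff_distrib
        by (intro Bochner_Integration.integral_diff L2_mult_integrable h partial_sum_L2 Hf)
      then show ?thesis
        using L2_Cauchy_Schwarz[OF L2_diff[OF h partial_sum_L2[of a m]] Hf] pm[OF that] by simp
    qed
    have "(cmod ((LINT x|lborel. h x * helmholtz f x) - (LINT x|lborel. g x * helmholtz f x)))\<^sup>2 \<le> 0"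
    proof (rule LIMSEQ_le_const)
      show "(\<lambda>m. (LINT x|lborel. (cmod (h x - partial_sum a m x))\<^sup>2) * (LINT x|lborel. (cmod (helmholtz f x))\<^sup>2)) \<longlonglongrightarrow> 0"
        using tendsto_mult_left_zero[OF lim] by simp
    qed (use le in blast)
    then show "(LINT x|lborel. g x * helmholtz f x) = (LINT x|lborel. h x * helmholtz f x)" by simp
  qed
  note ae = this
  note [measurable] = L2_measurable[OF gL] L2_measurable[OF h] L2_measurable[OF partial_sum_L2]
  have "(LINT x|lborel. (cmod (g x - partial_sum a m x))\<^sup>2) = (LINT x|lborel. (cmod (h x - partial_sum a m x))\<^sup>2)" for m
    by (rule integral_cong_AE) (use ae in \<open>auto elim: eventually_mono\<close>)
  then have "(\<lambda>m. sqrt (LINT x|lborel. (cmod (g x - partial_sum a m x))\<^sup>2)) \<longlonglongrightarrow> sqrt 0"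
    using lim by (intro tendsto_real_sqrt) simp
  then show ?thesis by (simp add: L2_norm_def a_def[abs_def])
qed

lemma L2_norm_square: "(L2_norm f)\<^sup>2 = (LINT x|lborel. (cmod (f x))\<^sup>2)"
  unfolding L2_norm_def by (rule real_sqrt_pow2) (rule Bochner_Integration.integral_nonneg, simp)

lemma riesz_basis_phi: "riesz_basis (phi X) (defect_subspace X)"
  unfolding riesz_basis_def
proof (intro conjI allI ballI impI)
  show "phi X k \<in> defect_subspace X" for k by (rule phi_in_defect_subspace)
next
  fix g and e :: real assume g: "g \<in> defect_subspace X" and e: "e > 0"
  obtain m where "norm (L2_norm (\<lambda>x. g x - partial_sum (\<lambda>k. coef g k / of_real kappa) m x) - 0) < e"
    using LIMSEQ_D[OF span_dense_in_defect_subspace[OF g] e] by blast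
  then have "L2_norm (\<lambda>x. g x - partial_sum (\<lambda>k. coef g k / of_real kappa) m x) < e" by simp
  moreover have "partial_sum (\<lambda>k. coef g k / of_real kappa) m \<in> linear_span (phi X)"
    unfolding linear_span_def partial_sum_def[abs_def]
    by (intro CollectI exI[of _ m] exI[of _ "\<lambda>k. coef g k / of_real kappa"]) simp
  ultimately show "\<exists>h\<in>linear_span (phi X). L2_norm (\<lambda>x. g x - h x) < e" by blast
next
  have sq: "(L2_norm (\<lambda>x. \<Sum>k<m. \<xi> k * phi X k x))\<^sup>2 = (LINT x|lborel. (cmod (partial_sum \<xi> m x))\<^sup>2)" for m \<xi>
    by (simp add: L2_norm_square partial_sum_def)
  have "kappa\<^sup>2 / bump_energy > 0" using kappa_pos bump_energy_pos by simp
  \<comment> \<open>The added 1 makes the upper constant strictly positive, as the definition of a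
    Riesz basis requires.\<close>
  moreover have "overlap_bound * weight_integral + 1 > 0" using overlap_bound_pos weight_integral_nonneg by (simp add: add_nonneg_pos)
  moreover have "(LINT x|lborel. (cmod (partial_sum \<xi> m x))\<^sup>2) \<le> (overlap_bound * weight_integral + 1) * (\<Sum>k<m. (cmod (\<xi> k))\<^sup>2)" for m \<xi>
  proof (rule order_trans[OF riesz_upper_bound])
    show "overlap_bound * weight_integral * (\<Sum>k<m. (cmod (\<xi> k))\<^sup>2) \<le> (overlap_bound * weight_integral + 1) * (\<Sum>k<m. (cmod (\<xi> k))\<^sup>2)"
      by (rule mult_right_mono) (auto intro: sum_nonneg)
  qed
  ultimately show "\<exists>c>0. \<exists>D>0. \<forall>m \<xi>. c * (\<Sum>k<m. (cmod (\<xi> k))\<^sup>2) \<le> (L2_norm (\<lambda>x. \<Sum>k<m. \<xi> k * phi X k x))\<^sup>2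
      \<and> (L2_norm (\<lambda>x. \<Sum>k<m. \<xi> k * phi X k x))\<^sup>2 \<le> D * (\<Sum>k<m. (cmod (\<xi> k))\<^sup>2)"
    unfolding sq using riesz_lower_bound by blast
qed

end

section \<open>Points without positive separation\<close>

lemma d_star_le: "k \<noteq> j \<Longrightarrow> d_star X \<le> norm (X k - X j)"
  unfolding d_star_def by (rule cInf_lower) (auto intro!: bdd_belowI[of _ 0])

lemma close_pair_if_d_star_nonpos:
  assumes "d_star X \<le> 0" "\<delta> > 0"
  obtains k j where "k \<noteq> j" "norm (X k - X j) < \<delta>"
proof -
  have "norm (X 0 - X 1) \<in> {norm (X k - X j) | k j. k \<noteq> j}"
    by (intro CollectI exI[of _ 0] exI[of _ 1]) simp
  moreover have "Inf {norm (X k - X j) | k j. k \<noteq> j} < \<delta>"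
    using assms by (simp add: d_star_def)
  ultimately have "\<exists>x\<in>{norm (X k - X j) | k j. k \<noteq> j}. x < \<delta>"
    by (intro cInf_lessD) auto
  then show ?thesis using that by blast
qed

lemma integral_yukawa_square: "(LINT x|lborel. (yukawa y x)\<^sup>2) = (LINT x|lborel. (yukawa 0 x)\<^sup>2)"
  using integral_translate[of "\<lambda>x. (yukawa 0 x)\<^sup>2" y] by (simp add: yukawa_def)

text \<open>
  Expanding the square reduces the claim to a lower bound for the cross term, for which
  \<open>norm (x - z) \<le> norm (x - y) + D\<close> is enough.
\<close>

lemma yukawa_close:
  assumes "e > 0"
  obtains \<delta> where "\<delta> > 0" "\<And>y z. norm (y - z) < \<delta> \<Longrightarrow> (LINT x|lborel. (yukawa y x - yukawa z x)\<^sup>2) < e"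
proof -
  \<comment> \<open>A lower bound for the product of two kernels whose centres are less than D
    apart, with the first centre moved to 0. It does not involve the position of the second centre,
    so the resulting estimate is uniform in both.\<close>
  define L where "L D x = exp (- (2 * norm x + D)) / (norm x * (norm x + D))" for D and x :: "real^3"
  define N where "N = (LINT x|lborel. (yukawa 0 x)\<^sup>2)"
  have L_le: "norm (L D x) \<le> (yukawa 0 x)\<^sup>2" if "D > 0" for D x
  proof (cases "x = 0")
    case False
    have "exp (- (2 * norm x + D)) / (norm x * (norm x + D)) \<le> exp (- 2 * norm x) / (norm x * norm x)"
      using that False by (intro frac_le mult_pos_pos mult_left_mono) auto
    moreover have "(yukawa 0 x)\<^sup>2 = exp (- 2 * norm x) / (norm x * norm x)"
      unfolding yukawa_square by (simp add: power2_eq_square)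
    ultimately show ?thesis using that by (simp only:) (simp add: L_def)
  qed (simp add: L_def)
  have Lm [measurable]: "L D \<in> borel_measurable borel" for D unfolding L_def[abs_def] by measurable
  have Li: "integrable lborel (L D)" if "D > 0" for D
    by (rule Bochner_Integration.integrable_bound[OF yukawa_square_integrable[of 0]])
      (use L_le[OF that] in auto)
  have "(\<lambda>n. LINT x|lborel. L (eps n) x) \<longlonglongrightarrow> N"
    unfolding N_def
  proof (rule integral_dominated_convergence[where w = "\<lambda>x. (yukawa 0 x)\<^sup>2"])
    show "AE x in lborel. (\<lambda>n. L (eps n) x) \<longlonglongrightarrow> (yukawa 0 x)\<^sup>2"
      using AE_lborel_singleton[of 0]
    proof eventually_elim
      fix x :: "real^3" assume "x \<noteq> 0"
      then show "(\<lambda>n. L (eps n) x) \<longlonglongrightarrow> (yukawa 0 x)\<^sup>2"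
        unfolding L_def yukawa_square by (auto intro!: tendsto_eq_intros eps_tendsto simp: power2_eq_square)
    qed
  qed (use yukawa_square_integrable L_le eps_pos in auto)
  \<comment> \<open>Accuracy e / 2, because the cross term enters the expanded square with the
    factor 2.\<close>
  then obtain n where n: "norm ((LINT x|lborel. L (eps n) x) - N) < e / 2"
    using LIMSEQ_D[of _ N "e / 2"] assms by fastforce
  have "(LINT x|lborel. (yukawa y x - yukawa z x)\<^sup>2) < e" if yz: "norm (y - z) < eps n" for y z
  proof -
    have ip: "integrable lborel (\<lambda>x. yukawa y x * yukawa z x)"
      using L2_mult_integrable[OF yukawa_L2[of y] yukawa_L2[of z]]
      by (simp only: of_real_mult[symmetric] complex_of_real_integrable_eq)
    have "(LINT x|lborel. L (eps n) x) = (LINT x|lborel. L (eps n) (x - y))"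
      by (rule integral_translate[symmetric]) measurable
    also have "\<dots> \<le> (LINT x|lborel. yukawa y x * yukawa z x)"
    proof (rule integral_mono_AE)
      show "integrable lborel (\<lambda>x. L (eps n) (x - y))"
        using Li[OF eps_pos] by (simp add: integrable_translate)
      show "AE x in lborel. L (eps n) (x - y) \<le> yukawa y x * yukawa z x"
        using AE_lborel_singleton[of y] AE_lborel_singleton[of z]
      proof eventually_elim
        fix x assume "x \<noteq> y" "x \<noteq> z"
        then have p: "norm (x - y) > 0" "norm (x - z) > 0" by auto
        have t: "norm (x - z) \<le> norm (x - y) + eps n"
          using norm_triangle_ineq[of "x - y" "y - z"] yz by simp
        have "exp (- (2 * norm (x - y) + eps n)) / (norm (x - y) * (norm (x - y) + eps n)) \<le>
           exp (- (norm (x - y) + norm (x - z))) / (norm (x - y) * norm (x - z))"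
          using p t by (intro frac_le mult_pos_pos mult_left_mono) auto
        then show "L (eps n) (x - y) \<le> yukawa y x * yukawa z x"
          by (simp add: L_def yukawa_def exp_add[symmetric])
      qed
    qed (rule ip)
    finally have low: "(LINT x|lborel. L (eps n) x) \<le> (LINT x|lborel. yukawa y x * yukawa z x)" .
    have "(LINT x|lborel. (yukawa y x - yukawa z x)\<^sup>2) =
        (LINT x|lborel. (yukawa y x)\<^sup>2 + (yukawa z x)\<^sup>2 - 2 * (yukawa y x * yukawa z x))"
      by (simp add: power2_diff mult.assoc)
    also have "\<dots> = (LINT x|lborel. (yukawa y x)\<^sup>2 + (yukawa z x)\<^sup>2) - (LINT x|lborel. 2 * (yukawa y x * yukawa z x))"
      by (intro Bochner_Integration.integral_diff Bochner_Integration.integrable_add yukawa_square_integrable integrable_mult_right ip)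
    also have "\<dots> = 2 * N - 2 * (LINT x|lborel. yukawa y x * yukawa z x)"
      using yukawa_square_integrable by (simp add: N_def integral_yukawa_square[of y] integral_yukawa_square[of z])
    finally show ?thesis using low n by (simp only: real_norm_def)
  qed
  then show ?thesis using that eps_pos by blast
qed

lemma not_riesz_basis_if_d_star_nonpos:
  assumes "d_star X \<le> 0"
  shows "\<not> riesz_basis (phi X) N"
proof
  assume "riesz_basis (phi X) N"
  then obtain c where c: "c > 0" "\<And>m \<xi>. c * (\<Sum>k<m. (cmod (\<xi> k))\<^sup>2) \<le> (L2_norm (\<lambda>x. \<Sum>k<m. \<xi> k * phi X k x))\<^sup>2"
    unfolding riesz_basis_def by blast
  obtain \<delta> where \<delta>: "\<delta> > 0" "\<And>y z. norm (y - z) < \<delta> \<Longrightarrow> (LINT x|lborel. (yukawa y x - yukawa z x)\<^sup>2) < c"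
    using yukawa_close[OF c(1)] by blast
  obtain k j where kj: "k \<noteq> j" "norm (X k - X j) < \<delta>"
    using close_pair_if_d_star_nonpos[OF assms \<delta>(1)] by blast
  \<comment> \<open>The coefficients of \<open>phi X k\<close> minus \<open>phi X j\<close>. The
    k-th one alone makes the sum of squares at least 1, so the lower Riesz bound gives at least
    c.\<close>
  define \<xi> :: "nat \<Rightarrow> complex" where "\<xi> i = (if i = k then 1 else 0) - (if i = j then 1 else 0)" for i
  define m where "m = Suc (max k j)"
  have mem: "k < m" "j < m" by (auto simp: m_def)
  have "(\<Sum>i<m. \<xi> i * phi X i x) = (\<Sum>i<m. (if i = k then phi X i x else 0) - (if i = j then phi X i x else 0))" for x
    by (rule sum.cong) (auto simp: \<xi>_def)
  then have sm: "(\<Sum>i<m. \<xi> i * phi X i x) = phi X k x - phi X j x" for x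
    using mem by (simp add: sum_subtractf)
  have "cmod (\<xi> k) \<le> 1 \<and> \<xi> k = 1" using kj by (simp add: \<xi>_def)
  then have "1 = (\<Sum>i\<in>{k}. (cmod (\<xi> i))\<^sup>2)" by simp
  also have "\<dots> \<le> (\<Sum>i<m. (cmod (\<xi> i))\<^sup>2)" by (rule sum_mono2) (use mem in auto)
  finally have "c * 1 \<le> c * (\<Sum>i<m. (cmod (\<xi> i))\<^sup>2)" using c(1) by (intro mult_left_mono) auto
  also have "\<dots> \<le> (L2_norm (\<lambda>x. phi X k x - phi X j x))\<^sup>2"
    using c(2)[where \<xi> = \<xi> and m = m] unfolding sm .
  also have "\<dots> = (LINT x|lborel. (yukawa (X k) x - yukawa (X j) x)\<^sup>2)"
  proof -
    have "cmod (phi X k x - phi X j x) = \<bar>yukawa (X k) x - yukawa (X j) x\<bar>" for x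
      by (simp only: phi_eq_yukawa of_real_diff[symmetric] norm_of_real)
    moreover have "(LINT x|lborel. (yukawa (X k) x - yukawa (X j) x)\<^sup>2) \<ge> 0"
      by (rule Bochner_Integration.integral_nonneg) simp
    ultimately show ?thesis by (simp add: L2_norm_def)
  qed
  also have "\<dots> < c" by (rule \<delta>(2)[OF kj(2)])
  finally show False by simp
qed

theorem theorem3p8:
  fixes X :: "nat \<Rightarrow> real^3"
  assumes "inj X"
  shows "riesz_basis (phi X) (defect_subspace X) \<longleftrightarrow> d_star X > 0"
proof
  assume "riesz_basis (phi X) (defect_subspace X)"
  then show "d_star X > 0"
    using not_riesz_basis_if_d_star_nonpos not_le by blast
next
  assume "d_star X > 0"
  then interpret separated X "d_star X"
    by unfold_locales (auto intro: d_star_le)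
  show "riesz_basis (phi X) (defect_subspace X)" by (rule riesz_basis_phi)
qed

end
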